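(* (Generalization bound for projection pursuit, $\ell_2$-norm on input weights.) Let $d,k,n \geq 1$ be integers and $R,\eta,G > 0$. Let $f_\ast(x) = \sum_{j=1}^k f_j(w_j^\top x)$, where $w_j \in \mathbb{R}^d$ with $\|w_j\|_2 \leq \eta$ and each $f_j : \mathbb{R} \to \mathbb{R}$ is bounded in absolute value by $\eta R$ and $1$-Lipschitz continuous. Suppose $\|x\|_2 \leq R$ almost surely. For $\delta>0$ let $\hat f_\delta$ denote a minimizer of the empirical risk $\hat J$ over $\{f \in \mathcal{F}_1 : \gamma_1(f) \leq \delta\}$. (i) For every integer $\alpha \geq 1$ there is a constant $C(\alpha)$ depending only on $\alpha$ such that, with $\delta = k \eta R\, n^{\alpha/(2(\alpha+1))}$, if the loss satisfies assumption (L) with constants $G$ and $\delta$, then $$\mathbb{E}\big[J(\hat f_\delta)\big] - J(f_\ast) \leq C(\alpha)\, k G R \eta\, \frac{\log n}{n^{1/(2\alpha+2)}}.$$ (ii) For $\alpha = 0$ there are universal constants $c, C$ such that $f_\ast \in \mathcal{F}_1$ with $\gamma_1(f_\ast) \leq c\,kR\eta$ and, with $\delta = c\, k R \eta$, if the loss satisfies assumption (L) with constants $G$ and $\delta$, then $$\mathbb{E}\big[J(\hat f_\delta)\big] - J(f_\ast) \leq C\, \frac{k G R \eta \sqrt{d}}{\sqrt{n}}.$$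
   Context: Write $(u)_+^\alpha = \max\{u,0\}^\alpha$, with the convention $0^0=0$ (so it is $1_{u>0}$ for $\alpha=0$). For $x \in \mathbb{R}^d$ let $z = (x^\top, R)^\top \in \mathbb{R}^{d+1}$ and let $\mathcal{V} = \{v \in \mathbb{R}^{d+1} : \|v\|_2 = 1/R\}$. $\mathcal{F}_1$ (which depends on $\alpha$) is the space of functions on $\{\|x\|_2 \leq R\}$ of the form $f(x) = \int_{\mathcal{V}} (v^\top z)_+^\alpha \, d\mu(v)$ with $\mu$ a signed Radon measure on $\mathcal{V}$ of finite total variation; $\gamma_1(f)$ is the infimum of the total variation $|\mu|(\mathcal{V})$ over all such representations. $(x,y)$ is a random pair in $\mathbb{R}^d \times \mathcal{Y}$, $(x_i,y_i)_{i=1}^n$ are i.i.d. copies, $\ell : \mathcal{Y} \times \mathbb{R} \to \mathbb{R}$ is a loss function, $J(f) = \mathbb{E}[\ell(y,f(x))]$ and $\hat J(f) = \frac1n \sum_{i=1}^n \ell(y_i,f(x_i))$. The outer expectation is over the $n$ observations. Assumption (L) with constants $G,\delta$: for all $y$, the function $u \mapsto \ell(y,u)$ is $G$-Lipschitz continuous on $\{|u| \leq \sqrt{2}\, \delta\}$, and almost surely $\ell(y,0) \leq G\delta$.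
   Formalization: In (i), n ≥ 2 is required (at n = 1 the bound is 0 and fails), and for α ≥ 2 assumption (L) asks the loss to be G-Lipschitz on |u| ≤ 2^(α/2) δ, the range predictors attain, instead of |u| ≤ √2 δ, where the claim is false. *)

theory Defs
  imports "HOL-Probability.Probability"
begin

text \<open>
  The constants of the theorem must not depend on the dimension, so the dimension is a natural
  number quantified inside the statement: \<open>\<real>\<^sup>d\<close> is the space of extensional functions on
  \<open>{..<d}\<close>, with the product Borel sets and the Euclidean norm \<^term>\<open>L2_set x {..<d}\<close>.
\<close>

abbreviation borel_vec :: "nat \<Rightarrow> (nat \<Rightarrow> real) measure" where
  "borel_vec d \<equiv> (\<Pi>\<^sub>M i\<in>{..<d}. borel)"

definition dot :: "nat \<Rightarrow> (nat \<Rightarrow> real) \<Rightarrow> (nat \<Rightarrow> real) \<Rightarrow> real" where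
  "dot d u v = (\<Sum>i<d. u i * v i)"

definition input_ball :: "nat \<Rightarrow> real \<Rightarrow> (nat \<Rightarrow> real) set" where
  "input_ball d R = {x \<in> space (borel_vec d). L2_set x {..<d} \<le> R}"

definition weight_sphere :: "nat \<Rightarrow> real \<Rightarrow> (nat \<Rightarrow> real) set" where
  "weight_sphere d R = {v \<in> space (borel_vec (Suc d)). L2_set v {..<Suc d} = 1 / R}"

text \<open>The vector \<open>z = (x, R)\<close>: the new coordinate has index \<open>d\<close>.\<close>

definition lift_input :: "nat \<Rightarrow> real \<Rightarrow> (nat \<Rightarrow> real) \<Rightarrow> (nat \<Rightarrow> real)" where
  "lift_input d R x = x(d := R)"

text \<open>The convention \<open>0\<^sup>0 = 0\<close> differs from the library's \<^prop>\<open>(0::real) ^ 0 = 1\<close>.\<close>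

definition pos_power :: "nat \<Rightarrow> real \<Rightarrow> real" where
  "pos_power \<alpha> u = (if u > 0 then u ^ \<alpha> else 0)"


text \<open>
  Finite signed measures, as countably additive real-valued set functions on \<^term>\<open>sets M\<close>.
  On the sphere, a compact metric space, every finite signed Borel measure is Radon.
\<close>

definition signed_measure :: "'a measure \<Rightarrow> ('a set \<Rightarrow> real) \<Rightarrow> bool" where
  "signed_measure M \<nu> \<longleftrightarrow> \<nu> {} = 0 \<and>
     (\<forall>A :: nat \<Rightarrow> 'a set. range A \<subseteq> sets M \<longrightarrow> disjoint_family A \<longrightarrow>
        (\<lambda>i. \<nu> (A i)) sums \<nu> (\<Union>i. A i))"

definition total_variation :: "'a measure \<Rightarrow> ('a set \<Rightarrow> real) \<Rightarrow> ennreal" where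
  "total_variation M \<nu> =
     (SUP P \<in> {P. finite P \<and> P \<subseteq> sets M \<and> partition_on (space M) P}. \<Sum>A\<in>P. ennreal \<bar>\<nu> A\<bar>)"

text \<open>
  The positive part \<open>\<nu>\<^sup>+\<close> of the Jordan decomposition; the negative part is the positive part
  of \<open>- \<nu>\<close>. Since \<^term>\<open>ennreal\<close> sends negative reals to 0 and \<open>\<nu> {} = 0\<close>, the truncation does not
  affect the supremum.
\<close>

definition positive_part :: "'a measure \<Rightarrow> ('a set \<Rightarrow> real) \<Rightarrow> 'a measure" where
  "positive_part M \<nu> =
     measure_of (space M) (sets M) (\<lambda>A. SUP B \<in> {B \<in> sets M. B \<subseteq> A}. ennreal (\<nu> B))"

definition signed_integral :: "'a measure \<Rightarrow> ('a set \<Rightarrow> real) \<Rightarrow> ('a \<Rightarrow> real) \<Rightarrow> real" where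
  "signed_integral M \<nu> f =
     (\<integral>x. f x \<partial>positive_part M \<nu>) - (\<integral>x. f x \<partial>positive_part M (\<lambda>A. - \<nu> A))"


definition weight_space :: "nat \<Rightarrow> real \<Rightarrow> (nat \<Rightarrow> real) measure" where
  "weight_space d R = restrict_space (borel_vec (Suc d)) (weight_sphere d R)"

text \<open>Functions on the input ball are total functions made extensional by \<^const>\<open>restrict\<close>.\<close>

definition represents ::
    "nat \<Rightarrow> real \<Rightarrow> nat \<Rightarrow> ((nat \<Rightarrow> real) set \<Rightarrow> real) \<Rightarrow> ((nat \<Rightarrow> real) \<Rightarrow> real) \<Rightarrow> bool" where
  "represents d R \<alpha> \<mu> f \<longleftrightarrow>
     signed_measure (weight_space d R) \<mu> \<and> total_variation (weight_space d R) \<mu> < \<infinity> \<and>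
     f = restrict (\<lambda>x. signed_integral (weight_space d R) \<mu>
                         (\<lambda>v. pos_power \<alpha> (dot (Suc d) v (lift_input d R x)))) (input_ball d R)"

definition F1 :: "nat \<Rightarrow> real \<Rightarrow> nat \<Rightarrow> ((nat \<Rightarrow> real) \<Rightarrow> real) set" where
  "F1 d R \<alpha> = {f. \<exists>\<mu>. represents d R \<alpha> \<mu> f}"

definition gamma1 :: "nat \<Rightarrow> real \<Rightarrow> nat \<Rightarrow> ((nat \<Rightarrow> real) \<Rightarrow> real) \<Rightarrow> ennreal" where
  "gamma1 d R \<alpha> f = (INF \<mu> \<in> {\<mu>. represents d R \<alpha> \<mu> f}. total_variation (weight_space d R) \<mu>)"

definition F1_ball :: "nat \<Rightarrow> real \<Rightarrow> nat \<Rightarrow> real \<Rightarrow> ((nat \<Rightarrow> real) \<Rightarrow> real) set" where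
  "F1_ball d R \<alpha> \<delta> = {f \<in> F1 d R \<alpha>. gamma1 d R \<alpha> f \<le> ennreal \<delta>}"


text \<open>\<open>D\<close> is the law of the pair \<open>(x, y)\<close>; labels live in an arbitrary measurable space \<open>Y\<close>.\<close>

definition data_law ::
    "nat \<Rightarrow> real \<Rightarrow> 'y measure \<Rightarrow> ((nat \<Rightarrow> real) \<times> 'y) measure \<Rightarrow> bool" where
  "data_law d R Y D \<longleftrightarrow>
     prob_space D \<and> sets D = sets (borel_vec d \<Otimes>\<^sub>M Y) \<and> (AE p in D. L2_set (fst p) {..<d} \<le> R)"

definition risk ::
    "((nat \<Rightarrow> real) \<times> 'y) measure \<Rightarrow> ('y \<Rightarrow> real \<Rightarrow> real) \<Rightarrow> ((nat \<Rightarrow> real) \<Rightarrow> real) \<Rightarrow> real" where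
  "risk D loss f = (\<integral>p. loss (snd p) (f (fst p)) \<partial>D)"

definition empirical_risk ::
    "nat \<Rightarrow> ('y \<Rightarrow> real \<Rightarrow> real) \<Rightarrow> (nat \<Rightarrow> (nat \<Rightarrow> real) \<times> 'y) \<Rightarrow> ((nat \<Rightarrow> real) \<Rightarrow> real) \<Rightarrow> real" where
  "empirical_risk n loss s f = (\<Sum>i<n. loss (snd (s i)) (f (fst (s i)))) / real n"

text \<open>The law of the \<open>n\<close> i.i.d. observations.\<close>

abbreviation sample_law :: "nat \<Rightarrow> 'b measure \<Rightarrow> (nat \<Rightarrow> 'b) measure" where
  "sample_law n D \<equiv> (\<Pi>\<^sub>M i\<in>{..<n}. D)"

text \<open>
  A sample-dependent empirical risk minimizer. Measurability of its risk is what gives meaning to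
  the outer expectation: a Bochner integral of a non-measurable function would be 0.
\<close>

definition empirical_minimizer ::
    "nat \<Rightarrow> real \<Rightarrow> nat \<Rightarrow> real \<Rightarrow> nat \<Rightarrow> ((nat \<Rightarrow> real) \<times> 'y) measure \<Rightarrow> ('y \<Rightarrow> real \<Rightarrow> real) \<Rightarrow>
     ((nat \<Rightarrow> (nat \<Rightarrow> real) \<times> 'y) \<Rightarrow> (nat \<Rightarrow> real) \<Rightarrow> real) \<Rightarrow> bool" where
  "empirical_minimizer d R \<alpha> \<delta> n D loss fhat \<longleftrightarrow>
     (AE s in sample_law n D. fhat s \<in> F1_ball d R \<alpha> \<delta> \<and>
        (\<forall>f \<in> F1_ball d R \<alpha> \<delta>. empirical_risk n loss s (fhat s) \<le> empirical_risk n loss s f)) \<and>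
     (\<lambda>s. risk D loss (fhat s)) \<in> borel_measurable (sample_law n D)"

text \<open>
  Assumption (L). Elements of the ball of radius \<open>\<delta>\<close> are only bounded by \<open>(sqrt 2) ^ \<alpha> * \<delta>\<close> on the
  inputs, because \<open>v\<^sup>T z \<le> sqrt 2\<close>. For \<open>\<alpha> \<le> 1\<close> the range below is \<open>{\<bar>u\<bar> \<le> sqrt 2 * \<delta>}\<close>; for
  \<open>\<alpha> \<ge> 2\<close> that range would leave the loss uncontrolled at values that predictors attain, and the
  generalization bound would be false.
\<close>

definition assumption_L ::
    "nat \<Rightarrow> 'y measure \<Rightarrow> ((nat \<Rightarrow> real) \<times> 'y) measure \<Rightarrow> ('y \<Rightarrow> real \<Rightarrow> real) \<Rightarrow> real \<Rightarrow> real \<Rightarrow> bool" where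
  "assumption_L \<alpha> Y D loss G \<delta> \<longleftrightarrow>
     (\<lambda>(y, u). loss y u) \<in> borel_measurable (Y \<Otimes>\<^sub>M borel) \<and>
     (\<forall>y \<in> space Y. lipschitz_on G {u. \<bar>u\<bar> \<le> sqrt 2 ^ max 1 \<alpha> * \<delta>} (loss y)) \<and>
     (AE p in D. loss (snd p) 0 \<le> G * \<delta>)"

definition projection_pursuit_params ::
    "nat \<Rightarrow> nat \<Rightarrow> real \<Rightarrow> real \<Rightarrow> (nat \<Rightarrow> nat \<Rightarrow> real) \<Rightarrow> (nat \<Rightarrow> real \<Rightarrow> real) \<Rightarrow> bool" where
  "projection_pursuit_params d k R \<eta> w f \<longleftrightarrow>
     (\<forall>j<k. w j \<in> space (borel_vec d) \<and> L2_set (w j) {..<d} \<le> \<eta> \<and>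
            (\<forall>t. \<bar>f j t\<bar> \<le> \<eta> * R) \<and> lipschitz_on 1 UNIV (f j))"

definition projection_pursuit ::
    "nat \<Rightarrow> nat \<Rightarrow> (nat \<Rightarrow> nat \<Rightarrow> real) \<Rightarrow> (nat \<Rightarrow> real \<Rightarrow> real) \<Rightarrow> (nat \<Rightarrow> real) \<Rightarrow> real" where
  "projection_pursuit d k w f x = (\<Sum>j<k. f j (dot d (w j) x))"

end

theory Submission
  imports Defs
begin

text \<open>
  The deviation of the empirical risk over a ball of the space is controlled by symmetrization and
  contraction, because the ball is the closed symmetric convex hull of single neurons. For
  \<open>\<alpha> \<ge> 1\<close> a second contraction replaces a neuron by a linear form; for \<open>\<alpha> = 0\<close> the neurons are
  indicators of halfspaces, and chaining over Dudley's packing numbers gives \<open>sqrt (d n)\<close> without a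
  logarithm. A supremum over the ball need not be measurable, so it is replaced by one over the
  countably many networks with grid weights, which are pointwise dense.

  The approximation error is bounded ridge function by ridge function. For \<open>\<alpha> \<ge> 1\<close>, quasi-interpolation
  by B-splines with knot distance \<open>\<epsilon>\<close> is a combination of truncated powers, that is, of neurons, with
  error \<open>O(\<epsilon>)\<close> and total weight \<open>O(\<epsilon>\<^sup>-\<^sup>\<alpha>)\<close>. For \<open>\<alpha> = 0\<close> there is no error: a 1-Lipschitz \<open>f\<close> is the
  difference of the monotone functions \<open>(t + f t) / 2\<close> and \<open>(t - f t) / 2\<close>, and their Stieltjes measures
  represent it exactly.
\<close>

section \<open>Averages over signs\<close>

text \<open>The radius \<delta> is the balance point of two errors: with \<epsilon> of order
  n^(-1/(2\<alpha>+2)) the weight \<epsilon>^(-\<alpha>) grows like n^(\<alpha>/(2\<alpha>+2)), and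
  the deviation of the empirical risk, of order \<delta> / sqrt n, is then again of order
  \<epsilon>. The comparison function is fixed before the sample is drawn, so the mean of its
  empirical risk is its risk, and only the one-sided supremum of risk minus empirical risk has to be
  bounded. Three obstacles shape the details. The infimum in \<open>gamma1\<close> is only
  approached, and rounded weights leave the sphere; total weight 2\<delta> and weight norm 2/R leave
  room for both at the price of constants. Such networks may leave the range on which the loss is
  Lipschitz, so their outputs are clipped; clipping is 1-Lipschitz and costs nothing under
  contraction. The loss at 0 is bounded above only, so the argument works with the difference to the
  loss at 0, which is bounded.\<close>

primrec sign_avg :: "nat \<Rightarrow> ((nat \<Rightarrow> real) \<Rightarrow> real) \<Rightarrow> real" where
  "sign_avg 0 F = F (\<lambda>_. 0)"
| "sign_avg (Suc n) F = (sign_avg n (\<lambda>\<sigma>. F (\<sigma>(n := 1))) + sign_avg n (\<lambda>\<sigma>. F (\<sigma>(n := -1)))) / 2"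

text \<open>These are exactly the arguments at which \<open>sign_avg n\<close> evaluates its
  function; the entries from \<open>n\<close> on stay 0 because the recursion starts from the zero
  function.\<close>

definition sign_vectors :: "nat \<Rightarrow> (nat \<Rightarrow> real) set" where
  "sign_vectors n = {\<sigma>. \<forall>i. if i < n then \<sigma> i = 1 \<or> \<sigma> i = -1 else \<sigma> i = 0}"

lemma sign_vectors_upd:
  "\<sigma> \<in> sign_vectors n \<Longrightarrow> \<sigma>(n := 1) \<in> sign_vectors (Suc n)"
  "\<sigma> \<in> sign_vectors n \<Longrightarrow> \<sigma>(n := -1) \<in> sign_vectors (Suc n)"
  by (auto simp: sign_vectors_def less_Suc_eq)

lemma sign_avg_mono:
  "(\<And>\<sigma>. \<sigma> \<in> sign_vectors n \<Longrightarrow> F \<sigma> \<le> G \<sigma>) \<Longrightarrow> sign_avg n F \<le> sign_avg n G"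
proof (induction n arbitrary: F G)
  case 0
  from 0[of "\<lambda>_. 0"] show ?case by (simp add: sign_vectors_def)
next
  case (Suc n)
  have "sign_avg n (\<lambda>\<sigma>. F (\<sigma>(n := 1))) \<le> sign_avg n (\<lambda>\<sigma>. G (\<sigma>(n := 1)))"
    "sign_avg n (\<lambda>\<sigma>. F (\<sigma>(n := -1))) \<le> sign_avg n (\<lambda>\<sigma>. G (\<sigma>(n := -1)))"
    by (rule Suc.IH, rule Suc.prems, erule sign_vectors_upd)+
  then show ?case by simp
qed

lemma sign_avg_cong:
  "(\<And>\<sigma>. \<sigma> \<in> sign_vectors n \<Longrightarrow> F \<sigma> = G \<sigma>) \<Longrightarrow> sign_avg n F = sign_avg n G"
  by (intro antisym sign_avg_mono) auto

lemma sign_avg_const [simp]: "sign_avg n (\<lambda>_. c) = c"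
  by (induction n) auto

lemma sign_avg_add: "sign_avg n (\<lambda>\<sigma>. F \<sigma> + G \<sigma>) = sign_avg n F + sign_avg n G"
  by (induction n arbitrary: F G) (auto simp: field_simps)

lemma sign_avg_cmult: "sign_avg n (\<lambda>\<sigma>. c * F \<sigma>) = c * sign_avg n F"
  by (induction n arbitrary: F) (auto simp: field_simps)

lemma sign_avg_diff: "sign_avg n (\<lambda>\<sigma>. F \<sigma> - G \<sigma>) = sign_avg n F - sign_avg n G"
  using sign_avg_add[of n F "\<lambda>\<sigma>. -1 * G \<sigma>"] sign_avg_cmult[of n "-1" G] by simp

lemma sign_avg_sum: "sign_avg n (\<lambda>\<sigma>. \<Sum>i\<in>I. F i \<sigma>) = (\<Sum>i\<in>I. sign_avg n (F i))"
  by (induction I rule: infinite_finite_induct) (auto simp: sign_avg_add)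

text \<open>Flipping every sign only exchanges the two halves of each recursion step, and the
  initial zero function is its own negative.\<close>

lemma sign_avg_uminus: "sign_avg n (\<lambda>\<sigma>. F (\<lambda>i. - \<sigma> i)) = sign_avg n F"
proof (induction n arbitrary: F)
  case (Suc n)
  have *: "(\<lambda>i. - (\<sigma>(n := x)) i) = (\<lambda>i. - \<sigma> i)(n := -x)" for x :: real and \<sigma>
    by auto
  show ?case
    unfolding sign_avg.simps * using Suc.IH[of "\<lambda>\<sigma>. F (\<sigma>(n := -1))"] Suc.IH[of "\<lambda>\<sigma>. F (\<sigma>(n := 1))"]
    by simp
qed simp

text \<open>Independence of the signs: averaging over the last sign splits off one factor
  \<open>cosh\<close>.\<close>

lemma sign_avg_prod_exp:
  "sign_avg n (\<lambda>\<sigma>. exp (\<Sum>i<n. \<sigma> i * a i)) = (\<Prod>i<n. cosh (a i))"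
proof (induction n)
  case (Suc n)
  have "sign_avg (Suc n) (\<lambda>\<sigma>. exp (\<Sum>i<Suc n. \<sigma> i * a i)) =
     (sign_avg n (\<lambda>\<sigma>. exp (a n) * exp (\<Sum>i<n. \<sigma> i * a i)) + sign_avg n (\<lambda>\<sigma>. exp (- a n) * exp (\<Sum>i<n. \<sigma> i * a i))) / 2"
    by (simp add: exp_add mult_ac)
  also have "\<dots> = cosh (a n) * (\<Prod>i<n. cosh (a i))"
    by (simp add: sign_avg_cmult Suc.IH cosh_def field_simps)
  finally show ?case by (simp add: mult_ac)
qed simp

text \<open>The signs are orthonormal, so the mixed terms cancel. The summand \<open>c\<close> is
  there for the induction, where it absorbs \<open>a n\<close> or \<open>- a n\<close>.\<close>

lemma sign_avg_square: "sign_avg n (\<lambda>\<sigma>. (c + (\<Sum>i<n. \<sigma> i * a i))\<^sup>2) = c\<^sup>2 + (\<Sum>i<n. (a i)\<^sup>2)"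
proof (induction n arbitrary: c)
  case (Suc n)
  have "sign_avg (Suc n) (\<lambda>\<sigma>. (c + (\<Sum>i<Suc n. \<sigma> i * a i))\<^sup>2) =
     (sign_avg n (\<lambda>\<sigma>. ((c + a n) + (\<Sum>i<n. \<sigma> i * a i))\<^sup>2) + sign_avg n (\<lambda>\<sigma>. ((c - a n) + (\<Sum>i<n. \<sigma> i * a i))\<^sup>2)) / 2"
    by (simp add: algebra_simps)
  also have "\<dots> = c\<^sup>2 + (\<Sum>i<Suc n. (a i)\<^sup>2)"
    unfolding Suc.IH by (simp add: power2_eq_square algebra_simps)
  finally show ?case .
qed simp

text \<open>Jensen's inequality for the square, from F \<le> (F^2 / r + r) / 2. Taking the upper
  bound \<open>r\<close> as a parameter avoids the root of an average that may vanish.\<close>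

lemma sign_avg_le_sqrt:
  assumes "sign_avg n (\<lambda>\<sigma>. (F \<sigma>)\<^sup>2) \<le> r\<^sup>2" "r > 0"
  shows "sign_avg n F \<le> r"
proof -
  have "F \<sigma> \<le> ((1 / r) * (F \<sigma>)\<^sup>2 + r) / 2" for \<sigma>
  proof -
    have "0 \<le> (F \<sigma> - r)\<^sup>2" by simp
    then show ?thesis using \<open>r > 0\<close> by (simp add: field_simps power2_eq_square)
  qed
  then have "sign_avg n F \<le> sign_avg n (\<lambda>\<sigma>. (1/2) * ((1 / r) * (F \<sigma>)\<^sup>2 + r))"
    by (intro sign_avg_mono) simp
  also have "\<dots> = (1/2) * ((1 / r) * sign_avg n (\<lambda>\<sigma>. (F \<sigma>)\<^sup>2) + r)"
    by (simp only: sign_avg_cmult sign_avg_add sign_avg_const)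
  also have "\<dots> \<le> (1/2) * ((1 / r) * r\<^sup>2 + r)"
    using assms by (intro mult_left_mono add_right_mono) auto
  also have "\<dots> = r" using \<open>r > 0\<close> by (simp add: power2_eq_square)
  finally show ?thesis .
qed

section \<open>Subgaussian exponential moments and Massart's finite class lemma\<close>

lemma tanh_le_self: "(0::real) \<le> x \<Longrightarrow> tanh x \<le> x"
proof -
  assume x: "0 \<le> x"
  have "\<exists>y. ((\<lambda>x. x - tanh x) has_real_derivative y) (at t) \<and> 0 \<le> y" for t :: real
    by (intro exI[of _ "tanh t ^ 2"] conjI) (auto intro!: derivative_eq_intros)
  from DERIV_nonneg_imp_nondecreasing[OF x this]
  show ?thesis by simp
qed

text \<open>A single sign is subgaussian with variance 1. On the positive axis the difference of the
  logarithms has derivative t - tanh t, and both sides are even.\<close>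

lemma cosh_le_exp_half_square: "cosh x \<le> exp (x\<^sup>2 / 2)" for x :: real
proof -
  have pos: "cosh x \<le> exp (x\<^sup>2 / 2)" if x: "0 \<le> x" for x :: real
  proof -
    have "\<exists>y. ((\<lambda>x. x\<^sup>2 / 2 - ln (cosh x)) has_real_derivative y) (at t) \<and> 0 \<le> y" if "0 \<le> t" "t \<le> x" for t :: real
      using tanh_le_self[of t] that
      by (intro exI[of _ "t - tanh t"] conjI)
        (auto intro!: derivative_eq_intros simp: tanh_def)
    from DERIV_nonneg_imp_nondecreasing[OF x this]
    have "ln (cosh x) \<le> x\<^sup>2 / 2" by simp
    then show ?thesis by (metis cosh_real_pos exp_le_cancel_iff exp_ln)
  qed
  show ?thesis using pos[of x] pos[of "-x"] by (cases "x \<ge> 0") auto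
qed

lemma sign_avg_exp_le:
  "sign_avg n (\<lambda>\<sigma>. exp (\<Sum>i<n. \<sigma> i * a i)) \<le> exp ((\<Sum>i<n. (a i)\<^sup>2) / 2)"
proof -
  have "(\<Prod>i<n. cosh (a i)) \<le> (\<Prod>i<n. exp ((a i)\<^sup>2 / 2))"
    by (intro prod_mono) (auto simp: cosh_le_exp_half_square cosh_real_nonneg)
  then show ?thesis by (subst sign_avg_prod_exp) (simp add: exp_sum sum_divide_distrib)
qed

text \<open>Jensen's inequality from the tangent of \<open>exp\<close> at the average.\<close>

lemma exp_sign_avg_le: "exp (sign_avg n F) \<le> sign_avg n (\<lambda>\<sigma>. exp (F \<sigma>))"
proof -
  let ?m = "sign_avg n F"
  have "exp ?m * (1 + (F \<sigma> - ?m)) \<le> exp (F \<sigma>)" for \<sigma>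
  proof -
    have "exp ?m * (1 + (F \<sigma> - ?m)) \<le> exp ?m * exp (F \<sigma> - ?m)"
      using exp_ge_add_one_self[of "F \<sigma> - ?m"] by (intro mult_left_mono) auto
    then show ?thesis by (simp add: exp_diff)
  qed
  then have "sign_avg n (\<lambda>\<sigma>. exp ?m * (1 + (F \<sigma> - ?m))) \<le> sign_avg n (\<lambda>\<sigma>. exp (F \<sigma>))"
    by (intro sign_avg_mono) auto
  then show ?thesis by (simp add: sign_avg_cmult sign_avg_add sign_avg_diff)
qed

text \<open>Exponential moment method: the exponential of the maximum is at most the sum of the
  exponentials over both signs, which is the origin of the 2 in \<open>ln (2 * M)\<close>. Only an
  upper bound \<open>M\<close> of the cardinality enters, so chaining can insert entropy bounds
  directly.\<close>

lemma massart_finite_class: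
  assumes fin: "finite A" "A \<noteq> {}" and card: "real (card A) \<le> M"
    and norm: "\<And>a. a \<in> A \<Longrightarrow> (\<Sum>i<n. (a i)\<^sup>2) \<le> r\<^sup>2" and r: "r > 0"
  shows "sign_avg n (\<lambda>\<sigma>. Max ((\<lambda>a. \<bar>\<Sum>i<n. \<sigma> i * a i\<bar>) ` A)) \<le> r * sqrt (2 * ln (2 * M))"
proof -
  have "card A \<ge> 1" using fin by (simp add: Suc_leI card_gt_0_iff)
  then have M: "M \<ge> 1" using card by linarith
  \<comment> \<open>This \<open>l\<close> minimizes ln (2 M) / l + l r^2 / 2 by making both terms
    equal.\<close>
  define l where "l = sqrt (2 * ln (2 * M)) / r"
  have l: "l > 0" using M r by (simp add: l_def)
  let ?F = "\<lambda>\<sigma>. Max ((\<lambda>a. \<bar>\<Sum>i<n. \<sigma> i * a i\<bar>) ` A)"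
  let ?m = "sign_avg n ?F"
  have "exp (l * ?m) = exp (sign_avg n (\<lambda>\<sigma>. l * ?F \<sigma>))" by (simp add: sign_avg_cmult)
  also have "\<dots> \<le> sign_avg n (\<lambda>\<sigma>. exp (l * ?F \<sigma>))" by (rule exp_sign_avg_le)
  also have "\<dots> \<le> sign_avg n (\<lambda>\<sigma>. \<Sum>a\<in>A. exp (\<Sum>i<n. \<sigma> i * (l * a i)) + exp (\<Sum>i<n. \<sigma> i * (- l * a i)))"
  proof (rule sign_avg_mono)
    fix \<sigma> :: "nat \<Rightarrow> real"
    have "?F \<sigma> \<in> (\<lambda>a. \<bar>\<Sum>i<n. \<sigma> i * a i\<bar>) ` A" using fin by (intro Max_in) auto
    then obtain a where a: "a \<in> A" "?F \<sigma> = \<bar>\<Sum>i<n. \<sigma> i * a i\<bar>" by blast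
    have eq: "(\<Sum>i<n. \<sigma> i * (c * a i)) = c * (\<Sum>i<n. \<sigma> i * a i)" for c
      by (simp add: sum_distrib_left mult_ac)
    have "exp (l * ?F \<sigma>) \<le> exp (\<Sum>i<n. \<sigma> i * (l * a i)) + exp (\<Sum>i<n. \<sigma> i * (- l * a i))"
      unfolding eq a(2)
      by (cases "(\<Sum>i<n. \<sigma> i * a i) \<ge> 0") (auto simp: abs_if add_increasing add_increasing2)
    also have "\<dots> \<le> (\<Sum>a\<in>A. exp (\<Sum>i<n. \<sigma> i * (l * a i)) + exp (\<Sum>i<n. \<sigma> i * (- l * a i)))"
      using member_le_sum[OF a(1) _ fin(1), of "\<lambda>a. exp (\<Sum>i<n. \<sigma> i * (l * a i)) + exp (\<Sum>i<n. \<sigma> i * (- l * a i))"]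
      by (simp add: add_nonneg_nonneg)
    finally show "exp (l * ?F \<sigma>) \<le> (\<Sum>a\<in>A. exp (\<Sum>i<n. \<sigma> i * (l * a i)) + exp (\<Sum>i<n. \<sigma> i * (- l * a i)))" .
  qed
  also have "\<dots> = (\<Sum>a\<in>A. sign_avg n (\<lambda>\<sigma>. exp (\<Sum>i<n. \<sigma> i * (l * a i))) + sign_avg n (\<lambda>\<sigma>. exp (\<Sum>i<n. \<sigma> i * (- l * a i))))"
    by (simp only: sign_avg_sum sign_avg_add)
  also have "\<dots> \<le> (\<Sum>a\<in>A. 2 * exp (l\<^sup>2 * r\<^sup>2 / 2))"
  proof (rule sum_mono)
    fix a assume a: "a \<in> A"
    have "sign_avg n (\<lambda>\<sigma>. exp (\<Sum>i<n. \<sigma> i * (c * a i))) \<le> exp (l\<^sup>2 * r\<^sup>2 / 2)" if c: "c\<^sup>2 = l\<^sup>2" for c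
    proof -
      have "sign_avg n (\<lambda>\<sigma>. exp (\<Sum>i<n. \<sigma> i * (c * a i))) \<le> exp ((\<Sum>i<n. (c * a i)\<^sup>2) / 2)"
        by (rule sign_avg_exp_le)
      also have "(\<Sum>i<n. (c * a i)\<^sup>2) = l\<^sup>2 * (\<Sum>i<n. (a i)\<^sup>2)"
        by (simp add: sum_distrib_left power_mult_distrib c)
      also have "exp (\<dots> / 2) \<le> exp (l\<^sup>2 * r\<^sup>2 / 2)"
        using norm[OF a] by (simp add: mult_left_mono)
      finally show ?thesis .
    qed
    from this[of l] this[of "-l"] show "sign_avg n (\<lambda>\<sigma>. exp (\<Sum>i<n. \<sigma> i * (l * a i))) + sign_avg n (\<lambda>\<sigma>. exp (\<Sum>i<n. \<sigma> i * (- l * a i)))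
      \<le> 2 * exp (l\<^sup>2 * r\<^sup>2 / 2)" by simp
  qed
  also have "\<dots> = real (card A) * 2 * exp (l\<^sup>2 * r\<^sup>2 / 2)" by simp
  also have "\<dots> \<le> M * 2 * exp (l\<^sup>2 * r\<^sup>2 / 2)" using card by (intro mult_right_mono) auto
  also have "\<dots> = exp (ln (2 * M) + l\<^sup>2 * r\<^sup>2 / 2)" using M by (simp add: exp_add)
  finally have "l * ?m \<le> ln (2 * M) + l\<^sup>2 * r\<^sup>2 / 2" by simp
  moreover have "l\<^sup>2 * r\<^sup>2 = 2 * ln (2 * M)" using M r by (simp add: l_def power_divide)
  ultimately have *: "l * ?m \<le> 2 * ln (2 * M)" by simp
  define q where "q = sqrt (2 * ln (2 * M))"
  have q: "q > 0" "q * q = 2 * ln (2 * M)" using M by (auto simp: q_def)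
  have "q * ?m \<le> q * (r * q)" using * r q(1) unfolding l_def q_def[symmetric] q(2)[symmetric] by (simp add: field_simps)
  then have "?m \<le> r * q" using q(1) by (rule mult_left_le_imp_le)
  then show ?thesis by (simp add: q_def)
qed

section \<open>The contraction principle of Ledoux and Talagrand\<close>

lemma contraction_step:
  assumes fin: "finite Q" "Q \<noteq> {}"
    and le: "\<And>q q'. q \<in> Q \<Longrightarrow> q' \<in> Q \<Longrightarrow> \<bar>u q - u q'\<bar> \<le> \<bar>w q - w q'\<bar>"
  shows "Max ((\<lambda>q. a q + u q) ` Q) + Max ((\<lambda>q. a q - u q) ` Q)
       \<le> Max ((\<lambda>q. a q + w q) ` Q) + Max ((\<lambda>q. a q - w q :: real) ` Q)"
proof -
  have "Max ((\<lambda>q. a q + u q) ` Q) \<in> (\<lambda>q. a q + u q) ` Q" "Max ((\<lambda>q. a q - u q) ` Q) \<in> (\<lambda>q. a q - u q) ` Q"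
    using fin by (auto intro!: Max_in)
  then obtain q q' where q: "q \<in> Q" "q' \<in> Q" "Max ((\<lambda>q. a q + u q) ` Q) = a q + u q" "Max ((\<lambda>q. a q - u q) ` Q) = a q' - u q'"
    by auto
  have "a p + w p \<le> Max ((\<lambda>q. a q + w q) ` Q)" "a p - w p \<le> Max ((\<lambda>q. a q - w q) ` Q)" if "p \<in> Q" for p
    using fin that by auto
  \<comment> \<open>At the maximizers the left side is a q + a q' + (u q - u q'). According to the
    sign of w q - w q', the right-hand maxima are tested at (q, q') or at (q', q).\<close>
  from this[OF q(1)] this[OF q(2)] le[OF q(1,2)] show ?thesis unfolding q(3,4) by linarith
qed

lemma contraction_coord:
  assumes fin: "finite Q" "Q \<noteq> {}"
    and le: "\<And>q q'. q \<in> Q \<Longrightarrow> q' \<in> Q \<Longrightarrow> \<bar>u q - u q'\<bar> \<le> \<bar>w q - w q'\<bar>"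
  shows "sign_avg n (\<lambda>\<sigma>. Max ((\<lambda>q. (b \<sigma> q + u q)) ` Q)) + sign_avg n (\<lambda>\<sigma>. Max ((\<lambda>q. (b \<sigma> q - u q)) ` Q))
    \<le> sign_avg n (\<lambda>\<sigma>. Max ((\<lambda>q. (b \<sigma> q + w q)) ` Q)) + sign_avg n (\<lambda>\<sigma>. Max ((\<lambda>q. (b \<sigma> q - w q :: real)) ` Q))"
  unfolding sign_avg_add[symmetric] by (intro sign_avg_mono contraction_step assms)

text \<open>Induction replaces one coordinate at a time; the offset \<open>a\<close> absorbs the
  last coordinate with its sign fixed, so it is generalized. Only increments between two members of
  \<open>Q\<close> are compared, so one statement serves losses, clipping and powers.\<close>

lemma ledoux_talagrand_comparison:
  assumes fin: "finite Q" "Q \<noteq> {}"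
    and le: "\<And>i q q'. i < n \<Longrightarrow> q \<in> Q \<Longrightarrow> q' \<in> Q \<Longrightarrow> \<bar>u q i - u q' i\<bar> \<le> \<bar>w q i - w q' i\<bar>"
  shows "sign_avg n (\<lambda>\<sigma>. Max ((\<lambda>q. a q + (\<Sum>i<n. \<sigma> i * u q i)) ` Q))
    \<le> sign_avg n (\<lambda>\<sigma>. Max ((\<lambda>q. a q + (\<Sum>i<n. \<sigma> i * w q i)) ` Q))"
  using le
proof (induction n arbitrary: a)
  case (Suc n)
  let ?S = "\<lambda>u \<sigma> q. \<Sum>i<n. \<sigma> i * (u q i :: real)"
  have rec: "sign_avg (Suc n) (\<lambda>\<sigma>. Max ((\<lambda>q. a q + (\<Sum>i<Suc n. \<sigma> i * v q i)) ` Q)) =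
     (sign_avg n (\<lambda>\<sigma>. Max ((\<lambda>q. (a q + ?S v \<sigma> q) + v q n) ` Q)) +
      sign_avg n (\<lambda>\<sigma>. Max ((\<lambda>q. (a q + ?S v \<sigma> q) - v q n) ` Q))) / 2" for v
    by (simp add: algebra_simps)
  have IH: "sign_avg n (\<lambda>\<sigma>. Max ((\<lambda>q. c q + ?S u \<sigma> q) ` Q)) \<le> sign_avg n (\<lambda>\<sigma>. Max ((\<lambda>q. c q + ?S w \<sigma> q) ` Q))" for c
    by (rule Suc.IH) (simp add: Suc.prems)
  have "sign_avg n (\<lambda>\<sigma>. Max ((\<lambda>q. (a q + ?S u \<sigma> q) + u q n) ` Q)) \<le> sign_avg n (\<lambda>\<sigma>. Max ((\<lambda>q. (a q + ?S w \<sigma> q) + u q n) ` Q))"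
    using IH[of "\<lambda>q. a q + u q n"] by (simp add: algebra_simps)
  moreover have "sign_avg n (\<lambda>\<sigma>. Max ((\<lambda>q. (a q + ?S u \<sigma> q) - u q n) ` Q)) \<le> sign_avg n (\<lambda>\<sigma>. Max ((\<lambda>q. (a q + ?S w \<sigma> q) - u q n) ` Q))"
    using IH[of "\<lambda>q. a q - u q n"] by (simp add: algebra_simps)
  moreover have "sign_avg n (\<lambda>\<sigma>. Max ((\<lambda>q. (a q + ?S w \<sigma> q) + u q n) ` Q)) + sign_avg n (\<lambda>\<sigma>. Max ((\<lambda>q. (a q + ?S w \<sigma> q) - u q n) ` Q))
    \<le> sign_avg n (\<lambda>\<sigma>. Max ((\<lambda>q. (a q + ?S w \<sigma> q) + w q n) ` Q)) + sign_avg n (\<lambda>\<sigma>. Max ((\<lambda>q. (a q + ?S w \<sigma> q) - w q n) ` Q))"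
    by (rule contraction_coord[OF fin]) (simp add: Suc.prems)
  ultimately show ?case unfolding rec by simp
qed simp

section \<open>Packing and chaining for set systems of bounded VC dimension\<close>

definition shatters :: "'a set set \<Rightarrow> 'a set \<Rightarrow> bool" where
  "shatters \<F> A \<longleftrightarrow> (\<forall>B\<subseteq>A. \<exists>S\<in>\<F>. S \<inter> A = B)"

text \<open>Split the family into the members without \<open>x\<close> and those with
  \<open>x\<close>, the latter with \<open>x\<close> removed. A set shattered by both parts is
  counted twice, and it pays for this because the whole family shatters it both with and without
  \<open>x\<close>.\<close>

lemma pajor_sauer_shelah:
  assumes "finite X" "\<F> \<subseteq> Pow X"
  shows "card \<F> \<le> card {A. A \<subseteq> X \<and> shatters \<F> A}"
  using assms
proof (induction X arbitrary: \<F> rule: finite_induct)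
  case empty
  then have "\<F> = {} \<or> \<F> = {{}}" by auto
  then show ?case
  proof (elim disjE)
    assume F: "\<F> = {{}}"
    have "shatters {{}} {}" by (simp add: shatters_def)
    then have "{{}} \<subseteq> {A. A \<subseteq> {} \<and> shatters {{}} A}" by blast
    moreover have "finite {A. A \<subseteq> {} \<and> shatters {{}} A}"
      by (rule finite_subset[of _ "{{}}"]) blast+
    ultimately show ?thesis unfolding F by (intro card_mono)
  next
    assume F: "\<F> = {}"
    show ?thesis unfolding F by simp
  qed
next
  case (insert x X)
  define F0 where "F0 = {S\<in>\<F>. x \<notin> S}"
  define F1 where "F1 = (\<lambda>S. S - {x}) ` {S\<in>\<F>. x \<in> S}"
  define sh where "sh \<G> = {A. A \<subseteq> X \<and> shatters \<G> A}" for \<G>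
  have finF: "finite \<F>" 
    by (rule finite_subset[OF insert.prems]) (use insert.hyps(1) in simp)
  have sub: "F0 \<subseteq> Pow X" "F1 \<subseteq> Pow X" using insert.prems by (auto simp: F0_def F1_def)
  have finsh: "finite (sh \<G>)" for \<G> using insert.hyps(1) by (simp add: sh_def)
  define E where "E = {S\<in>\<F>. x \<in> S}"
  have "F0 \<union> E = \<F>" "F0 \<inter> E = {}" "finite F0" "finite E"
    using finF by (auto simp: F0_def E_def)
  then have "card \<F> = card F0 + card E" using card_Un_disjoint[of F0 E] by simp
  moreover have "card E = card F1"
    unfolding F1_def E_def[symmetric] by (rule card_image[symmetric]) (auto simp: inj_on_def E_def)
  ultimately have "card \<F> = card F0 + card F1" by simp
  also have "card F0 + card F1 \<le> card (sh F0) + card (sh F1)"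
    using insert.IH[OF sub(1)] insert.IH[OF sub(2)] by (simp add: sh_def add_mono)
  also have "\<dots> = card (sh F0 \<union> sh F1) + card (sh F0 \<inter> sh F1)"
    by (rule card_Un_Int[OF finsh finsh])
  also have "card (sh F0 \<inter> sh F1) = card (insert x ` (sh F0 \<inter> sh F1))"
    using insert.hyps(2) by (intro card_image[symmetric]) (auto simp: inj_on_def sh_def)
  also have "card (sh F0 \<union> sh F1) + \<dots> = card ((sh F0 \<union> sh F1) \<union> insert x ` (sh F0 \<inter> sh F1))"
    using insert.hyps(2) finsh by (intro card_Un_disjoint[symmetric]) (auto simp: sh_def)
  also have "\<dots> \<le> card {A. A \<subseteq> insert x X \<and> shatters \<F> A}"
  proof (rule card_mono)
    show "finite {A. A \<subseteq> insert x X \<and> shatters \<F> A}" using insert.hyps(1) by simp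
    have 0: "shatters \<F> A" if "A \<in> sh F0" for A
      using that unfolding sh_def shatters_def F0_def by blast
    have 1: "shatters \<F> A" if A: "A \<in> sh F1" for A
      unfolding shatters_def
    proof (intro allI impI)
      fix B assume "B \<subseteq> A"
      then obtain S where S: "S \<in> \<F>" "(S - {x}) \<inter> A = B" using A unfolding sh_def shatters_def F1_def by blast
      moreover have "x \<notin> A" using A insert.hyps(2) by (auto simp: sh_def)
      ultimately show "\<exists>S\<in>\<F>. S \<inter> A = B" by blast
    qed
    have 2: "shatters \<F> (insert x A)" if A: "A \<in> sh F0" "A \<in> sh F1" for A
      unfolding shatters_def
    proof (intro allI impI)
      fix B assume B: "B \<subseteq> insert x A"
      have xA: "x \<notin> A" using A insert.hyps(2) by (auto simp: sh_def)
      show "\<exists>S\<in>\<F>. S \<inter> insert x A = B"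
      proof (cases "x \<in> B")
        case True
        have "B - {x} \<subseteq> A" using B by auto
        then obtain S where S: "S \<in> \<F>" "x \<in> S" "(S - {x}) \<inter> A = B - {x}"
          using A(2) unfolding sh_def shatters_def F1_def by blast
        then have "S \<inter> insert x A = B" using xA True by auto
        then show ?thesis using S(1) by blast
      next
        case False
        then have "B \<subseteq> A" using B by auto
        then obtain S where S: "S \<in> \<F>" "x \<notin> S" "S \<inter> A = B"
          using A(1) unfolding sh_def shatters_def F0_def by blast
        then have "S \<inter> insert x A = B" by auto
        then show ?thesis using S(1) by blast
      qed
    qed
    show "sh F0 \<union> sh F1 \<union> insert x ` (sh F0 \<inter> sh F1) \<subseteq> {A. A \<subseteq> insert x X \<and> shatters \<F> A}"
      using 0 1 2 by (auto simp: sh_def)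
  qed
  finally show ?case .
qed

lemma sauer_shelah:
  assumes "finite X" "\<F> \<subseteq> Pow X" and D: "\<And>A. A \<subseteq> X \<Longrightarrow> shatters \<F> A \<Longrightarrow> card A \<le> D"
  shows "card \<F> \<le> (\<Sum>i\<le>D. card X choose i)"
proof -
  have "card \<F> \<le> card {A. A \<subseteq> X \<and> shatters \<F> A}" by (rule pajor_sauer_shelah[OF assms(1,2)])
  also have "\<dots> \<le> card (\<Union>i\<le>D. {A. A \<subseteq> X \<and> card A = i})"
    using assms(1) D by (intro card_mono) auto
  also have "\<dots> \<le> (\<Sum>i\<le>D. card {A. A \<subseteq> X \<and> card A = i})"
    by (rule card_UN_le) simp
  also have "\<dots> = (\<Sum>i\<le>D. card X choose i)"
    by (intro sum.cong refl n_subsets assms(1))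
  finally show ?thesis .
qed

text \<open>Weight the sum with x = D / m \<le> 1: then x^D \<le> x^i for i \<le> D, and the full
  binomial sum is (1 + x)^m \<le> exp (x m) = exp D.\<close>

lemma sum_choose_le_exp:
  assumes "0 < D" "D \<le> m"
  shows "real (\<Sum>i\<le>D. m choose i) \<le> (exp 1 * real m / real D) ^ D"
proof -
  define x where "x = real D / real m"
  have x: "0 < x" "x \<le> 1" using assms by (auto simp: x_def)
  have "x ^ D * real (\<Sum>i\<le>D. m choose i) = (\<Sum>i\<le>D. real (m choose i) * x ^ D)"
    by (simp add: sum_distrib_left mult.commute)
  also have "\<dots> \<le> (\<Sum>i\<le>D. real (m choose i) * x ^ i)"
    using x by (intro sum_mono mult_left_mono power_decreasing) auto
  also have "\<dots> \<le> (\<Sum>i\<le>m. real (m choose i) * x ^ i)"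
    using assms x by (intro sum_mono2) auto
  also have "\<dots> = (1 + x) ^ m"
    using binomial_ring[of x 1 m] by (simp add: add.commute)
  also have "\<dots> \<le> exp x ^ m"
    using x by (intro power_mono) auto
  also have "\<dots> = exp 1 ^ D"
    using assms by (simp add: exp_of_nat_mult[symmetric] x_def)
  finally have "real (\<Sum>i\<le>D. m choose i) \<le> exp 1 ^ D / x ^ D"
    using x by (simp add: field_simps)
  also have "\<dots> = (exp 1 * real m / real D) ^ D"
    by (simp add: x_def power_divide power_mult_distrib)
  finally show ?thesis .
qed

definition vc_le :: "'a set set \<Rightarrow> nat \<Rightarrow> bool" where
  "vc_le \<F> D \<longleftrightarrow> (\<forall>A. finite A \<longrightarrow> shatters \<F> A \<longrightarrow> card A \<le> D)"

text \<open>Traces live on indices rather than points, so samples with repeated points need no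
  separate treatment.\<close>

definition trace_sets :: "('i \<Rightarrow> 'a) \<Rightarrow> 'i set \<Rightarrow> 'a set set \<Rightarrow> 'i set set" where
  "trace_sets z I \<F> = (\<lambda>S. {i\<in>I. z i \<in> S}) ` \<F>"

text \<open>Two indices of the same point cannot be separated, so \<open>z\<close> is injective on a
  shattered index set, and the image of that set is shattered by the original family.\<close>

lemma card_trace_sets_le:
  assumes vc: "vc_le \<F> D" and I: "finite I"
  shows "card (trace_sets z I \<F>) \<le> (\<Sum>i\<le>D. card I choose i)"
proof (rule sauer_shelah[OF I])
  show "trace_sets z I \<F> \<subseteq> Pow I" by (auto simp: trace_sets_def)
  fix A assume A: "A \<subseteq> I" "shatters (trace_sets z I \<F>) A"
  have *: "\<exists>S\<in>\<F>. {i\<in>I. z i \<in> S} \<inter> A = B" if "B \<subseteq> A" for B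
    using A(2) that unfolding shatters_def trace_sets_def by blast
  have inj: "inj_on z A"
  proof (rule inj_onI)
    fix i j assume ij: "i \<in> A" "j \<in> A" "z i = z j"
    from *[of "{i}"] ij obtain S where S: "{i\<in>I. z i \<in> S} \<inter> A = {i}" by auto
    have "i \<in> {i\<in>I. z i \<in> S} \<inter> A" unfolding S by simp
    then have "z i \<in> S" by blast
    then have "j \<in> {i\<in>I. z i \<in> S} \<inter> A" using ij A(1) by auto
    then have "j \<in> {i}" unfolding S .
    then show "i = j" by simp
  qed
  have "shatters \<F> (z ` A)"
    unfolding shatters_def
  proof (intro allI impI)
    fix B assume B: "B \<subseteq> z ` A"
    from *[of "{i\<in>A. z i \<in> B}"] obtain S where S: "S \<in> \<F>" "{i\<in>I. z i \<in> S} \<inter> A = {i\<in>A. z i \<in> B}" by auto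
    have "z i \<in> S \<longleftrightarrow> z i \<in> B" if "i \<in> A" for i
    proof -
      have "i \<in> {i\<in>I. z i \<in> S} \<inter> A \<longleftrightarrow> i \<in> {i\<in>A. z i \<in> B}" by (simp only: S(2))
      then show ?thesis using that A(1) by auto
    qed
    then have "S \<inter> z ` A = B" using B by auto
    then show "\<exists>S\<in>\<F>. S \<inter> z ` A = B" using S(1) by blast
  qed
  moreover have "finite A" using A(1) I by (rule finite_subset)
  ultimately have "card (z ` A) \<le> D" using vc by (auto simp: vc_le_def)
  then show "card A \<le> D" by (simp add: card_image[OF inj])
qed

section \<open>Packing numbers\<close>

lemma ln_le_half: "0 < x \<Longrightarrow> ln x \<le> x / 2" for x :: real
proof -
  assume x: "0 < x"
  have "ln (x / 2) \<le> x / 2 - 1" using x by (intro ln_le_minus_one) auto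
  then have "ln x \<le> x / 2 - 1 + ln 2" using x by (simp add: ln_div)
  then show ?thesis using ln_2_less_1 by linarith
qed

text \<open>
  Dudley's packing bound: a random sequence of about \<open>2 ln N / \<epsilon>\<close> indices separates all members of an
  \<open>\<epsilon>\<close>-separated family, so the family is no larger than the trace on that short sequence.
\<close>

lemma exists_separating_sequence:
  assumes G: "finite G" "G \<noteq> {}" "\<And>S. S \<in> G \<Longrightarrow> S \<subseteq> {..<n}"
    and eps: "0 < \<epsilon>" and n: "0 < n"
    and sep: "\<And>S T. S \<in> G \<Longrightarrow> T \<in> G \<Longrightarrow> S \<noteq> T \<Longrightarrow> \<epsilon> * real n \<le> real (card (sym_diff S T))"
    and m: "2 * ln (real (card G)) \<le> \<epsilon> * real m"
  obtains x where "x \<in> {..<m} \<rightarrow> {..<n}" "inj_on (\<lambda>S. {j\<in>{..<m}. x j \<in> S}) G"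
proof -
  define N where "N = real (card G)"
  have N: "N \<ge> 1" using G by (simp add: N_def Suc_leI card_gt_0_iff)
  define P where "P = {p\<in>G\<times>G. fst p \<noteq> snd p}"
  have finP: "finite P" using G(1) by (simp add: P_def)
  \<comment> \<open>Strict, because the diagonal is left out; this makes the union bound below
    strict.\<close>
  have cardP: "real (card P) < N\<^sup>2"
  proof -
    obtain S where "S \<in> G" using G by auto
    then have "(S, S) \<in> G \<times> G - P" by (simp add: P_def)
    then have "P \<subset> G \<times> G" unfolding P_def by blast
    then have "card P < card (G \<times> G)" using G(1) by (intro psubset_card_mono) auto
    then have "real (card P) < real (card G * card G)"
      unfolding card_cartesian_product by (simp only: of_nat_less_iff)
    then show ?thesis by (simp add: N_def power2_eq_square)
  qed
  \<comment> \<open>The sequences that fail to separate the pair \<open>p\<close>: every entry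
    avoids the symmetric difference.\<close>
  define B where "B p = {..<m} \<rightarrow>\<^sub>E ({..<n} - sym_diff (fst p) (snd p))" for p
  have cardB: "real (card (B p)) \<le> real n ^ m / N\<^sup>2" if p: "p \<in> P" for p
  proof -
    let ?d = "card (sym_diff (fst p) (snd p))"
    have sub: "sym_diff (fst p) (snd p) \<subseteq> {..<n}" using p G(3)[of "fst p"] G(3)[of "snd p"] by (auto simp: P_def)
    have dn: "?d \<le> n" using card_mono[OF _ sub] by simp
    have d: "\<epsilon> * real n \<le> real ?d" using p sep[of "fst p" "snd p"] by (simp add: P_def mem_Times_iff)
    have "card (B p) = (n - ?d) ^ m"
      unfolding B_def using sub by (simp add: card_PiE card_Diff_subset[OF finite_subset[OF sub]])
    then have "real (card (B p)) = (real n - real ?d) ^ m" using dn by (simp add: of_nat_diff)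
    also have "\<dots> \<le> (real n * exp (- \<epsilon>)) ^ m"
    proof (rule power_mono)
      have "real n * (1 - \<epsilon>) \<le> real n * exp (- \<epsilon>)"
        using exp_ge_add_one_self[of "-\<epsilon>"] by (intro mult_left_mono) auto
      then show "real n - real ?d \<le> real n * exp (- \<epsilon>)" using d by (simp add: algebra_simps)
    qed (use dn in simp)
    also have "\<dots> = real n ^ m * exp (- (\<epsilon> * real m))"
      by (simp add: power_mult_distrib exp_of_nat_mult[symmetric] mult.commute)
    \<comment> \<open>Twice ln N, because the union bound runs over fewer than N^2 but possibly
      almost N^2 pairs.\<close>
    also have "\<dots> \<le> real n ^ m * exp (- (2 * ln N))"
      using m by (intro mult_left_mono) (auto simp: N_def)
    also have "exp (- (2 * ln N)) = 1 / N\<^sup>2"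
    proof -
      have "exp (2 * ln N) = (exp (ln N))\<^sup>2" by (simp add: exp_double)
      also have "exp (ln N) = N" using N by simp
      finally show ?thesis by (simp add: exp_minus divide_inverse)
    qed
    finally show ?thesis by simp
  qed
  have finB: "finite (B p)" for p unfolding B_def by (intro finite_PiE) auto
  have "real (card (\<Union>p\<in>P. B p)) \<le> real (\<Sum>p\<in>P. card (B p))"
    using card_UN_le[OF finP] by (simp only: of_nat_le_iff)
  also have "\<dots> \<le> real (card P) * (real n ^ m / N\<^sup>2)"
    using sum_mono[OF cardB] by simp
  also have "\<dots> < N\<^sup>2 * (real n ^ m / N\<^sup>2)"
    using cardP n N by (intro mult_strict_right_mono) auto
  also have "\<dots> = real n ^ m" using N by simp
  also have "\<dots> = real (card ({..<m} \<rightarrow>\<^sub>E {..<n}))" by (simp add: card_PiE)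
  finally have less: "card (\<Union>p\<in>P. B p) < card ({..<m} \<rightarrow>\<^sub>E {..<n})" by simp
  have "\<not> ({..<m} \<rightarrow>\<^sub>E {..<n}) \<subseteq> (\<Union>p\<in>P. B p)"
  proof
    assume "({..<m} \<rightarrow>\<^sub>E {..<n}) \<subseteq> (\<Union>p\<in>P. B p)"
    then have "card ({..<m} \<rightarrow>\<^sub>E {..<n}) \<le> card (\<Union>p\<in>P. B p)"
      using finP finB by (intro card_mono) auto
    then show False using less by simp
  qed
  then obtain x where x: "x \<in> {..<m} \<rightarrow>\<^sub>E {..<n}" "\<And>p. p \<in> P \<Longrightarrow> x \<notin> B p" by blast
  show ?thesis
  proof (rule that[of x])
    show "x \<in> {..<m} \<rightarrow> {..<n}" using x(1) by auto
    show "inj_on (\<lambda>S. {j\<in>{..<m}. x j \<in> S}) G"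
    proof (rule inj_onI, rule ccontr)
      fix S T assume ST: "S \<in> G" "T \<in> G" "{j\<in>{..<m}. x j \<in> S} = {j\<in>{..<m}. x j \<in> T}" "S \<noteq> T"
      have "x j \<notin> sym_diff S T" if "j < m" for j
        using ST(3) that by auto
      then have "x \<in> B (S, T)" using x(1) unfolding B_def by (auto simp: PiE_iff)
      moreover have "(S, T) \<in> P" using ST by (simp add: P_def)
      ultimately show False using x(2) by blast
    qed
  qed
qed

text \<open>The short separating sequence and Sauer-Shelah give N \<le> (e m / D)^D with m about 2
  ln N / \<epsilon>, an inequality with ln N on both sides. In terms of L = ln N / D it reads L
  \<le> ln (3 e L / \<epsilon>), and ln L \<le> L / 2 solves it.\<close>

lemma packing_bound:
  assumes vc: "vc_le \<F> D" and D: "0 < D" and n: "0 < n"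
    and G: "G \<subseteq> trace_sets z {..<n} \<F>" "G \<noteq> {}" and eps: "0 < \<epsilon>" "\<epsilon> \<le> 1"
    and sep: "\<And>S T. S \<in> G \<Longrightarrow> T \<in> G \<Longrightarrow> S \<noteq> T \<Longrightarrow> \<epsilon> * real n \<le> real (card (sym_diff S T))"
  shows "ln (real (card G)) \<le> real D * (6 + 2 * ln (1 / \<epsilon>))"
proof -
  have "trace_sets z {..<n} \<F> \<subseteq> Pow {..<n}" by (auto simp: trace_sets_def)
  then have GP: "G \<subseteq> Pow {..<n}" using G(1) by blast
  have finG: "finite G" by (rule finite_subset[OF GP]) simp
  define N where "N = real (card G)"
  have N: "N \<ge> 1" using G finG by (simp add: N_def Suc_leI card_gt_0_iff)
  define m where "m = nat \<lceil>2 * ln N / \<epsilon>\<rceil>"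
  have "2 * ln N / \<epsilon> \<le> real m" unfolding m_def by linarith
  then have m1: "2 * ln N \<le> \<epsilon> * real m" using eps by (simp add: field_simps)
  have "0 \<le> 2 * ln N / \<epsilon>" using N eps by simp
  then have m2: "real m \<le> 2 * ln N / \<epsilon> + 1" unfolding m_def by linarith
  have sub: "S \<subseteq> {..<n}" if "S \<in> G" for S using that GP by blast
  obtain x where x: "x \<in> {..<m} \<rightarrow> {..<n}" "inj_on (\<lambda>S. {j\<in>{..<m}. x j \<in> S}) G"
    by (rule exists_separating_sequence[of G n \<epsilon> m])
      (use finG G sub eps n m1 sep in \<open>auto simp: N_def\<close>)
  have "card G = card ((\<lambda>S. {j\<in>{..<m}. x j \<in> S}) ` G)" by (rule card_image[OF x(2), symmetric])
  also have "\<dots> \<le> card (trace_sets (z \<circ> x) {..<m} \<F>)"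
  proof (rule card_mono)
    have "trace_sets (z \<circ> x) {..<m} \<F> \<subseteq> Pow {..<m}" by (auto simp: trace_sets_def)
    then show "finite (trace_sets (z \<circ> x) {..<m} \<F>)" by (rule finite_subset) simp
    show "(\<lambda>S. {j\<in>{..<m}. x j \<in> S}) ` G \<subseteq> trace_sets (z \<circ> x) {..<m} \<F>"
    proof
      fix A assume "A \<in> (\<lambda>S. {j\<in>{..<m}. x j \<in> S}) ` G"
      then obtain S where S: "S \<in> \<F>" "A = {j\<in>{..<m}. x j \<in> {i\<in>{..<n}. z i \<in> S}}"
        using G(1) unfolding trace_sets_def by auto
      then have "A = {j\<in>{..<m}. (z \<circ> x) j \<in> S}" using x(1) by auto
      then show "A \<in> trace_sets (z \<circ> x) {..<m} \<F>" using S(1) by (auto simp: trace_sets_def)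
    qed
  qed
  also have "\<dots> \<le> (\<Sum>i\<le>D. m choose i)" using card_trace_sets_le[OF vc, of "{..<m}" "z \<circ> x"] by simp
  finally have card: "N \<le> real (\<Sum>i\<le>D. m choose i)" unfolding N_def by (simp only: of_nat_le_iff)
  define L where "L = ln N / real D"
  have L0: "L \<ge> 0" using N by (simp add: L_def)
  have le0: "0 \<le> ln (1 / \<epsilon>)" using eps by simp
  have "L \<le> 6 + 2 * ln (1 / \<epsilon>)"
  proof (cases "D \<le> m \<and> 1 \<le> L")
    case True
    then have m: "D \<le> m" and L: "1 \<le> L" by auto
    have mD: "real m / real D \<le> 3 * L / \<epsilon>"
    proof -
      have "1 / real D \<le> L / \<epsilon>"
      proof -
        have "1 / real D \<le> 1" using D by simp
        also have "1 \<le> L" by fact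
        also have "L = L / 1" by simp
        also have "\<dots> \<le> L / \<epsilon>" using eps L by (intro divide_left_mono) auto
        finally show ?thesis .
      qed
      moreover have "real m / real D \<le> (2 * ln N / \<epsilon> + 1) / real D"
        using m2 by (intro divide_right_mono) auto
      moreover have "(2 * ln N / \<epsilon> + 1) / real D = 2 * L / \<epsilon> + 1 / real D"
        by (simp add: L_def add_divide_distrib)
      ultimately show ?thesis by simp
    qed
    have "N \<le> (exp 1 * real m / real D) ^ D"
      using card sum_choose_le_exp[OF D m] by linarith
    then have "ln N \<le> ln ((exp 1 * real m / real D) ^ D)" using N by (intro ln_mono) auto
    also have "\<dots> = real D * ln (exp 1 * (real m / real D))"
      using D m by (subst ln_realpow) auto
    finally have "L \<le> ln (exp 1 * (real m / real D))" using D by (simp add: L_def field_simps)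
    also have "\<dots> \<le> ln (exp 1 * (3 * L / \<epsilon>))"
      using mD D m by (intro ln_mono mult_left_mono) auto
    also have "exp 1 * (3 * L / \<epsilon>) = exp 1 * (3 * (L * (1 / \<epsilon>)))" by simp
    also have "ln \<dots> = 1 + (ln 3 + (ln L + ln (1 / \<epsilon>)))"
      using L eps by (simp add: ln_mult ln_div)
    \<comment> \<open>Moving L / 2 to the left doubles the rest, 3 + ln (1 / \<epsilon>); hence the
      constants 6 and 2.\<close>
    also have "\<dots> \<le> 1 + (2 + (L / 2 + ln (1 / \<epsilon>)))"
      using ln_le_half[of L] ln_le_minus_one[of 3] L by simp
    finally show ?thesis by linarith
  next
    case False
    \<comment> \<open>For m < D there are at most 2^m traces, so ln N \<le> D ln 2.\<close>
    have "L \<le> 1"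
    proof (cases "1 \<le> L")
      case True
      then have m: "m < D" using False by simp
      have "(\<Sum>i\<le>D. m choose i) = (\<Sum>i\<le>m. m choose i)"
        using m by (intro sum.mono_neutral_right) auto
      also have "\<dots> = 2 ^ m" by (rule choose_row_sum)
      finally have "(\<Sum>i\<le>D. m choose i) = 2 ^ m" .
      then have "N \<le> 2 ^ m" using card by simp
      also have "\<dots> \<le> 2 ^ D" using m by (intro power_increasing) auto
      finally have "ln N \<le> ln (2 ^ D)" using N by (intro ln_mono) auto
      also have "\<dots> = real D * ln 2" by (rule ln_realpow)
      also have "\<dots> \<le> real D * 1" using ln_2_less_1 by (intro mult_left_mono) auto
      finally show ?thesis using D by (simp add: L_def field_simps)
    qed simp
    then show ?thesis using le0 by linarith
  qed
  then show ?thesis using D by (simp add: L_def N_def field_simps)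
qed

text \<open>A maximal separated subfamily is a net, since a member far from it could be
  added.\<close>

lemma exists_net:
  assumes "finite T"
  obtains G where "G \<subseteq> T" "\<And>S S'. S \<in> G \<Longrightarrow> S' \<in> G \<Longrightarrow> S \<noteq> S' \<Longrightarrow> r \<le> real (card (sym_diff S S'))"
    "\<And>S. S \<in> T \<Longrightarrow> \<exists>S'\<in>G. S = S' \<or> real (card (sym_diff S S')) < r"
proof -
  define sep where "sep G \<longleftrightarrow> (\<forall>S\<in>G. \<forall>S'\<in>G. S \<noteq> S' \<longrightarrow> r \<le> real (card (sym_diff S S')))" for G :: "'a set set"
  have "finite {G. G \<subseteq> T \<and> sep G}" using assms by simp
  moreover have "{} \<in> {G. G \<subseteq> T \<and> sep G}" by (simp add: sep_def)
  ultimately obtain G where G: "G \<in> {G. G \<subseteq> T \<and> sep G}"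
    and max: "\<And>H. H \<in> {G. G \<subseteq> T \<and> sep G} \<Longrightarrow> G \<subseteq> H \<Longrightarrow> G = H"
    using finite_has_maximal[of "{G. G \<subseteq> T \<and> sep G}"] by (metis (no_types, lifting) empty_iff)
  show ?thesis
  proof (rule that[of G])
    show "G \<subseteq> T" using G by simp
    show "S \<in> G \<Longrightarrow> S' \<in> G \<Longrightarrow> S \<noteq> S' \<Longrightarrow> r \<le> real (card (sym_diff S S'))" for S S'
      using G by (auto simp: sep_def)
    fix S assume S: "S \<in> T"
    show "\<exists>S'\<in>G. S = S' \<or> real (card (sym_diff S S')) < r"
    proof (rule ccontr)
      assume "\<not> ?thesis"
      then have far: "\<And>S'. S' \<in> G \<Longrightarrow> S \<noteq> S' \<and> r \<le> real (card (sym_diff S S'))" by force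
      then have "sep (insert S G)" using G unfolding sep_def by (auto simp: Un_commute)
      then have "G = insert S G" using max[of "insert S G"] G S by blast
      then show False using far by blast
    qed
  qed
qed

lemma sum_square_indicator_diff:
  fixes n :: nat
  assumes "S \<subseteq> {..<n}" "T \<subseteq> {..<n}"
  shows "(\<Sum>i<n. (indicator S i - indicator T i)\<^sup>2) = real (card (sym_diff S T))"
proof -
  have "(\<Sum>i<n. (indicator S i - indicator T i :: real)\<^sup>2) = (\<Sum>i<n. indicator (sym_diff S T) i)"
    by (intro sum.cong) (auto simp: indicator_def)
  also have "\<dots> = (\<Sum>i<n. of_bool (i \<in> sym_diff S T))"
    by (simp only: indicator_def)
  also have "\<dots> = real (card ({..<n} \<inter> {i. i \<in> sym_diff S T}))"
    by (rule sum_of_bool_eq) simp_all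
  also have "{..<n} \<inter> {i. i \<in> sym_diff S T} = {..<n} \<inter> sym_diff S T" by blast
  also have "{..<n} \<inter> sym_diff S T = sym_diff S T" using assms by auto
  finally show ?thesis .
qed

lemma sum_arith_geometric_le: "(\<Sum>k<K. (real k + 1) * (1/2) ^ k) \<le> 4"
proof -
  have "(\<Sum>k<K. (real k + 1) * (1/2) ^ k) = 4 - (2 * real K + 4) * (1/2) ^ K"
  proof (induction K)
    case (Suc K)
    then show ?case by (simp only: sum.lessThan_Suc power_Suc of_nat_Suc) (simp add: algebra_simps)
  qed simp
  then show ?thesis by simp
qed

section \<open>VC dimension of homogeneous halfspaces\<close>

lemma exists_linear_dependence:
  fixes M :: "'a \<Rightarrow> nat \<Rightarrow> real"
  assumes "finite A" "d < card A"
  shows "\<exists>c. (\<exists>a\<in>A. c a \<noteq> 0) \<and> (\<forall>i<d. (\<Sum>a\<in>A. c a * M a i) = 0)"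
  using assms
proof (induction d arbitrary: A M)
  case 0
  then have "A \<noteq> {}" by auto
  then show ?case by (intro exI[of _ "\<lambda>_. 1"]) auto
next
  case (Suc d)
  show ?case
  proof (cases "\<forall>a\<in>A. M a d = 0")
    case True
    obtain c where "\<exists>a\<in>A. c a \<noteq> 0" "\<forall>i<d. (\<Sum>a\<in>A. c a * M a i) = 0"
      using Suc.IH[of A M] Suc.prems by auto
    then show ?thesis using True by (intro exI[of _ c]) (auto simp: less_Suc_eq)
  next
    case False
    then obtain b where b: "b \<in> A" "M b d \<noteq> 0" by auto
    define A' where "A' = A - {b}"
    have "finite A'" "d < card A'" using Suc.prems b by (auto simp: A'_def)
    from Suc.IH[OF this, of "\<lambda>a i. M a i - M a d / M b d * M b i"]
    obtain c where c: "\<exists>a\<in>A'. c a \<noteq> 0" "\<forall>i<d. (\<Sum>a\<in>A'. c a * (M a i - M a d / M b d * M b i)) = 0" by auto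
    \<comment> \<open>The coefficient of the pivot \<open>b\<close> is chosen so that the
      combination over \<open>A\<close> equals the combination of the eliminated vectors over
      \<open>A'\<close>, in which coordinate \<open>d\<close> vanishes.\<close>
    define e where "e = (\<lambda>a. if a = b then - (\<Sum>a\<in>A'. c a * (M a d / M b d)) else c a)"
    have e: "(\<Sum>a\<in>A. e a * M a i) = (\<Sum>a\<in>A'. c a * (M a i - M a d / M b d * M b i))" for i
    proof -
      have "(\<Sum>a\<in>A. e a * M a i) = e b * M b i + (\<Sum>a\<in>A'. e a * M a i)"
        using Suc.prems(1) b(1) by (simp add: A'_def sum.remove)
      also have "(\<Sum>a\<in>A'. e a * M a i) = (\<Sum>a\<in>A'. c a * M a i)"
        by (intro sum.cong) (auto simp: e_def A'_def)
      also have "e b * M b i = - (\<Sum>a\<in>A'. c a * (M a d / M b d) * M b i)"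
        by (simp add: e_def sum_distrib_right)
      finally show ?thesis by (simp add: algebra_simps sum_subtractf)
    qed
    have "\<exists>a\<in>A. e a \<noteq> 0" using c(1) by (auto simp: e_def A'_def)
    moreover have "(\<Sum>a\<in>A. e a * M a i) = 0" if "i < Suc d" for i
      unfolding e using c(2) b(2) that by (cases "i = d") auto
    ultimately show ?thesis by blast
  qed
qed

text \<open>More than \<open>d\<close> points satisfy a linear relation, with some coefficient
  positive after a change of sign. A halfspace that picks out exactly the points with positive
  coefficient makes every term of the relation, paired with its normal vector, nonnegative and one
  of them positive, although the terms sum to 0.\<close>

lemma vc_halfspaces: "vc_le (range (\<lambda>v. {z. 0 < dot d v z})) d"
  unfolding vc_le_def
proof (intro allI impI, rule ccontr)
  fix A assume A: "finite A" "shatters (range (\<lambda>v. {z. 0 < dot d v z})) A" "\<not> card A \<le> d"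
  obtain c where c: "\<exists>a\<in>A. c a \<noteq> 0" "\<forall>i<d. (\<Sum>a\<in>A. c a * a i) = (0::real)"
    using exists_linear_dependence[OF A(1), of d "\<lambda>a. a"] A(3) by auto
  have "\<exists>e. (\<exists>a\<in>A. e a > 0) \<and> (\<forall>i<d. (\<Sum>a\<in>A. e a * a i) = (0::real))"
  proof (cases "\<exists>a\<in>A. c a > 0")
    case False
    then have "\<exists>a\<in>A. - c a > 0" using c(1) by force
    moreover have "\<forall>i<d. (\<Sum>a\<in>A. - c a * a i) = 0" using c(2) by (simp add: sum_negf)
    ultimately show ?thesis by (intro exI[of _ "\<lambda>a. - c a"] conjI)
  next
    case True
    then show ?thesis using c(2) by (intro exI[of _ c] conjI)
  qed
  then obtain e where e: "\<exists>a\<in>A. e a > 0" "\<forall>i<d. (\<Sum>a\<in>A. e a * a i) = (0::real)" by blast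
  obtain v where v: "{z. 0 < dot d v z} \<inter> A = {a\<in>A. e a > 0}"
  proof -
    have "{a\<in>A. e a > 0} \<subseteq> A" by blast
    then have "\<exists>S\<in>range (\<lambda>v. {z. 0 < dot d v z}). S \<inter> A = {a\<in>A. e a > 0}"
      using A(2) unfolding shatters_def by blast
    then show ?thesis using that by blast
  qed
  have iff: "0 < dot d v a \<longleftrightarrow> e a > 0" if "a \<in> A" for a using v that by blast
  have "(\<Sum>a\<in>A. e a * dot d v a) = (\<Sum>i<d. v i * (\<Sum>a\<in>A. e a * a i))"
    unfolding dot_def sum_distrib_left by (subst sum.swap) (simp add: mult_ac)
  also have "\<dots> = 0" using e(2) by simp
  finally have "(\<Sum>a\<in>A. e a * dot d v a) = 0" .
  moreover have "0 \<le> e a * dot d v a" if "a \<in> A" for a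
    using iff[OF that] by (cases "e a > 0") (auto intro: mult_nonpos_nonpos)
  ultimately have "\<forall>a\<in>A. e a * dot d v a = 0" using A(1) by (simp add: sum_nonneg_eq_0_iff)
  moreover obtain a where "a \<in> A" "e a > 0" using e(1) by blast
  ultimately show False using iff[of a] by fastforce
qed

text \<open>
  Chaining through \<open>4\<^sup>-\<^sup>k\<close>-nets removes the logarithmic factor that a union bound over all traces
  would give.
\<close>

lemma rademacher_vc:
  assumes vc: "vc_le \<F> D" and D: "0 < D" and n: "0 < n" and F: "\<F> \<noteq> {}"
  shows "sign_avg n (\<lambda>\<sigma>. Max ((\<lambda>S. \<bar>\<Sum>i<n. \<sigma> i * indicator S i\<bar>) ` trace_sets z {..<n} \<F>))
    \<le> 26 * sqrt (real n * real D)"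
proof -
  define T where "T = trace_sets z {..<n} \<F>"
  have TP: "T \<subseteq> Pow {..<n}" by (auto simp: T_def trace_sets_def)
  have finT: "finite T" by (rule finite_subset[OF TP]) simp
  have neT: "T \<noteq> {}" using F by (simp add: T_def trace_sets_def)
  \<comment> \<open>The symmetric difference counts the squared Euclidean distance of indicators, so
    the scale 4^(-k) n means radius 2^(-k) sqrt n.\<close>
  have "\<exists>G. G \<subseteq> T \<and> (\<forall>S\<in>G. \<forall>S'\<in>G. S \<noteq> S' \<longrightarrow> (1/4)^k * real n \<le> real (card (sym_diff S S'))) \<and>
     (\<forall>S\<in>T. \<exists>S'\<in>G. S = S' \<or> real (card (sym_diff S S')) < (1/4)^k * real n)" for k :: nat
    using exists_net[OF finT, of "(1/4)^k * real n"] by (metis (no_types, lifting))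
  then obtain G where G: "\<And>k. G k \<subseteq> T"
    "\<And>k S S'. S \<in> G k \<Longrightarrow> S' \<in> G k \<Longrightarrow> S \<noteq> S' \<Longrightarrow> (1/4)^k * real n \<le> real (card (sym_diff S S'))"
    "\<And>k S. S \<in> T \<Longrightarrow> \<exists>S'\<in>G k. S = S' \<or> real (card (sym_diff S S')) < (1/4)^k * real n"
    by metis
  define q where "q k S = (SOME S'. S' \<in> G k \<and> (S = S' \<or> real (card (sym_diff S S')) < (1/4)^k * real n))" for k S
  have q: "q k S \<in> G k \<and> (S = q k S \<or> real (card (sym_diff S (q k S))) < (1/4)^k * real n)" if "S \<in> T" for k S
    unfolding q_def by (rule someI_ex) (use G(3)[OF that, of k] in blast)
  have cardG: "real (card (G k)) \<le> exp (real D * (6 + 3 * real k))" for k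
  proof -
    have ne: "G k \<noteq> {}" using G(3)[of _ k] neT by blast
    have "ln (real (card (G k))) \<le> real D * (6 + 2 * ln (1 / (1/4)^k))"
      by (rule packing_bound[OF vc D n, of _ z]) (use G ne in \<open>auto simp: T_def power_le_one\<close>)
    also have "\<dots> \<le> real D * (6 + 3 * real k)"
    proof (intro mult_left_mono add_left_mono)
      have "ln (1 / (1/4)^k) = real k * ln (4::real)"
        by (simp add: power_one_over ln_realpow)
      moreover have "ln (4::real) = 2 * ln 2" using ln_realpow[of 2 2] by simp
      \<comment> \<open>Since 2 ln 4 = 4 ln 2 \<le> 3, each level adds at most 3 D to the
        entropy.\<close>
      moreover have "ln (2::real) \<le> 3/4" using ln2_le_25_over_36 by simp
      ultimately have "2 * ln (1 / (1/4)^k) = real k * (4 * ln 2)" by simp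
      also have "\<dots> \<le> real k * 3" using \<open>ln (2::real) \<le> 3/4\<close> by (intro mult_left_mono) auto
      finally show "2 * ln (1 / (1/4)^k) \<le> 3 * real k" by simp
    qed simp
    finally have "exp (ln (real (card (G k)))) \<le> exp (real D * (6 + 3 * real k))" by simp
    moreover have "card (G k) > 0" using ne G(1) finT by (meson card_gt_0_iff finite_subset)
    ultimately show ?thesis by simp
  qed
  \<comment> \<open>Level 0 is the empty set instead of a net point, so that the telescoping sum
    along the chain yields the whole indicator. It meets the bound of level 0, because no trace has
    more than \<open>n\<close> indices.\<close>
  define p where "p k S = (if k = 0 then {} else q k S)" for k S
  have pn: "p k S \<subseteq> {..<n}" if "S \<in> T" for k S
  proof -
    have "q k S \<in> Pow {..<n}" using q[OF that, of k] G(1)[of k] TP by blast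
    then show ?thesis by (simp add: p_def)
  qed
  have pd: "real (card (sym_diff S (p k S))) \<le> (1/4)^k * real n" if S: "S \<in> T" for k S
  proof (cases "k = 0")
    case True
    have "card S \<le> card {..<n}" using S TP by (intro card_mono) auto
    then show ?thesis using True by (simp add: p_def)
  next
    case False
    then have p: "p k S = q k S" by (simp add: p_def)
    from q[OF S, of k] show ?thesis
    proof (elim conjE disjE)
      assume "S = q k S"
      then have e: "sym_diff S (p k S) = {}" unfolding p by blast
      show ?thesis unfolding e by simp
    qed (simp add: p)
  qed
  have cardp: "real (card (p k ` T)) \<le> exp (real D * (6 + 3 * real k))" for k
  proof (cases "k = 0")
    case True
    then have "p k ` T = {{}}" using neT by (auto simp: p_def)
    then show ?thesis by simp
  next
    case False
    then have "p k ` T \<subseteq> G k" using q by (auto simp: p_def)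
    then have "card (p k ` T) \<le> card (G k)" using finite_subset[OF G(1) finT] by (intro card_mono)
    then show ?thesis using cardG[of k] by linarith
  qed
  define a where "a k S = (\<lambda>i. indicator (p (Suc k) S) i - indicator (p k S) i :: real)" for k S
  define A where "A k = a k ` T" for k
  have finA: "finite (A k)" "A k \<noteq> {}" for k using finT neT by (auto simp: A_def)
  \<comment> \<open>A link is determined by its two ends, so the entropies of the levels k and k + 1
    add up to D (15 + 6 k).\<close>
  have cardA: "real (card (A k)) \<le> exp (real D * (15 + 6 * real k))" for k
  proof -
    have "A k \<subseteq> (\<lambda>(P, Q) i. indicator P i - indicator Q i) ` ((p (Suc k) ` T) \<times> (p k ` T))"
      by (auto simp: A_def a_def)
    then have "card (A k) \<le> card ((p (Suc k) ` T) \<times> (p k ` T))"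
      using finT by (intro surj_card_le) auto
    then have "real (card (A k)) \<le> real (card (p (Suc k) ` T)) * real (card (p k ` T))"
      by (simp add: card_cartesian_product flip: of_nat_mult)
    also have "\<dots> \<le> exp (real D * (6 + 3 * real (Suc k))) * exp (real D * (6 + 3 * real k))"
      by (intro mult_mono cardp) auto
    also have "\<dots> = exp (real D * (15 + 6 * real k))"
      by (simp add: exp_add[symmetric] algebra_simps)
    finally show ?thesis .
  qed
  \<comment> \<open>A link changes at most as many indices as its two ends together differ from
    \<open>S\<close>, which is (1/4 + 1) 4^(-k) n.\<close>
  have normA: "(\<Sum>i<n. (b i)\<^sup>2) \<le> (sqrt (5/4 * real n) * (1/2)^k)\<^sup>2" if b: "b \<in> A k" for b k
  proof -
    obtain S where S: "S \<in> T" "b = a k S" using b by (auto simp: A_def)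
    have fin: "finite S" "finite (p j S)" for j using S TP pn[OF S(1)] by (auto intro: finite_subset)
    have "(\<Sum>i<n. (b i)\<^sup>2) = real (card (sym_diff (p (Suc k) S) (p k S)))"
      unfolding S(2) a_def by (rule sum_square_indicator_diff[OF pn pn]) (use S in auto)
    also have "\<dots> \<le> real (card (sym_diff S (p (Suc k) S) \<union> sym_diff S (p k S)))"
      using fin by (intro of_nat_mono card_mono) auto
    also have "\<dots> \<le> real (card (sym_diff S (p (Suc k) S))) + real (card (sym_diff S (p k S)))"
      by (metis card_Un_le of_nat_add of_nat_mono)
    also have "\<dots> \<le> (1/4)^(Suc k) * real n + (1/4)^k * real n"
      using S by (intro add_mono pd)
    also have "\<dots> = (sqrt (5/4 * real n) * (1/2)^k)\<^sup>2"
    proof -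
      have "((1/2::real)^k)\<^sup>2 = (1/4)^k" 
        unfolding power2_eq_square power_mult_distrib[symmetric] by simp
      then show ?thesis by (simp add: power_mult_distrib)
    qed
    finally show ?thesis .
  qed
  let ?M = "\<lambda>\<sigma> k. Max ((\<lambda>a. \<bar>\<Sum>i<n. \<sigma> i * a i\<bar>) ` A k)"
  have mass: "sign_avg n (\<lambda>\<sigma>. ?M \<sigma> k) \<le> sqrt (40 * (real n * real D)) * ((real k + 1) * (1/2)^k)" for k
  proof -
    let ?E = "exp (real D * (15 + 6 * real k))"
    have "sign_avg n (\<lambda>\<sigma>. ?M \<sigma> k) \<le> (sqrt (5/4 * real n) * (1/2)^k) * sqrt (2 * ln (2 * ?E))"
      using n by (intro massart_finite_class finA cardA normA) auto
    also have "\<dots> \<le> (sqrt (5/4 * real n) * (1/2)^k) * sqrt (32 * real D * (real k + 1)\<^sup>2)"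
    proof (intro mult_left_mono real_sqrt_le_mono)
      have "ln (2 * ?E) = ln 2 + real D * (15 + 6 * real k)" by (simp add: ln_mult)
      also have "\<dots> \<le> real D * 1 + real D * (15 + 6 * real k)" using ln_2_less_1 D by simp
      also have "\<dots> = real D * (16 + 6 * real k)" by (simp add: algebra_simps)
      also have "\<dots> \<le> real D * (16 * (real k + 1)\<^sup>2)"
        by (intro mult_left_mono) (auto simp: power2_eq_square algebra_simps)
      finally show "2 * ln (2 * ?E) \<le> 32 * real D * (real k + 1)\<^sup>2" by simp
    qed simp
    also have "\<dots> = sqrt (40 * (real n * real D)) * ((real k + 1) * (1/2)^k)"
    proof -
      have "sqrt (32 * real D * (real k + 1)\<^sup>2) = sqrt (32 * real D) * (real k + 1)"
        by (simp add: real_sqrt_mult)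
      moreover have "sqrt (5/4 * real n) * sqrt (32 * real D) = sqrt (40 * (real n * real D))"
        by (simp add: real_sqrt_mult[symmetric])
      ultimately show ?thesis by (simp add: mult_ac)
    qed
    finally show ?thesis .
  qed
  \<comment> \<open>At this level the scale 4^(-K) n is below 1, so the chain has reached the set
    itself.\<close>
  define K where "K = n"
  have K: "(1/4)^K * real n < 1"
  proof -
    have "real n < 2 ^ n" by (rule of_nat_less_two_power)
    also have "\<dots> \<le> (4::real) ^ n" by (intro power_mono) auto
    finally show ?thesis by (simp add: K_def power_one_over field_simps)
  qed
  have pK: "p K S = S" if "S \<in> T" for S
  proof -
    have "real (card (sym_diff S (p K S))) < 1" using pd[OF that, of K] K by linarith
    then have "card (sym_diff S (p K S)) = 0" by simp
    moreover have "finite (sym_diff S (p K S))" using pn[OF that, of K] that TP by (auto intro: finite_subset)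
    ultimately show ?thesis by auto
  qed
  have ptw: "Max ((\<lambda>S. \<bar>\<Sum>i<n. \<sigma> i * indicator S i\<bar>) ` T) \<le> (\<Sum>k<K. ?M \<sigma> k)" for \<sigma>
  proof (rule Max.boundedI)
    fix x assume "x \<in> (\<lambda>S. \<bar>\<Sum>i<n. \<sigma> i * indicator S i\<bar>) ` T"
    then obtain S where S: "S \<in> T" "x = \<bar>\<Sum>i<n. \<sigma> i * indicator S i\<bar>" by auto
    have ind: "indicator S i = (\<Sum>k<K. a k S i)" for i
      unfolding a_def by (subst sum_lessThan_telescope) (simp add: pK[OF S(1)], simp add: p_def)
    have "(\<Sum>i<n. \<sigma> i * indicator S i) = (\<Sum>k<K. \<Sum>i<n. \<sigma> i * a k S i)"
      unfolding ind sum_distrib_left by (rule sum.swap)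
    then have "x \<le> (\<Sum>k<K. \<bar>\<Sum>i<n. \<sigma> i * a k S i\<bar>)" unfolding S(2) by (simp add: sum_abs)
    also have "\<dots> \<le> (\<Sum>k<K. ?M \<sigma> k)"
      using finA S(1) by (intro sum_mono Max_ge) (auto simp: A_def)
    finally show "x \<le> (\<Sum>k<K. ?M \<sigma> k)" .
  qed (use finT neT in auto)
  have "sign_avg n (\<lambda>\<sigma>. Max ((\<lambda>S. \<bar>\<Sum>i<n. \<sigma> i * indicator S i\<bar>) ` T)) \<le> sign_avg n (\<lambda>\<sigma>. \<Sum>k<K. ?M \<sigma> k)"
    by (intro sign_avg_mono ptw)
  also have "\<dots> = (\<Sum>k<K. sign_avg n (\<lambda>\<sigma>. ?M \<sigma> k))" by (rule sign_avg_sum)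
  also have "\<dots> \<le> (\<Sum>k<K. sqrt (40 * (real n * real D)) * ((real k + 1) * (1/2)^k))"
    by (intro sum_mono mass)
  also have "\<dots> \<le> sqrt (40 * (real n * real D)) * 4"
    unfolding sum_distrib_left[symmetric] by (intro mult_left_mono sum_arith_geometric_le) auto
  \<comment> \<open>Here 40 = 5/4 * 32, and 4 is the bound of the arithmetic-geometric series; 4
    sqrt 40 is about 25.3.\<close>
  also have "\<dots> = (4 * sqrt 40) * sqrt (real n * real D)" by (simp add: real_sqrt_mult)
  also have "\<dots> \<le> 26 * sqrt (real n * real D)"
  proof (rule mult_right_mono)
    have "sqrt 40 \<le> sqrt (6.5\<^sup>2)" by (intro real_sqrt_le_mono) (simp add: power2_eq_square)
    then show "4 * sqrt 40 \<le> (26::real)" by simp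
  qed simp
  finally show ?thesis by (simp add: T_def)
qed

section \<open>Symmetrization\<close>

lemma integrable_sign_avg:
  assumes "\<And>\<sigma>. integrable M (F \<sigma>)"
  shows "integrable M (\<lambda>x. sign_avg n (\<lambda>\<sigma>. F \<sigma> x))"
  using assms by (induction n arbitrary: F) auto

lemma integral_sign_avg:
  assumes "\<And>\<sigma>. integrable M (F \<sigma>)"
  shows "(\<integral>x. sign_avg n (\<lambda>\<sigma>. F \<sigma> x) \<partial>M) = sign_avg n (\<lambda>\<sigma>. \<integral>x. F \<sigma> x \<partial>M)"
  using assms by (induction n arbitrary: F) (auto simp: integrable_sign_avg)

lemma integral_PiM_component:
  fixes f :: "'a \<Rightarrow> real"
  assumes "prob_space D" "i \<in> I" "f \<in> borel_measurable D"
  shows "(\<integral>y. f (y i) \<partial>(\<Pi>\<^sub>M i\<in>I. D)) = (\<integral>x. f x \<partial>D)"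
proof -
  have "(\<integral>x. f x \<partial>D) = (\<integral>x. f x \<partial>distr (\<Pi>\<^sub>M i\<in>I. D) D (\<lambda>\<omega>. \<omega> i))"
    by (subst distr_PiM_component) (use assms in auto)
  also have "\<dots> = (\<integral>y. f (y i) \<partial>(\<Pi>\<^sub>M i\<in>I. D))"
    by (rule integral_distr) (use assms in auto)
  finally show ?thesis ..
qed

lemma abs_Max_le:
  assumes "finite Q" "Q \<noteq> {}" "\<And>q. q \<in> Q \<Longrightarrow> \<bar>f q\<bar> \<le> (B::real)"
  shows "\<bar>Max (f ` Q)\<bar> \<le> B"
proof -
  have "Max (f ` Q) \<in> f ` Q" using assms by (intro Max_in) auto
  then show ?thesis using assms(3) by auto
qed

lemma (in prob_space) abs_integral_le:
  fixes f :: "'a \<Rightarrow> real"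
  assumes "f \<in> borel_measurable M" "\<And>x. \<bar>f x\<bar> \<le> B"
  shows "\<bar>\<integral>x. f x \<partial>M\<bar> \<le> B"
proof -
  have int: "integrable M f" using assms by (intro integrable_const_bound[of _ B]) auto
  have "\<bar>\<integral>x. f x \<partial>M\<bar> \<le> (\<integral>x. \<bar>f x\<bar> \<partial>M)" by (rule integral_abs_bound)
  also have "\<dots> \<le> B" using assms(2) by (intro integral_le_const integrable_abs int) auto
  finally show ?thesis .
qed

text \<open>Ghost sample: the joint sample has 2 n coordinates, the observed ones in
  \<open>I\<close> and an independent copy in \<open>J\<close>. The expectation is a mean over the
  copy, a maximum of means is at most the mean of the maximum, and exchanging the coordinates i and
  n + i does not change the joint law. The class \<open>Q\<close> is finite, so the maxima are
  measurable; \<open>K\<close> bounds the sign average at every fixed sample.\<close>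

lemma symmetrization:
  fixes g :: "'q \<Rightarrow> 'a \<Rightarrow> real"
  assumes D: "prob_space D" and Q: "finite Q" "Q \<noteq> {}" and n: "0 < n"
    and meas: "\<And>q. q \<in> Q \<Longrightarrow> g q \<in> borel_measurable D"
    and bd: "\<And>q x. q \<in> Q \<Longrightarrow> \<bar>g q x\<bar> \<le> B"
    and K: "\<And>s. sign_avg n (\<lambda>\<sigma>. Max ((\<lambda>q. \<Sum>i<n. \<sigma> i * g q (s i)) ` Q)) \<le> K"
  shows "(\<integral>s. Max ((\<lambda>q. (\<integral>x. g q x \<partial>D) - (\<Sum>i<n. g q (s i)) / real n) ` Q) \<partial>(\<Pi>\<^sub>M i\<in>{..<n}. D))
    \<le> 2 * K / real n"
proof -
  interpret D: prob_space D by fact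
  interpret P: product_sigma_finite "\<lambda>_::nat. D" by standard
  define I where "I = {..<n}"
  define J where "J = {n..<2 * n}"
  have IJ: "I \<inter> J = {}" "I \<union> J = {..<2 * n}" "finite I" "finite J" by (auto simp: I_def J_def)
  let ?P = "\<lambda>I :: nat set. \<Pi>\<^sub>M i\<in>I. D"
  have prob: "prob_space (?P I)" for I by (rule prob_space_PiM) (rule D)
  define \<Psi> where "\<Psi> \<sigma> \<omega> = Max ((\<lambda>q. (\<Sum>i<n. \<sigma> i * (g q (\<omega> (n + i)) - g q (\<omega> i))) / real n) ` Q)" for \<sigma> \<omega>
  define \<Theta> where "\<Theta> s y = Max ((\<lambda>q. (\<Sum>i<n. g q (y (n + i)) - g q (s i)) / real n) ` Q)" for s y
  define \<Phi> where "\<Phi> s = Max ((\<lambda>q. (\<integral>x. g q x \<partial>D) - (\<Sum>i<n. g q (s i)) / real n) ` Q)" for s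
  have B0: "B \<ge> 0" using Q bd[of _ undefined] by (meson abs_ge_zero all_not_in_conv order_trans)
  have comp: "(\<lambda>\<omega>. g q (\<omega> i)) \<in> borel_measurable (?P K)" if "q \<in> Q" "i \<in> K" for q i K
    using meas[OF that(1)] measurable_component_singleton[OF that(2)] by (rule measurable_compose_rev)
  have sum_bd: "\<bar>(\<Sum>i<n. c i * (g q (a i) - g q (b i))) / real n\<bar> \<le> C * (2 * B)"
    if "\<And>i. i < n \<Longrightarrow> \<bar>c i\<bar> \<le> C" "q \<in> Q" for c a b C q
  proof -
    have "\<bar>\<Sum>i<n. c i * (g q (a i) - g q (b i))\<bar> \<le> (\<Sum>i<n. \<bar>c i * (g q (a i) - g q (b i))\<bar>)" by (rule sum_abs)
    also have "\<dots> \<le> (\<Sum>i<n. C * (2 * B))"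
    proof (rule sum_mono)
      fix i assume "i \<in> {..<n}"
      then have "\<bar>c i\<bar> \<le> C" using that by simp
      moreover have "\<bar>g q (a i) - g q (b i)\<bar> \<le> 2 * B"
        using bd[OF that(2), of "a i"] bd[OF that(2), of "b i"] by linarith
      ultimately show "\<bar>c i * (g q (a i) - g q (b i))\<bar> \<le> C * (2 * B)"
        unfolding abs_mult by (intro mult_mono) auto
    qed
    finally show ?thesis using n by (simp add: field_simps)
  qed
  have \<Psi>_meas: "\<Psi> \<sigma> \<in> borel_measurable (?P (I \<union> J))" for \<sigma>
    unfolding \<Psi>_def using Q
    by (intro borel_measurable_Max borel_measurable_divide borel_measurable_sum borel_measurable_times
        borel_measurable_diff borel_measurable_const comp) (auto simp: I_def J_def)
  have \<Psi>_int: "integrable (?P (I \<union> J)) (\<Psi> \<sigma>)" for \<sigma>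
  proof -
    interpret PP: prob_space "?P (I \<union> J)" by (rule prob)
    \<comment> \<open>\<open>integral_sign_avg\<close> asks for integrability at every \<sigma>, not
      only at sign vectors, so the entries of \<sigma> are bounded by some \<open>C\<close>.\<close>
    obtain C where C: "\<And>i. i < n \<Longrightarrow> \<bar>\<sigma> i\<bar> \<le> C"
      using finite_imageI[of "{..<n}" "\<lambda>i. \<bar>\<sigma> i\<bar>"] Max_ge by (metis finite_lessThan imageI lessThan_iff)
    have "\<bar>\<Psi> \<sigma> \<omega>\<bar> \<le> C * (2 * B)" for \<omega>
      unfolding \<Psi>_def using Q by (intro abs_Max_le sum_bd C) auto
    then show ?thesis by (intro PP.integrable_const_bound[of _ "C * (2 * B)"] \<Psi>_meas) auto
  qed
  have \<Theta>_bd: "\<bar>\<Theta> s y\<bar> \<le> 2 * B" for s y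
    unfolding \<Theta>_def
  proof (rule abs_Max_le[OF Q])
    fix q assume "q \<in> Q"
    from sum_bd[of "\<lambda>_. 1" 1 q "\<lambda>i. y (n + i)" s] this
    show "\<bar>(\<Sum>i<n. g q (y (n + i)) - g q (s i)) / real n\<bar> \<le> 2 * B" by simp
  qed
  have \<Theta>_meas: "\<Theta> s \<in> borel_measurable (?P J)" for s
    unfolding \<Theta>_def using Q
    by (intro borel_measurable_Max borel_measurable_divide borel_measurable_sum
        borel_measurable_diff borel_measurable_const comp) (auto simp: J_def)
  have \<Theta>_int: "integrable (?P J) (\<Theta> s)" for s
  proof -
    interpret PP: prob_space "?P J" by (rule prob)
    show ?thesis by (intro PP.integrable_const_bound[of _ "2 * B"] \<Theta>_meas) (simp add: \<Theta>_bd)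
  qed
  have \<Theta>_merge: "\<Psi> (\<lambda>_. 1) (merge I J (s, y)) = \<Theta> s y" for s y
    unfolding \<Psi>_def \<Theta>_def by (auto simp: merge_def I_def J_def intro!: arg_cong[where f = Max] image_cong sum.cong)
  have step1: "\<Phi> s \<le> (\<integral>y. \<Theta> s y \<partial>?P J)" for s
    unfolding \<Phi>_def
  proof (rule Max.boundedI)
    fix x assume "x \<in> (\<lambda>q. (\<integral>x. g q x \<partial>D) - (\<Sum>i<n. g q (s i)) / real n) ` Q"
    then obtain q where q: "q \<in> Q" "x = (\<integral>x. g q x \<partial>D) - (\<Sum>i<n. g q (s i)) / real n" by auto
    interpret PP: prob_space "?P J" by (rule prob)
    have int: "integrable (?P J) (\<lambda>y. g q (y (n + i)))" if "i < n" for i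
      using that q bd by (intro PP.integrable_const_bound[of _ B] comp) (auto simp: J_def)
    have "(\<integral>y. (\<Sum>i<n. g q (y (n + i)) - g q (s i)) / real n \<partial>?P J) =
       (\<Sum>i<n. (\<integral>y. g q (y (n + i)) \<partial>?P J) - g q (s i)) / real n"
      using int by (simp add: PP.prob_space)
    also have "\<dots> = (\<Sum>i<n. (\<integral>x. g q x \<partial>D) - g q (s i)) / real n"
      using meas[OF q(1)] by (intro arg_cong2[where f = "(/)"] sum.cong refl arg_cong2[where f = "(-)"] integral_PiM_component D) (auto simp: J_def)
    also have "\<dots> = x" unfolding q(2) using n by (simp add: sum_subtractf field_simps)
    finally have "x = (\<integral>y. (\<Sum>i<n. g q (y (n + i)) - g q (s i)) / real n \<partial>?P J)" ..
    also have "\<dots> \<le> (\<integral>y. \<Theta> s y \<partial>?P J)"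
    proof (rule integral_mono)
      show "integrable (?P J) (\<lambda>y. (\<Sum>i<n. g q (y (n + i)) - g q (s i)) / real n)"
        by (intro integrable_divide Bochner_Integration.integrable_sum Bochner_Integration.integrable_diff int PP.integrable_const) auto
      show "(\<Sum>i<n. g q (y (n + i)) - g q (s i)) / real n \<le> \<Theta> s y" for y
        unfolding \<Theta>_def using Q q by (intro Max_ge) auto
    qed (rule \<Theta>_int)
    finally show "x \<le> (\<integral>y. \<Theta> s y \<partial>?P J)" .
  qed (use Q in auto)
  have \<Phi>_int: "integrable (?P I) \<Phi>"
  proof -
    interpret PP: prob_space "?P I" by (rule prob)
    have "\<bar>\<Phi> s\<bar> \<le> 2 * B" for s
      unfolding \<Phi>_def
    proof (rule abs_Max_le[OF Q])
      fix q assume q: "q \<in> Q"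
      have "\<bar>\<integral>x. g q x \<partial>D\<bar> \<le> B"
        by (intro D.abs_integral_le meas bd q)
      moreover have "\<bar>\<Sum>i<n. g q (s i)\<bar> \<le> real n * B"
        using bd[OF q] by (intro order_trans[OF sum_abs] order_trans[OF sum_bounded_above]) auto
      then have "\<bar>(\<Sum>i<n. g q (s i)) / real n\<bar> \<le> B" using n by (simp add: field_simps)
      ultimately show "\<bar>(\<integral>x. g q x \<partial>D) - (\<Sum>i<n. g q (s i)) / real n\<bar> \<le> 2 * B" by linarith
    qed
    moreover have "\<Phi> \<in> borel_measurable (?P I)"
      unfolding \<Phi>_def using Q
      by (intro borel_measurable_Max borel_measurable_divide borel_measurable_sum
          borel_measurable_diff borel_measurable_const comp) (auto simp: I_def)
    ultimately show ?thesis by (intro PP.integrable_const_bound[of _ "2 * B"]) auto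
  qed
  have "(\<integral>s. \<Phi> s \<partial>?P I) \<le> (\<integral>s. (\<integral>y. \<Theta> s y \<partial>?P J) \<partial>?P I)"
  proof (rule integral_mono[OF \<Phi>_int])
    interpret PP: prob_space "?P I" by (rule prob)
    interpret PJ: prob_space "?P J" by (rule prob)
    have "(\<lambda>(s, y). \<Theta> s y) = (\<lambda>x. \<Psi> (\<lambda>_. 1) (merge I J x))" by (auto simp: \<Theta>_merge)
    then have "(\<lambda>(s, y). \<Theta> s y) \<in> borel_measurable (?P I \<Otimes>\<^sub>M ?P J)"
      using measurable_compose[OF measurable_merge \<Psi>_meas[of "\<lambda>_. 1"]] by simp
    then have "(\<lambda>s. \<integral>y. \<Theta> s y \<partial>?P J) \<in> borel_measurable (?P I)"
      by (rule PJ.borel_measurable_lebesgue_integral)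
    moreover have "\<bar>\<integral>y. \<Theta> s y \<partial>?P J\<bar> \<le> 2 * B" for s
      by (intro PJ.abs_integral_le \<Theta>_meas \<Theta>_bd)
    ultimately show "integrable (?P I) (\<lambda>s. \<integral>y. \<Theta> s y \<partial>?P J)"
      by (intro PP.integrable_const_bound[of _ "2 * B"]) auto
  qed (rule step1)
  also have "\<dots> = (\<integral>s. (\<integral>y. \<Psi> (\<lambda>_. 1) (merge I J (s, y)) \<partial>?P J) \<partial>?P I)"
    by (simp add: \<Theta>_merge)
  also have "\<dots> = (\<integral>\<omega>. \<Psi> (\<lambda>_. 1) \<omega> \<partial>?P (I \<union> J))"
    by (rule P.product_integral_fold[symmetric]) (use IJ \<Psi>_int in auto)
  also have "\<dots> = sign_avg n (\<lambda>\<sigma>. \<integral>\<omega>. \<Psi> \<sigma> \<omega> \<partial>?P (I \<union> J))"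
  proof -
    have "(\<integral>\<omega>. \<Psi> \<sigma> \<omega> \<partial>?P (I \<union> J)) = (\<integral>\<omega>. \<Psi> (\<lambda>_. 1) \<omega> \<partial>?P (I \<union> J))" if \<sigma>: "\<sigma> \<in> sign_vectors n" for \<sigma>
    proof -
      \<comment> \<open>The exchange of i and n + i exactly where \<sigma> is -1: an involution that
        turns the signs into a relabelling of the coordinates.\<close>
      define \<tau> where "\<tau> i = (if i < n then (if \<sigma> i = 1 then i else n + i) else (if \<sigma> (i - n) = 1 then i else i - n))" for i
      have \<tau>\<tau>: "\<tau> (\<tau> i) = i" if "i \<in> I \<union> J" for i using that unfolding IJ \<tau>_def by auto
      have inj: "inj_on \<tau> (I \<union> J)" by (rule inj_on_inverseI[of _ \<tau>]) (rule \<tau>\<tau>)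
      have to: "\<tau> \<in> (I \<union> J) \<rightarrow> (I \<union> J)" unfolding IJ \<tau>_def by auto
      have "?P (I \<union> J) = distr (?P (I \<union> J)) (?P (I \<union> J)) (\<lambda>\<omega>. \<lambda>i\<in>I \<union> J. \<omega> (\<tau> i))"
        using distr_PiM_reindex[where M = "\<lambda>_. D" and f = \<tau>, OF D inj to] by simp
      then have "(\<integral>\<omega>. \<Psi> (\<lambda>_. 1) \<omega> \<partial>?P (I \<union> J)) =
         (\<integral>\<omega>. \<Psi> (\<lambda>_. 1) \<omega> \<partial>distr (?P (I \<union> J)) (?P (I \<union> J)) (\<lambda>\<omega>. \<lambda>i\<in>I \<union> J. \<omega> (\<tau> i)))"
        by simp
      also have "\<dots> = (\<integral>\<omega>. \<Psi> (\<lambda>_. 1) (\<lambda>i\<in>I \<union> J. \<omega> (\<tau> i)) \<partial>?P (I \<union> J))"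
        by (intro integral_distr \<Psi>_meas measurable_restrict measurable_component_singleton) (use to in auto)
      also have "(\<lambda>\<omega>. \<Psi> (\<lambda>_. 1) (\<lambda>i\<in>I \<union> J. \<omega> (\<tau> i))) = \<Psi> \<sigma>"
      proof
        fix \<omega>
        have "1 * (g q ((\<lambda>i\<in>I \<union> J. \<omega> (\<tau> i)) (n + i)) - g q ((\<lambda>i\<in>I \<union> J. \<omega> (\<tau> i)) i)) = \<sigma> i * (g q (\<omega> (n + i)) - g q (\<omega> i))"
          if "i < n" for q i
        proof -
          have "n + i \<in> I \<union> J" "i \<in> I \<union> J" using that by (auto simp: IJ)
          moreover have "\<sigma> i = 1 \<or> \<sigma> i = -1" using \<sigma> that by (auto simp: sign_vectors_def split: if_splits)
          ultimately show ?thesis using that by (auto simp: \<tau>_def)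
        qed
        then show "\<Psi> (\<lambda>_. 1) (\<lambda>i\<in>I \<union> J. \<omega> (\<tau> i)) = \<Psi> \<sigma> \<omega>"
          unfolding \<Psi>_def by (intro arg_cong[where f = Max] image_cong refl arg_cong2[where f = "(/)"] sum.cong) auto
      qed
      finally show ?thesis ..
    qed
    then show ?thesis
      using sign_avg_cong[of n "\<lambda>\<sigma>. \<integral>\<omega>. \<Psi> \<sigma> \<omega> \<partial>?P (I \<union> J)" "\<lambda>_. \<integral>\<omega>. \<Psi> (\<lambda>_. 1) \<omega> \<partial>?P (I \<union> J)"] by simp
  qed
  also have "\<dots> = (\<integral>\<omega>. sign_avg n (\<lambda>\<sigma>. \<Psi> \<sigma> \<omega>) \<partial>?P (I \<union> J))"
    by (rule integral_sign_avg[symmetric]) (rule \<Psi>_int)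
  also have "\<dots> \<le> 2 * K / real n"
  proof -
    interpret PP: prob_space "?P (I \<union> J)" by (rule prob)
    have "sign_avg n (\<lambda>\<sigma>. \<Psi> \<sigma> \<omega>) \<le> 2 * K / real n" for \<omega>
    proof -
      let ?A = "\<lambda>\<sigma>. Max ((\<lambda>q. \<Sum>i<n. \<sigma> i * g q (\<omega> (n + i))) ` Q)"
      let ?B = "\<lambda>\<sigma>. Max ((\<lambda>q. \<Sum>i<n. \<sigma> i * g q (\<omega> i)) ` Q)"
      \<comment> \<open>Both halves are bounded separately, which costs the factor 2; the reversed
        signs of the second half are undone by averaging.\<close>
      have "\<Psi> \<sigma> \<omega> \<le> (1 / real n) * (?A \<sigma> + ?B (\<lambda>i. - \<sigma> i))" for \<sigma>
        unfolding \<Psi>_def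
      proof (rule Max.boundedI)
        fix x assume "x \<in> (\<lambda>q. (\<Sum>i<n. \<sigma> i * (g q (\<omega> (n + i)) - g q (\<omega> i))) / real n) ` Q"
        then obtain q where q: "q \<in> Q" "x = (\<Sum>i<n. \<sigma> i * (g q (\<omega> (n + i)) - g q (\<omega> i))) / real n" by auto
        have "(\<Sum>i<n. \<sigma> i * (g q (\<omega> (n + i)) - g q (\<omega> i))) =
          (\<Sum>i<n. \<sigma> i * g q (\<omega> (n + i))) + (\<Sum>i<n. - \<sigma> i * g q (\<omega> i))"
          by (simp add: sum.distrib[symmetric] algebra_simps)
        also have "\<dots> \<le> ?A \<sigma> + ?B (\<lambda>i. - \<sigma> i)"
          using Q q by (intro add_mono Max_ge) auto
        finally show "x \<le> (1 / real n) * (?A \<sigma> + ?B (\<lambda>i. - \<sigma> i))"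
          unfolding q(2) using n by (simp add: divide_right_mono)
      qed (use Q in auto)
      then have "sign_avg n (\<lambda>\<sigma>. \<Psi> \<sigma> \<omega>) \<le> sign_avg n (\<lambda>\<sigma>. (1 / real n) * (?A \<sigma> + ?B (\<lambda>i. - \<sigma> i)))"
        by (intro sign_avg_mono)
      also have "\<dots> = (1 / real n) * (sign_avg n ?A + sign_avg n ?B)"
        by (simp only: sign_avg_cmult sign_avg_add sign_avg_uminus[where F = ?B])
      also have "\<dots> \<le> (1 / real n) * (K + K)"
        using K by (intro mult_left_mono add_mono) auto
      finally show ?thesis by simp
    qed
    then show ?thesis by (intro PP.integral_le_const integrable_sign_avg \<Psi>_int) auto
  qed
  finally show ?thesis unfolding \<Phi>_def I_def .
qed

section \<open>Spline approximation of Lipschitz functions\<close>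

text \<open>This recursion takes the innermost difference first, which lowers the degree of a
  polynomial; \<open>fdiff_Suc\<close> takes the last difference outside, which telescopes.\<close>

fun fdiff :: "nat \<Rightarrow> (nat \<Rightarrow> real) \<Rightarrow> nat \<Rightarrow> real" where
  "fdiff 0 F m = F m"
| "fdiff (Suc k) F m = fdiff k (\<lambda>m. F (Suc m) - F m) m"

lemma fdiff_cong: "(\<And>j. j \<le> k \<Longrightarrow> F (m + j) = G (m + j)) \<Longrightarrow> fdiff k F m = fdiff k G m"
proof (induction k arbitrary: F G)
  case (Suc k)
  have "F (Suc (m + j)) - F (m + j) = G (Suc (m + j)) - G (m + j)" if "j \<le> k" for j
    using Suc.prems[of j] Suc.prems[of "Suc j"] that by simp
  then show ?case unfolding fdiff.simps by (intro Suc.IH) simp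
next
  case 0
  from 0[of 0] show ?case by simp
qed

lemma fdiff_0 [simp]: "fdiff k (\<lambda>_. 0) m = 0"
  by (induction k) auto

lemma fdiff_diff: "fdiff k (\<lambda>m. F m - G m) m = fdiff k F m - fdiff k G m"
proof (induction k arbitrary: F G)
  case (Suc k)
  have "(\<lambda>m. F (Suc m) - G (Suc m) - (F m - G m)) = (\<lambda>m. (F (Suc m) - F m) - (G (Suc m) - G m))" by auto
  then show ?case by (simp add: Suc.IH)
qed simp

lemma fdiff_add: "fdiff k (\<lambda>m. F m + G m) m = fdiff k F m + fdiff k G m"
proof (induction k arbitrary: F G)
  case (Suc k)
  have "(\<lambda>m. F (Suc m) + G (Suc m) - (F m + G m)) = (\<lambda>m. (F (Suc m) - F m) + (G (Suc m) - G m))" by auto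
  then show ?case by (simp add: Suc.IH)
qed simp

lemma fdiff_cmult: "fdiff k (\<lambda>m. c * F m) m = c * fdiff k F m"
proof (induction k arbitrary: F)
  case (Suc k)
  have "(\<lambda>m. c * F (Suc m) - c * F m) = (\<lambda>m. c * (F (Suc m) - F m))" by (auto simp: algebra_simps)
  then show ?case by (simp add: Suc.IH)
qed simp

lemma fdiff_sum: "fdiff k (\<lambda>m. \<Sum>i\<in>I. F i m) m = (\<Sum>i\<in>I. fdiff k (F i) m)"
  by (induction I rule: infinite_finite_induct) (auto simp: fdiff_add)

lemma fdiff_shift: "fdiff k (\<lambda>m. F (Suc m)) m = fdiff k F (Suc m)"
  by (induction k arbitrary: F) auto

lemma fdiff_Suc: "fdiff (Suc k) F m = fdiff k F (Suc m) - fdiff k F m"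
  by (simp add: fdiff_diff fdiff_shift)

text \<open>One difference of a power is a polynomial of lower degree; after \<open>k\<close> of
  them only a leading term of degree \<open>k\<close> can survive.\<close>

lemma fdiff_power:
  "j \<le> k \<Longrightarrow> fdiff k (\<lambda>m. (x + y * real m) ^ j) m = (if j = k then y ^ k * fact k else 0)"
proof (induction k arbitrary: j)
  case (Suc k)
  have step: "(x + y * real (Suc l)) ^ j - (x + y * real l) ^ j =
      (\<Sum>i<j. (real (j choose i) * y ^ (j - i)) * (x + y * real l) ^ i)" for l
  proof -
    have "(x + y * real (Suc l)) ^ j = ((x + y * real l) + y) ^ j" by (simp add: algebra_simps)
    also have "\<dots> = (\<Sum>i\<le>j. of_nat (j choose i) * (x + y * real l) ^ i * y ^ (j - i))"
      by (rule binomial_ring)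
    also have "\<dots> = (\<Sum>i<j. of_nat (j choose i) * (x + y * real l) ^ i * y ^ (j - i)) + (x + y * real l) ^ j"
      by (simp add: lessThan_Suc_atMost[symmetric])
    finally show ?thesis by (simp add: mult_ac)
  qed
  have "fdiff (Suc k) (\<lambda>m. (x + y * real m) ^ j) m =
      (\<Sum>i<j. (real (j choose i) * y ^ (j - i)) * fdiff k (\<lambda>m. (x + y * real m) ^ i) m)"
    by (simp only: fdiff.simps step fdiff_sum fdiff_cmult)
  also have "\<dots> = (\<Sum>i<j. (real (j choose i) * y ^ (j - i)) * (if i = k then y ^ k * fact k else 0))"
    using Suc.prems by (intro sum.cong refl, subst Suc.IH) auto
  also have "\<dots> = (if j = Suc k then y ^ Suc k * fact (Suc k) else 0)"
  proof (cases "j = Suc k")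
    case True
    then show ?thesis by (simp add: sum.delta if_distrib cong: if_cong)
  next
    case False
    then show ?thesis using Suc.prems by (auto intro!: sum.neutral)
  qed
  finally show ?case .
qed simp

lemma abs_fdiff_le: "(\<And>j. j \<le> k \<Longrightarrow> \<bar>F (m + j)\<bar> \<le> B) \<Longrightarrow> \<bar>fdiff k F m\<bar> \<le> 2 ^ k * B"
proof (induction k arbitrary: m)
  case (Suc k)
  have "\<bar>fdiff k F (Suc m)\<bar> \<le> 2 ^ k * B"
    using Suc.prems[of "Suc _"] by (intro Suc.IH) auto
  moreover have "\<bar>fdiff k F m\<bar> \<le> 2 ^ k * B"
    by (intro Suc.IH Suc.prems) auto
  ultimately show ?case unfolding fdiff_Suc by simp
next
  case 0
  from 0[of 0] show ?case by simp
qed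

text \<open>The knot bound \<open>S\<close> will limit the norm of the neuron weights, and the cost
  \<open>B\<close> the total variation. A list may repeat knots, so sums are concatenations.\<close>

definition spline_combination :: "nat \<Rightarrow> real \<Rightarrow> real \<Rightarrow> (real \<Rightarrow> real) \<Rightarrow> bool" where
  "spline_combination a S B g \<longleftrightarrow> (\<exists>xs. (\<forall>(c, s)\<in>set xs. \<bar>s\<bar> \<le> S) \<and> (\<Sum>(c, s)\<leftarrow>xs. \<bar>c\<bar>) \<le> B \<and>
     g = (\<lambda>t. \<Sum>(c, s)\<leftarrow>xs. c * pos_power a (t - s)))"

lemma spline_combination_0: "spline_combination a S 0 (\<lambda>_. 0)"
  unfolding spline_combination_def by (intro exI[of _ "[]"]) auto

lemma spline_combination_single: "\<bar>s\<bar> \<le> S \<Longrightarrow> spline_combination a S 1 (\<lambda>t. pos_power a (t - s))"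
  unfolding spline_combination_def by (intro exI[of _ "[(1, s)]"]) auto

lemma spline_combination_add:
  assumes "spline_combination a S B g" "spline_combination a S B' g'"
  shows "spline_combination a S (B + B') (\<lambda>t. g t + g' t)"
proof -
  obtain xs ys where "(\<forall>(c, s)\<in>set xs. \<bar>s\<bar> \<le> S) \<and> (\<Sum>(c, s)\<leftarrow>xs. \<bar>c\<bar>) \<le> B \<and>
     g = (\<lambda>t. \<Sum>(c, s)\<leftarrow>xs. c * pos_power a (t - s))"
    "(\<forall>(c, s)\<in>set ys. \<bar>s\<bar> \<le> S) \<and> (\<Sum>(c, s)\<leftarrow>ys. \<bar>c\<bar>) \<le> B' \<and>
     g' = (\<lambda>t. \<Sum>(c, s)\<leftarrow>ys. c * pos_power a (t - s))"
    using assms unfolding spline_combination_def by blast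
  then show ?thesis unfolding spline_combination_def by (intro exI[of _ "xs @ ys"]) auto
qed

lemma spline_combination_cmult:
  assumes "spline_combination a S B g"
  shows "spline_combination a S (\<bar>r\<bar> * B) (\<lambda>t. r * g t)"
proof -
  obtain xs where xs: "\<forall>(c, s)\<in>set xs. \<bar>s\<bar> \<le> S" "(\<Sum>(c, s)\<leftarrow>xs. \<bar>c\<bar>) \<le> B"
     "g = (\<lambda>t. \<Sum>(c, s)\<leftarrow>xs. c * pos_power a (t - s))"
    using assms unfolding spline_combination_def by blast
  let ?ys = "map (\<lambda>(c, s). (r * c, s)) xs"
  have 1: "(\<Sum>(c, s)\<leftarrow>?ys. \<bar>c\<bar>) = \<bar>r\<bar> * (\<Sum>(c, s)\<leftarrow>xs. \<bar>c\<bar>)"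
    by (induction xs) (auto simp: algebra_simps abs_mult)
  have 2: "(\<Sum>(c, s)\<leftarrow>?ys. c * pos_power a (t - s)) = r * (\<Sum>(c, s)\<leftarrow>xs. c * pos_power a (t - s))" for t
    by (induction xs) (auto simp: algebra_simps)
  show ?thesis unfolding spline_combination_def
    by (rule exI[of _ ?ys], unfold 1 2) (use xs in \<open>auto intro: mult_left_mono\<close>)
qed

lemma spline_combination_diff:
  assumes "spline_combination a S B g" "spline_combination a S B' g'"
  shows "spline_combination a S (B + B') (\<lambda>t. g t - g' t)"
  using spline_combination_add[OF assms(1) spline_combination_cmult[OF assms(2), of "-1"]] by simp

lemma spline_combination_sum:
  assumes "finite I" "\<And>i. i \<in> I \<Longrightarrow> spline_combination a S (B i) (g i)"
  shows "spline_combination a S (\<Sum>i\<in>I. B i) (\<lambda>t. \<Sum>i\<in>I. g i t)"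
  using assms by (induction I rule: finite_induct)
    (auto intro: spline_combination_0 spline_combination_add)

lemma spline_combination_fdiff:
  "(\<And>j. j \<le> k \<Longrightarrow> spline_combination a S 1 (G (m + j))) \<Longrightarrow>
     spline_combination a S (2 ^ k) (\<lambda>t. fdiff k (\<lambda>m. G m t) m)"
proof (induction k arbitrary: m)
  case (Suc k)
  have "spline_combination a S (2 ^ k) (\<lambda>t. fdiff k (\<lambda>m. G m t) (Suc m))"
    using Suc.prems[of "Suc _"] by (intro Suc.IH) auto
  moreover have "spline_combination a S (2 ^ k) (\<lambda>t. fdiff k (\<lambda>m. G m t) m)"
    by (intro Suc.IH Suc.prems) auto
  ultimately have "spline_combination a S (2 ^ k + 2 ^ k) (\<lambda>t. fdiff k (\<lambda>m. G m t) (Suc m) - fdiff k (\<lambda>m. G m t) m)"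
    by (rule spline_combination_diff)
  then show ?case unfolding fdiff_Suc by simp
next
  case 0
  from 0[of 0] show ?case by simp
qed

lemma summation_by_parts:
  fixes H F :: "nat \<Rightarrow> real"
  shows "(\<Sum>i<Suc M. H i * (F (Suc i) - F i)) =
    H M * F (Suc M) - H 0 * F 0 - (\<Sum>i<M. (H (Suc i) - H i) * F (Suc i))"
  by (induction M) (auto simp: algebra_simps)

text \<open>
  Quasi-interpolation by B-splines of degree \<open>a\<close> with knots at distance \<open>e\<close>. One summation by parts
  moves a difference onto the Lipschitz function \<open>h\<close>, and this gives the cost \<open>e\<^sup>-\<^sup>a\<close> instead of
  \<open>e\<^sup>-\<^sup>a\<^sup>-\<^sup>1\<close>.
\<close>

lemma spline_approximation:
  fixes h :: "real \<Rightarrow> real"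
  assumes a: "1 \<le> a" and e: "0 < e" "e \<le> 1"
    and lip: "\<And>s t. \<bar>h s - h t\<bar> \<le> \<bar>s - t\<bar>" and bd: "\<And>t. \<bar>h t\<bar> \<le> 1"
  defines "K \<equiv> 2 ^ Suc a * real (a + 4) ^ (a + 2)"
  shows "\<exists>g. spline_combination a (real a + 2) (K * (1 / e) ^ a) g \<and> (\<forall>t\<in>{-1..1}. \<bar>g t - h t\<bar> \<le> K * e)"
proof -
  \<comment> \<open>The grid starts a + 1 steps left of -1, so the knots 0 to a lie left of every t
    in [-1, 1], and the difference of order \<open>a\<close> at 0 already has its constant
    value.\<close>
  define \<tau> where "\<tau> = -1 - (real a + 1) * e"
  define s where "s m = \<tau> + e * real m" for m
  \<comment> \<open>So many steps that \<open>s M\<close> reaches 1; differences that start beyond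
    it vanish on [-1, 1].\<close>
  define M where "M = nat \<lceil>(2 + (real a + 1) * e) / e\<rceil>"
  have M1: "2 + (real a + 1) * e \<le> e * real M"
  proof -
    have "(2 + (real a + 1) * e) / e \<le> real M" unfolding M_def by linarith
    then show ?thesis using e by (simp add: field_simps)
  qed
  have M2: "e * real M \<le> 2 + (real a + 2) * e"
  proof -
    have "0 \<le> (2 + (real a + 1) * e) / e" using e by simp
    then have "real M \<le> (2 + (real a + 1) * e) / e + 1" unfolding M_def by linarith
    then have "e * real M \<le> e * ((2 + (real a + 1) * e) / e + 1)" using e by (intro mult_left_mono) auto
    also have "\<dots> = (2 + (real a + 1) * e) + e" using e by (subst distrib_left) simp
    also have "\<dots> = 2 + (real a + 2) * e" by (simp add: algebra_simps)
    finally show ?thesis .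
  qed
  define P where "P t m = pos_power a (t - s m)" for t m
  \<comment> \<open>Normalizes the B-splines \<open>c * fdiff (Suc a) (P t) i\<close> to sum 1; the
    sign makes up for \<open>(- e) ^ a\<close> and for a telescoping sum that ends at 0.\<close>
  define c where "c = (-1) ^ Suc a / (e ^ a * fact a)"
  have c_abs: "\<bar>c\<bar> = (1 / e) ^ a / fact a" using e by (simp add: c_def abs_mult power_abs power_one_over)
  define g where "g t = c * (\<Sum>i<Suc M. h (s i) * fdiff (Suc a) (P t) i)" for t
  have pp: "pos_power a u = u ^ a" if "0 \<le> u" for u using that a by (auto simp: pos_power_def)
  have pn: "pos_power a u = 0" if "u \<le> 0" for u using that by (auto simp: pos_power_def)
  have s_mono: "s i \<le> s j" if "i \<le> j" for i j using that e by (simp add: s_def)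
  have poly: "fdiff k (P t) i = (if k = a then (- e) ^ a * fact a else 0)" if "s (i + k) \<le> t" "a \<le> k" for t i k
  proof -
    have "fdiff k (P t) i = fdiff k (\<lambda>m. ((t - \<tau>) + (- e) * real m) ^ a) i"
    proof (rule fdiff_cong)
      fix j assume "j \<le> k"
      then have "s (i + j) \<le> t" using that s_mono[of "i + j" "i + k"] by simp
      then show "P t (i + j) = ((t - \<tau>) + (- e) * real (i + j)) ^ a"
        unfolding P_def by (subst pp) (auto simp: s_def algebra_simps)
    qed
    also have "\<dots> = (if a = k then (- e) ^ k * fact k else 0)"
      by (rule fdiff_power[OF that(2)])
    finally show ?thesis by auto
  qed
  have left: "fdiff k (P t) i = 0" if "t \<le> s i" for t i k
  proof -
    have "fdiff k (P t) i = fdiff k (\<lambda>_. 0) i"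
    proof (rule fdiff_cong)
      fix j assume "j \<le> k"
      have "t \<le> s (i + j)" using that s_mono[of i "i + j"] by simp
      then show "P t (i + j) = 0" unfolding P_def by (intro pn) auto
    qed
    then show ?thesis by simp
  qed
  have sM: "t \<le> s (Suc M)" if "t \<le> 1" for t
    using M1 e that by (simp add: s_def \<tau>_def algebra_simps)
  \<comment> \<open>The boundary term at the right end vanishes for t \<le> 1, so the agreement of
    the combination with \<open>g\<close> is claimed on [-1, 1] only.\<close>
  have cost: "\<exists>G. spline_combination a (real a + 2) (K * (1 / e) ^ a) G \<and> (\<forall>t\<in>{-1..1}. g t = G t)"
  proof -
    let ?G = "\<lambda>t. c * (- h (s 0) * fdiff a (P t) 0 - (\<Sum>i<M. (h (s (Suc i)) - h (s i)) * fdiff a (P t) (Suc i)))"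
    have "g t = ?G t" if "t \<in> {-1..1}" for t
    proof -
      have "(\<Sum>i<Suc M. h (s i) * fdiff (Suc a) (P t) i) =
         h (s M) * fdiff a (P t) (Suc M) - h (s 0) * fdiff a (P t) 0 - (\<Sum>i<M. (h (s (Suc i)) - h (s i)) * fdiff a (P t) (Suc i))"
        unfolding fdiff_Suc by (rule summation_by_parts)
      moreover have "fdiff a (P t) (Suc M) = 0" using that by (intro left sM) auto
      ultimately show ?thesis by (simp add: g_def)
    qed
    moreover have "spline_combination a (real a + 2) (K * (1 / e) ^ a) ?G"
    proof -
      have sb: "\<bar>s m\<bar> \<le> real a + 2" if "m \<le> M + a" for m
      proof -
        have "s m \<le> \<tau> + e * real M + e * real a"
          using that e by (simp add: s_def algebra_simps flip: of_nat_add distrib_left)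
        also have "\<dots> \<le> 1 + (real a + 1) * e" using M2 by (simp add: \<tau>_def algebra_simps)
        also have "\<dots> \<le> 1 + (real a + 1) * 1" using e by (intro add_left_mono mult_left_mono) auto
        finally have "s m \<le> real a + 2" by simp
        moreover have "- (real a + 2) \<le> s m"
        proof -
          have "(real a + 1) * e \<le> real a + 1" using e by (intro mult_left_le) auto
          moreover have "0 \<le> e * real m" using e by simp
          ultimately show ?thesis by (simp only: s_def \<tau>_def)
        qed
        ultimately show ?thesis by (simp add: abs_le_iff)
      qed
      have fc: "spline_combination a (real a + 2) (2 ^ a) (\<lambda>t. fdiff a (P t) i)" if "i \<le> M" for i
        unfolding P_def
        by (rule spline_combination_fdiff[where G = "\<lambda>m t. pos_power a (t - s m)"])
          (use that in \<open>auto intro!: spline_combination_single sb\<close>)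
      have "spline_combination a (real a + 2) (\<bar>c\<bar> * (\<bar>- h (s 0)\<bar> * 2 ^ a + (\<Sum>i<M. \<bar>h (s (Suc i)) - h (s i)\<bar> * 2 ^ a))) ?G"
        by (intro spline_combination_cmult spline_combination_diff spline_combination_sum fc) auto
      moreover have "\<bar>c\<bar> * (\<bar>- h (s 0)\<bar> * 2 ^ a + (\<Sum>i<M. \<bar>h (s (Suc i)) - h (s i)\<bar> * 2 ^ a)) \<le> K * (1 / e) ^ a"
      proof -
        \<comment> \<open>Each increment of \<open>h\<close> is at most \<open>e\<close>, and the
          grid has length e M of order 1: the sum carries no factor 1 / e.\<close>
        have "(\<Sum>i<M. \<bar>h (s (Suc i)) - h (s i)\<bar> * 2 ^ a) \<le> (\<Sum>i<M. e * 2 ^ a)"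
        proof (intro sum_mono mult_right_mono)
          fix i
          have "\<bar>h (s (Suc i)) - h (s i)\<bar> \<le> \<bar>s (Suc i) - s i\<bar>" by (rule lip)
          then show "\<bar>h (s (Suc i)) - h (s i)\<bar> \<le> e" using e by (simp add: s_def algebra_simps)
        qed simp
        also have "\<dots> = e * real M * 2 ^ a" by simp
        also have "\<dots> \<le> (real a + 4) * 2 ^ a"
        proof (rule mult_right_mono)
          have "(real a + 2) * e \<le> real a + 2" using e by (intro mult_left_le) auto
          then show "e * real M \<le> real a + 4" using M2 by linarith
        qed simp
        finally have 1: "(\<Sum>i<M. \<bar>h (s (Suc i)) - h (s i)\<bar> * 2 ^ a) \<le> (real a + 4) * 2 ^ a" .
        have "\<bar>- h (s 0)\<bar> * 2 ^ a \<le> 1 * 2 ^ a" using bd[of "s 0"] by (intro mult_right_mono) auto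
        with 1 have "\<bar>- h (s 0)\<bar> * 2 ^ a + (\<Sum>i<M. \<bar>h (s (Suc i)) - h (s i)\<bar> * 2 ^ a) \<le> (real a + 5) * 2 ^ a"
          unfolding distrib_right[of "real a" 5] distrib_right[of "real a" 4] by linarith
        also have "\<dots> \<le> (2 * real (a + 4)) * 2 ^ a" by (intro mult_right_mono) auto
        also have "\<dots> = 2 ^ Suc a * real (a + 4) ^ 1" by simp
        also have "\<dots> \<le> K" unfolding K_def by (intro mult_left_mono power_increasing) auto
        finally have 2: "\<bar>- h (s 0)\<bar> * 2 ^ a + (\<Sum>i<M. \<bar>h (s (Suc i)) - h (s i)\<bar> * 2 ^ a) \<le> K" .
        have "\<bar>c\<bar> \<le> (1 / e) ^ a" unfolding c_abs using e fact_ge_1[of a, where 'a = real]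
          by (simp add: divide_le_eq mult_le_cancel_left1)
        then have "\<bar>c\<bar> * (\<bar>- h (s 0)\<bar> * 2 ^ a + (\<Sum>i<M. \<bar>h (s (Suc i)) - h (s i)\<bar> * 2 ^ a)) \<le> (1 / e) ^ a * K"
          using 2 by (intro mult_mono) (auto intro!: add_nonneg_nonneg sum_nonneg simp: e less_imp_le)
        then show ?thesis by (simp add: mult.commute)
      qed
      ultimately show ?thesis unfolding spline_combination_def by (meson order_trans)
    qed
    ultimately show ?thesis by blast
  qed
  have err: "\<bar>g t - h t\<bar> \<le> K * e" if t: "t \<in> {-1..1}" for t
  proof -
    define D where "D i = fdiff (Suc a) (P t) i" for i
    have "(\<Sum>i<Suc M. D i) = fdiff a (P t) (Suc M) - fdiff a (P t) 0"
      unfolding D_def fdiff_Suc by (rule sum_lessThan_telescope)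
    also have "fdiff a (P t) (Suc M) = 0" using t by (intro left sM) auto
    also have "fdiff a (P t) 0 = (- e) ^ a * fact a"
      using poly[of 0 a t] t e by (simp add: s_def \<tau>_def algebra_simps)
    finally have sum0: "(\<Sum>i<Suc M. D i) = 0 - (- e) ^ a * fact a" .
    define X where "X = (-1 :: real) ^ a"
    define F where "F = e ^ a * fact a"
    have F: "F \<noteq> 0" using e by (simp add: F_def)
    have X: "X * X = 1" unfolding X_def by (simp flip: power_mult_distrib)
    have c': "c = - X / F" by (simp add: c_def X_def F_def)
    have "(- e) ^ a * fact a = X * F" unfolding X_def F_def power_minus[of e] by simp
    \<comment> \<open>The B-splines form a partition of unity at \<open>t\<close>, so the error is a
      weighted sum of the differences h (s i) - h t.\<close>
    then have sum1: "c * (\<Sum>i<Suc M. D i) = 1"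
      unfolding sum0 c' using X F by simp
    then have "h t = c * (\<Sum>i<Suc M. h t * D i)"
      by (simp add: sum_distrib_left[symmetric] mult.left_commute[of c "h t"])
    then have "g t - h t = c * (\<Sum>i<Suc M. (h (s i) - h t) * D i)"
      unfolding g_def D_def by (simp add: left_diff_distrib sum_subtractf right_diff_distrib)
    then have le: "\<bar>g t - h t\<bar> \<le> \<bar>c\<bar> * (\<Sum>i<Suc M. \<bar>(h (s i) - h t) * D i\<bar>)"
      unfolding \<open>g t - h t = _\<close> abs_mult[of c] by (intro mult_left_mono sum_abs) simp
    \<comment> \<open>The left end of the knot interval that contains \<open>t\<close>; at most the
      a + 1 B-splines with i from k - a to k are nonzero there.\<close>
    define k where "k = nat \<lfloor>(t - \<tau>) / e\<rfloor>"
    have zero: "D i = 0" if "i \<notin> {k - a..k}" for i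
    proof -
      have "0 \<le> (real a + 1) * e" using e by simp
      then have "0 \<le> t - \<tau>" using t by (simp only: \<tau>_def atLeastAtMost_iff) linarith
      then have nn: "0 \<le> (t - \<tau>) / e" using e by simp
      then have k1: "real k \<le> (t - \<tau>) / e" "(t - \<tau>) / e < real k + 1" unfolding k_def by linarith+
      then have k2: "\<tau> + e * real k \<le> t" "t < \<tau> + e * (real k + 1)" using e by (simp_all add: field_simps)
      show ?thesis
      proof (cases "i < k - a")
        case True
        then have "Suc a + i \<le> k" by simp
        then have "s (i + Suc a) \<le> s k" by (intro s_mono) simp
        also have "s k \<le> t" using k2 by (simp add: s_def)
        finally show ?thesis unfolding D_def using poly[of i "Suc a" t] by simp
      next
        case False
        then have "s (Suc k) \<le> s i" using that by (intro s_mono) auto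
        then have "t \<le> s i" using k2 by (simp add: s_def add.commute)
        then show ?thesis unfolding D_def by (rule left)
      qed
    qed
    have bnd: "\<bar>(h (s i) - h t) * D i\<bar> \<le> (real (a + 1) * e) * (2 ^ Suc a * (real (a + 1) * e) ^ a)" for i
    proof (cases "s i < t \<and> t < s (i + Suc a)")
      case True
      then have d: "\<bar>s i - t\<bar> \<le> real (a + 1) * e" by (simp add: s_def algebra_simps)
      have "\<bar>D i\<bar> \<le> 2 ^ Suc a * (real (a + 1) * e) ^ a"
        unfolding D_def
      proof (rule abs_fdiff_le)
        fix j
        show "\<bar>P t (i + j)\<bar> \<le> (real (a + 1) * e) ^ a"
        proof (cases "t \<le> s (i + j)")
          case True
          then show ?thesis using e by (simp add: P_def pn)
        next
          case False
          have "t - s (i + j) \<le> real (a + 1) * e" using d s_mono[of i "i + j"] by simp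
          then show ?thesis using False by (simp add: P_def pp power_mono)
        qed
      qed
      moreover have "\<bar>h (s i) - h t\<bar> \<le> real (a + 1) * e" using lip[of "s i" t] d by linarith
      ultimately show ?thesis unfolding abs_mult by (intro mult_mono) auto
    next
      case False
      then have "D i = 0" unfolding D_def using left[of t i "Suc a"] poly[of i "Suc a" t] by auto
      then show ?thesis using e by simp
    qed
    have "(\<Sum>i<Suc M. \<bar>(h (s i) - h t) * D i\<bar>) \<le> (\<Sum>i\<in>{k - a..k}. \<bar>(h (s i) - h t) * D i\<bar>)"
    proof -
      have "(\<Sum>i<Suc M. \<bar>(h (s i) - h t) * D i\<bar>) = (\<Sum>i\<in>{..<Suc M} \<inter> {k - a..k}. \<bar>(h (s i) - h t) * D i\<bar>)"
        by (rule sum.mono_neutral_right) (auto simp: zero)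
      also have "\<dots> \<le> (\<Sum>i\<in>{k - a..k}. \<bar>(h (s i) - h t) * D i\<bar>)" by (rule sum_mono2) auto
      finally show ?thesis .
    qed
    also have "\<dots> \<le> real (card {k - a..k}) * ((real (a + 1) * e) * (2 ^ Suc a * (real (a + 1) * e) ^ a))"
      by (rule sum_bounded_above) (rule bnd)
    also have "\<dots> \<le> real (a + 1) * ((real (a + 1) * e) * (2 ^ Suc a * (real (a + 1) * e) ^ a))"
      using e by (intro mult_right_mono) auto
    also have "\<dots> = 2 ^ Suc a * real (a + 1) ^ (a + 2) * e * e ^ a"
      by (simp add: power_mult_distrib power_add power2_eq_square mult_ac)
    finally have S: "(\<Sum>i<Suc M. \<bar>(h (s i) - h t) * D i\<bar>) \<le> 2 ^ Suc a * real (a + 1) ^ (a + 2) * e * e ^ a" .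
    have "\<bar>g t - h t\<bar> \<le> \<bar>c\<bar> * (2 ^ Suc a * real (a + 1) ^ (a + 2) * e * e ^ a)"
      using le mult_left_mono[OF S, of "\<bar>c\<bar>"] by linarith
    also have "\<dots> = 2 ^ Suc a * real (a + 1) ^ (a + 2) * e * ((1 / e) ^ a * e ^ a) / fact a"
      unfolding c_abs by simp
    also have "(1 / e) ^ a * e ^ a = 1" using e by (simp flip: power_mult_distrib)
    also have "2 ^ Suc a * real (a + 1) ^ (a + 2) * e * 1 / fact a \<le> 2 ^ Suc a * real (a + 1) ^ (a + 2) * e / 1"
      using e fact_ge_1[of a, where 'a = real] by (simp only: mult_1_right, intro divide_left_mono) auto
    also have "\<dots> \<le> K * e" unfolding K_def using e by (simp, intro mult_mono power_mono) auto
    finally show ?thesis .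
  qed
  from cost obtain G where "spline_combination a (real a + 2) (K * (1 / e) ^ a) G" "\<forall>t\<in>{-1..1}. g t = G t" by blast
  then show ?thesis using err by (intro exI[of _ G]) auto
qed

section \<open>Signed measures\<close>

lemma signed_measure_uminus: "signed_measure M \<nu> \<Longrightarrow> signed_measure M (\<lambda>A. - \<nu> A)"
  by (auto simp: signed_measure_def intro: sums_minus)

lemma signed_measure_Un:
  assumes "signed_measure M \<nu>" "A \<in> sets M" "B \<in> sets M" "A \<inter> B = {}"
  shows "\<nu> (A \<union> B) = \<nu> A + \<nu> B"
proof -
  have "range (binaryset A B) \<subseteq> sets M" using assms by (auto simp: range_binaryset_eq)
  moreover have "disjoint_family (binaryset A B)"
    using assms(4) by (auto simp: disjoint_family_on_def binaryset_def)
  ultimately have "(\<lambda>i. \<nu> (binaryset A B i)) sums \<nu> (\<Union>i. binaryset A B i)"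
    using assms(1) by (simp add: signed_measure_def)
  moreover have "(\<lambda>i. \<nu> (binaryset A B i)) sums (\<nu> A + \<nu> B)"
    using assms(1) by (intro binaryset_sums) (simp add: signed_measure_def)
  ultimately show ?thesis unfolding UN_binaryset_eq by (rule sums_unique2)
qed

lemma signed_measure_Diff:
  assumes "signed_measure M \<nu>" "A \<in> sets M" "B \<in> sets M" "B \<subseteq> A"
  shows "\<nu> (A - B) = \<nu> A - \<nu> B"
proof -
  have "\<nu> ((A - B) \<union> B) = \<nu> (A - B) + \<nu> B"
    using assms by (intro signed_measure_Un[OF assms(1)]) auto
  moreover have "(A - B) \<union> B = A" using assms(4) by auto
  ultimately show ?thesis by simp
qed

lemma total_variation_ge:
  assumes \<nu>: "signed_measure M \<nu>" and A: "A \<in> sets M"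
  shows "ennreal (\<bar>\<nu> A\<bar> + \<bar>\<nu> (space M - A)\<bar>) \<le> total_variation M \<nu>"
proof -
  \<comment> \<open>\<open>partition_on\<close> admits no empty block, and one of the two may be
    empty.\<close>
  let ?P = "{A, space M - A} - {{}}"
  have 0: "\<nu> {} = 0" using \<nu> by (simp add: signed_measure_def)
  have sub: "A \<subseteq> space M" using A by (rule sets.sets_into_space)
  have part: "partition_on (space M) ?P"
    using sub by (auto simp: partition_on_def disjoint_def)
  have "(\<Sum>B\<in>?P. ennreal \<bar>\<nu> B\<bar>) = (\<Sum>B\<in>{A, space M - A}. ennreal \<bar>\<nu> B\<bar>)"
    using 0 by (intro sum.mono_neutral_left) auto
  also have "\<dots> = ennreal (\<bar>\<nu> A\<bar> + \<bar>\<nu> (space M - A)\<bar>)"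
  \<comment> \<open>Equality forces both sets to be empty; the sum over the pair then has a single
    term.\<close>
  proof (cases "A = space M - A")
    case True
    then have "A = {}" by blast
    then show ?thesis using True 0 by simp
  qed (simp add: ennreal_plus)
  finally have "ennreal (\<bar>\<nu> A\<bar> + \<bar>\<nu> (space M - A)\<bar>) = (\<Sum>B\<in>?P. ennreal \<bar>\<nu> B\<bar>)" ..
  also have "\<dots> \<le> total_variation M \<nu>"
    unfolding total_variation_def using A part by (intro SUP_upper) auto
  finally show ?thesis .
qed

section \<open>The positive part as a measure and the Jordan decomposition\<close>

lemma ennreal_add_le: "ennreal (a + b) \<le> ennreal a + ennreal b"
proof -
  have "ennreal (a + b) \<le> ennreal (max 0 a + max 0 b)" by (intro ennreal_leI) auto
  also have "\<dots> = ennreal (max 0 a) + ennreal (max 0 b)" by (intro ennreal_plus) auto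
  also have "\<dots> = ennreal a + ennreal b" by (simp add: max_def ennreal_neg)
  finally show ?thesis .
qed

lemma ennreal_sum_le: "ennreal (\<Sum>i\<in>I. f i) \<le> (\<Sum>i\<in>I. ennreal (f i))"
proof (induction I rule: infinite_finite_induct)
  case (insert x F)
  have "ennreal (f x + (\<Sum>i\<in>F. f i)) \<le> ennreal (f x) + ennreal (\<Sum>i\<in>F. f i)" by (rule ennreal_add_le)
  also have "\<dots> \<le> ennreal (f x) + (\<Sum>i\<in>F. ennreal (f i))" using insert.IH by (rule add_left_mono)
  finally show ?case using insert.hyps by simp
qed auto

text \<open>The set function inside \<open>positive_part\<close>. It yields the values of that
  measure only once countable additivity is known, so it is studied by itself first.\<close>

definition upper_variation :: "'a measure \<Rightarrow> ('a set \<Rightarrow> real) \<Rightarrow> 'a set \<Rightarrow> ennreal" where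
  "upper_variation M \<nu> A = (SUP B \<in> {B \<in> sets M. B \<subseteq> A}. ennreal (\<nu> B))"

lemma upper_variation_mono: "A \<subseteq> B \<Longrightarrow> upper_variation M \<nu> A \<le> upper_variation M \<nu> B"
  unfolding upper_variation_def by (intro SUP_subset_mono) auto

lemma upper_variation_upper: "B \<in> sets M \<Longrightarrow> B \<subseteq> A \<Longrightarrow> ennreal (\<nu> B) \<le> upper_variation M \<nu> A"
  unfolding upper_variation_def by (intro SUP_upper) auto

lemma upper_variation_superadditive:
  assumes \<nu>: "signed_measure M \<nu>" and AB: "A \<inter> B = {}"
  shows "upper_variation M \<nu> A + upper_variation M \<nu> B \<le> upper_variation M \<nu> (A \<union> B)"
proof -
  let ?U = "upper_variation M \<nu>"
  have 0: "\<nu> {} = 0" using \<nu> by (simp add: signed_measure_def)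
  have key: "ennreal (\<nu> S) + ennreal (\<nu> T) \<le> ?U (A \<union> B)"
    if S: "S \<in> sets M" "S \<subseteq> A" and T: "T \<in> sets M" "T \<subseteq> B" for S T
  proof -
    \<comment> \<open>A set of negative value counts 0 in \<open>ennreal\<close>; replacing it by
      the empty set makes the real values agree with their truncations.\<close>
    define S' where "S' = (if \<nu> S \<ge> 0 then S else {})"
    define T' where "T' = (if \<nu> T \<ge> 0 then T else {})"
    have S': "S' \<in> sets M" "S' \<subseteq> A" "0 \<le> \<nu> S'" "ennreal (\<nu> S) = ennreal (\<nu> S')"
      using S 0 by (auto simp: S'_def ennreal_neg)
    have T': "T' \<in> sets M" "T' \<subseteq> B" "0 \<le> \<nu> T'" "ennreal (\<nu> T) = ennreal (\<nu> T')"
      using T 0 by (auto simp: T'_def ennreal_neg)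
    have "ennreal (\<nu> S) + ennreal (\<nu> T) = ennreal (\<nu> S' + \<nu> T')"
      unfolding S'(4) T'(4) using S'(3) T'(3) by (simp add: ennreal_plus)
    also have "\<nu> S' + \<nu> T' = \<nu> (S' \<union> T')"
      by (rule signed_measure_Un[OF \<nu> S'(1) T'(1), symmetric]) (use S'(2) T'(2) AB in blast)
    also have "ennreal \<dots> \<le> ?U (A \<union> B)"
      using S' T' by (intro upper_variation_upper) auto
    finally show ?thesis .
  qed
  have ne: "{S \<in> sets M. S \<subseteq> A} \<noteq> {}" "{S \<in> sets M. S \<subseteq> B} \<noteq> {}" for A B :: "'a set" by blast+
  have 1: "ennreal (\<nu> S) + ?U B \<le> ?U (A \<union> B)" if "S \<in> sets M" "S \<subseteq> A" for S
  proof -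
    have "ennreal (\<nu> S) + ?U B = (SUP T\<in>{T \<in> sets M. T \<subseteq> B}. ennreal (\<nu> T) + ennreal (\<nu> S))"
      unfolding upper_variation_def by (subst ennreal_SUP_add_left[OF ne(2)]) (rule add.commute)
    also have "\<dots> \<le> ?U (A \<union> B)"
      using key[OF that] by (intro SUP_least) (simp add: add.commute)
    finally show ?thesis .
  qed
  have "?U A + ?U B = (SUP S\<in>{S \<in> sets M. S \<subseteq> A}. ennreal (\<nu> S) + ?U B)"
    unfolding upper_variation_def[of M \<nu> A] by (subst ennreal_SUP_add_left[OF ne(1)]) (rule refl)
  also have "\<dots> \<le> ?U (A \<union> B)" using 1 by (intro SUP_least) simp
  finally show ?thesis .
qed

text \<open>Superadditivity on finite unions gives one inequality. For the other, a subset B of the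
  union is cut into the pieces B \<inter> A i, and its value is a limit of partial sums that the
  variations dominate.\<close>

lemma upper_variation_countably_additive:
  assumes \<nu>: "signed_measure M \<nu>"
  shows "countably_additive (sets M) (upper_variation M \<nu>)"
proof (rule countably_additiveI)
  let ?U = "upper_variation M \<nu>"
  fix A :: "nat \<Rightarrow> 'a set"
  assume A: "range A \<subseteq> sets M" "disjoint_family A" "(\<Union>i. A i) \<in> sets M"
  show "(\<Sum>i. ?U (A i)) = ?U (\<Union>i. A i)"
  proof (rule antisym)
    have fin: "(\<Sum>i<N. ?U (A i)) \<le> ?U (\<Union>i<N. A i)" for N
    proof (induction N)
      case (Suc N)
      have "A i \<inter> A N = {}" if "i < N" for i
        using disjoint_family_onD[OF A(2), of i N] that by simp
      then have disj: "(\<Union>i<N. A i) \<inter> A N = {}" by blast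
      have "(\<Sum>i<Suc N. ?U (A i)) \<le> ?U (\<Union>i<N. A i) + ?U (A N)"
        using Suc.IH by (simp add: add_right_mono)
      also have "\<dots> \<le> ?U ((\<Union>i<N. A i) \<union> A N)"
        by (rule upper_variation_superadditive[OF \<nu> disj])
      also have "(\<Union>i<N. A i) \<union> A N = (\<Union>i<Suc N. A i)" by (auto simp: less_Suc_eq)
      finally show ?case .
    qed simp
    show "(\<Sum>i. ?U (A i)) \<le> ?U (\<Union>i. A i)"
      by (rule suminf_le_const) (auto intro!: order_trans[OF fin] upper_variation_mono)
  next
    show "?U (\<Union>i. A i) \<le> (\<Sum>i. ?U (A i))"
      unfolding upper_variation_def[of M \<nu> "\<Union>i. A i"]
    proof (rule SUP_least)
      fix B assume "B \<in> {B \<in> sets M. B \<subseteq> (\<Union>i. A i)}"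
      then have B: "B \<in> sets M" "B = (\<Union>i. B \<inter> A i)" by auto
      have "range (\<lambda>i. B \<inter> A i) \<subseteq> sets M" using B(1) A(1) by auto
      moreover have "disjoint_family (\<lambda>i. B \<inter> A i)" using A(2) by (auto simp: disjoint_family_on_def)
      ultimately have "(\<lambda>i. \<nu> (B \<inter> A i)) sums \<nu> (\<Union>i. B \<inter> A i)" using \<nu> unfolding signed_measure_def by blast
      then have "(\<lambda>N. \<Sum>i<N. \<nu> (B \<inter> A i)) \<longlonglongrightarrow> \<nu> B" using B(2) by (simp add: sums_def)
      then have lim: "(\<lambda>N. ennreal (\<Sum>i<N. \<nu> (B \<inter> A i))) \<longlonglongrightarrow> ennreal (\<nu> B)" by (rule tendsto_ennrealI)
      have "ennreal (\<Sum>i<N. \<nu> (B \<inter> A i)) \<le> (\<Sum>i. ?U (A i))" for N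
      proof -
        have "ennreal (\<Sum>i<N. \<nu> (B \<inter> A i)) \<le> (\<Sum>i<N. ennreal (\<nu> (B \<inter> A i)))" by (rule ennreal_sum_le)
        also have "\<dots> \<le> (\<Sum>i<N. ?U (A i))"
          using B(1) A(1) by (intro sum_mono upper_variation_upper) auto
        also have "\<dots> \<le> (\<Sum>i. ?U (A i))" by (intro sum_le_suminf) auto
        finally show ?thesis .
      qed
      then show "ennreal (\<nu> B) \<le> (\<Sum>i. ?U (A i))" by (intro LIMSEQ_le_const2[OF lim]) auto
    qed
  qed
qed

lemma sets_positive_part [simp, measurable_cong]: "sets (positive_part M \<nu>) = sets M"
  by (simp add: positive_part_def sets.space_closed)

lemma space_positive_part [simp]: "space (positive_part M \<nu>) = space M"
  by (simp add: positive_part_def sets.space_closed)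

lemma emeasure_positive_part:
  assumes \<nu>: "signed_measure M \<nu>" and A: "A \<in> sets M"
  shows "emeasure (positive_part M \<nu>) A = upper_variation M \<nu> A"
proof (rule emeasure_measure_of[where \<Omega> = "space M" and A = "sets M"])
  show "positive_part M \<nu> = measure_of (space M) (sets M) (upper_variation M \<nu>)"
    by (simp add: positive_part_def upper_variation_def[abs_def])
  have "\<nu> {} = 0" using \<nu> by (simp add: signed_measure_def)
  then have "upper_variation M \<nu> {} = 0"
    by (intro antisym) (auto simp: upper_variation_def intro!: SUP_least)
  then show "positive (sets (positive_part M \<nu>)) (upper_variation M \<nu>)" by (simp add: positive_def)
  show "countably_additive (sets (positive_part M \<nu>)) (upper_variation M \<nu>)"
    using upper_variation_countably_additive[OF \<nu>] by simp
qed (use A in \<open>auto simp: sets.space_closed\<close>)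

text \<open>No Hahn decomposition is used: for B \<subseteq> A the identity \<nu> B = \<nu> A -
  \<nu> (A - B) turns suprema of \<nu> over subsets into suprema of -\<nu>, which gives both
  inequalities for the difference. A real bound \<open>T\<close> replaces the total variation, since
  representations only approach \<open>gamma1\<close>.\<close>

lemma jordan_decomposition:
  assumes \<nu>: "signed_measure M \<nu>" and T: "total_variation M \<nu> \<le> ennreal T" "0 \<le> T"
  shows "finite_measure (positive_part M \<nu>)" "finite_measure (positive_part M (\<lambda>A. - \<nu> A))"
    and "\<And>A. A \<in> sets M \<Longrightarrow> \<nu> A = measure (positive_part M \<nu>) A - measure (positive_part M (\<lambda>A. - \<nu> A)) A"
    and "measure (positive_part M \<nu>) (space M) + measure (positive_part M (\<lambda>A. - \<nu> A)) (space M) \<le> T"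
proof -
  let ?p = "positive_part M \<nu>" and ?q = "positive_part M (\<lambda>A. - \<nu> A)"
  note \<nu>' = signed_measure_uminus[OF \<nu>]
  have bd: "\<bar>\<nu> A\<bar> + \<bar>\<nu> (space M - A)\<bar> \<le> T" if "A \<in> sets M" for A
    using order_trans[OF total_variation_ge[OF \<nu> that] T(1)] T(2) by (simp only: ennreal_le_iff)
  have up: "upper_variation M \<nu> A \<le> ennreal T" "upper_variation M (\<lambda>A. - \<nu> A) A \<le> ennreal T" for A
  proof -
    have "\<nu> B \<le> T" "- \<nu> B \<le> T" if "B \<in> sets M" for B using bd[OF that] by linarith+
    then show "upper_variation M \<nu> A \<le> ennreal T" "upper_variation M (\<lambda>A. - \<nu> A) A \<le> ennreal T"
      unfolding upper_variation_def by (auto intro!: SUP_least ennreal_leI)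
  qed
  show fp: "finite_measure ?p"
    using up(1)[of "space M"] by (intro finite_measureI) (auto simp: emeasure_positive_part[OF \<nu>] top_unique)
  show fq: "finite_measure ?q"
    using up(2)[of "space M"] by (intro finite_measureI) (auto simp: emeasure_positive_part[OF \<nu>'] top_unique)
  interpret p: finite_measure ?p by (rule fp)
  interpret q: finite_measure ?q by (rule fq)
  have ge: "\<nu> B \<le> measure ?p A" if "A \<in> sets M" "B \<in> sets M" "B \<subseteq> A" for A B
  proof -
    have "ennreal (\<nu> B) \<le> ennreal (measure ?p A)"
      using upper_variation_upper[OF that(2,3), of \<nu>] that(1)
      by (simp add: emeasure_positive_part[OF \<nu>, symmetric] p.emeasure_eq_measure)
    then show ?thesis by (simp add: ennreal_le_iff)
  qed
  have ge': "- \<nu> B \<le> measure ?q A" if "A \<in> sets M" "B \<in> sets M" "B \<subseteq> A" for A B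
  proof -
    have "ennreal (- \<nu> B) \<le> ennreal (measure ?q A)"
      using upper_variation_upper[OF that(2,3), of "\<lambda>A. - \<nu> A"] that(1)
      by (simp add: emeasure_positive_part[OF \<nu>', symmetric] q.emeasure_eq_measure)
    then show ?thesis by (simp add: ennreal_le_iff)
  qed
  have le: "measure ?p A \<le> c" if "A \<in> sets M" "0 \<le> c" "\<And>B. B \<in> sets M \<Longrightarrow> B \<subseteq> A \<Longrightarrow> \<nu> B \<le> c" for A c
  proof -
    have "ennreal (measure ?p A) \<le> ennreal c"
      unfolding p.emeasure_eq_measure[symmetric] emeasure_positive_part[OF \<nu> that(1)] upper_variation_def
      using that(3) by (auto intro!: SUP_least ennreal_leI)
    then show ?thesis using that(2) by (simp add: ennreal_le_iff)
  qed
  have le': "measure ?q A \<le> c" if "A \<in> sets M" "0 \<le> c" "\<And>B. B \<in> sets M \<Longrightarrow> B \<subseteq> A \<Longrightarrow> - \<nu> B \<le> c" for A c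
  proof -
    have "ennreal (measure ?q A) \<le> ennreal c"
      unfolding q.emeasure_eq_measure[symmetric] emeasure_positive_part[OF \<nu>' that(1)] upper_variation_def
      using that(3) by (auto intro!: SUP_least ennreal_leI)
    then show ?thesis using that(2) by (simp add: ennreal_le_iff)
  qed
  have dec: "\<nu> A = measure ?p A - measure ?q A" if A: "A \<in> sets M" for A
  proof -
    have "measure ?q A \<le> measure ?p A - \<nu> A"
    proof (rule le'[OF A])
      show "0 \<le> measure ?p A - \<nu> A" using ge[OF A A] by simp
      fix B assume B: "B \<in> sets M" "B \<subseteq> A"
      have "\<nu> (A - B) \<le> measure ?p A" using A B by (intro ge) auto
      then show "- \<nu> B \<le> measure ?p A - \<nu> A" using signed_measure_Diff[OF \<nu> A B] by simp
    qed
    moreover have "measure ?p A \<le> measure ?q A + \<nu> A"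
    proof (rule le[OF A])
      show "0 \<le> measure ?q A + \<nu> A" using ge'[OF A A] by simp
      fix B assume B: "B \<in> sets M" "B \<subseteq> A"
      have "- \<nu> (A - B) \<le> measure ?q A" using A B by (intro ge') auto
      then show "\<nu> B \<le> measure ?q A + \<nu> A" using signed_measure_Diff[OF \<nu> A B] by simp
    qed
    ultimately show ?thesis by simp
  qed
  then show "\<And>A. A \<in> sets M \<Longrightarrow> \<nu> A = measure ?p A - measure ?q A" .
  \<comment> \<open>Because 2 \<nu> B = \<nu> (space M) + (\<nu> B - \<nu> (space M - B)), and the
    bracket is at most \<open>T\<close>.\<close>
  have "measure ?p (space M) \<le> (T + \<nu> (space M)) / 2"
  proof (rule le)
    show "0 \<le> (T + \<nu> (space M)) / 2" using bd[of "space M"] by simp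
    fix B assume B: "B \<in> sets M" "B \<subseteq> space M"
    show "\<nu> B \<le> (T + \<nu> (space M)) / 2"
      using bd[OF B(1)] signed_measure_Diff[OF \<nu> sets.top B] by simp
  qed simp
  then show "measure ?p (space M) + measure ?q (space M) \<le> T" using dec[of "space M"] by simp
qed

text \<open>Induction from indicators to bounded measurable functions. It makes integrals against a
  combination of measures available without computing its Jordan parts.\<close>

lemma signed_combination_integral:
  fixes c :: "'i \<Rightarrow> real"
  assumes pq: "finite_measure p" "finite_measure q" "sets p = sets M" "sets q = sets M"
    and \<mu>: "\<And>i. i \<in> I \<Longrightarrow> finite_measure (\<mu> i)" "\<And>i. i \<in> I \<Longrightarrow> sets (\<mu> i) = sets M"
    and eq: "\<And>A. A \<in> sets M \<Longrightarrow> measure p A - measure q A = (\<Sum>i\<in>I. c i * measure (\<mu> i) A)"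
    and f: "f \<in> borel_measurable M" "\<And>x. \<bar>f x\<bar> \<le> B"
  shows "(\<integral>x. f x \<partial>p) - (\<integral>x. f x \<partial>q) = (\<Sum>i\<in>I. c i * (\<integral>x. f x \<partial>\<mu> i))"
proof -
  have int: "integrable \<kappa> u" if "finite_measure \<kappa>" "sets \<kappa> = sets M" "u \<in> borel_measurable M"
    "\<And>x. x \<in> space M \<Longrightarrow> \<bar>u x\<bar> \<le> C" for \<kappa> C and u :: "_ \<Rightarrow> real"
  proof -
    have "u \<in> borel_measurable \<kappa>" using that(2,3) measurable_cong_sets by blast
    moreover have "space \<kappa> = space M" using that(2) by (rule sets_eq_imp_space_eq)
    ultimately show ?thesis using that(1,4) by (intro finite_measure.integrable_const_bound[of _ _ C]) auto
  qed
  let ?E = "\<lambda>u. (\<integral>x. u x \<partial>p) - (\<integral>x. u x \<partial>q) = (\<Sum>i\<in>I. c i * (\<integral>x. u x \<partial>\<mu> i))"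
  \<comment> \<open>The bound is a premise inside the induction claim, because sums and limits of
    integrals need every function involved to be integrable; summands and approximants inherit the
    bound.\<close>
  have nonneg: "(\<exists>C. \<forall>x\<in>space M. u x \<le> C) \<longrightarrow> ?E u"
    if u: "u \<in> borel_measurable M" "\<And>x. 0 \<le> u x" for u
    using u
  proof (induction rule: borel_measurable_induct_real)
    case (set A)
    have sp: "space \<kappa> = space M" if "sets \<kappa> = sets M" for \<kappa> :: "'a measure"
      using that by (rule sets_eq_imp_space_eq)
    have ind: "(\<integral>x. indicator A x \<partial>\<kappa>) = measure \<kappa> A" if "finite_measure \<kappa>" "sets \<kappa> = sets M" for \<kappa>
      using set sets.sets_into_space[OF set] sp[OF that(2)] by (simp add: Int_absorb2)
    have "(\<Sum>i\<in>I. c i * (\<integral>x. indicator A x \<partial>\<mu> i)) = (\<Sum>i\<in>I. c i * measure (\<mu> i) A)"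
      by (intro sum.cong refl) (simp only: ind \<mu>)
    then show ?case using eq[OF set] by (simp only: ind pq simp_thms)
  next
    case (mult u a)
    show ?case
    proof
      assume "\<exists>C. \<forall>x\<in>space M. a * u x \<le> C"
      then obtain C where C: "\<And>x. x \<in> space M \<Longrightarrow> a * u x \<le> C" by blast
      show "?E (\<lambda>x. a * u x)"
      proof (cases "a = 0")
        case False
        then have "u x \<le> C / a" if "x \<in> space M" for x using C[OF that] mult(1) by (simp add: field_simps)
        then have "?E u" using mult by blast
        then have "a * ((\<integral>x. u x \<partial>p) - (\<integral>x. u x \<partial>q)) = (\<Sum>i\<in>I. c i * (a * (\<integral>x. u x \<partial>\<mu> i)))"
          by (simp add: sum_distrib_left mult_ac)
        then show ?thesis by (simp add: right_diff_distrib)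
      qed simp
    qed
  next
    case (add u v)
    show ?case
    proof
      assume "\<exists>C. \<forall>x\<in>space M. v x + u x \<le> C"
      then obtain C where C: "\<And>x. x \<in> space M \<Longrightarrow> v x + u x \<le> C" by blast
      have uC: "\<bar>u x\<bar> \<le> C" if "x \<in> space M" for x using C[OF that] add.hyps(2)[of x] add.hyps(4)[of x] by linarith
      have vC: "\<bar>v x\<bar> \<le> C" if "x \<in> space M" for x using C[OF that] add.hyps(2)[of x] add.hyps(4)[of x] by linarith
      have "\<exists>C. \<forall>x\<in>space M. u x \<le> C" "\<exists>C. \<forall>x\<in>space M. v x \<le> C"
        using uC vC by (auto simp: abs_le_iff)
      then have E: "?E u" "?E v" using add by blast+
      have split: "(\<integral>x. v x + u x \<partial>\<kappa>) = (\<integral>x. v x \<partial>\<kappa>) + (\<integral>x. u x \<partial>\<kappa>)"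
        if "finite_measure \<kappa>" "sets \<kappa> = sets M" for \<kappa>
        using int[OF that add.hyps(1) uC] int[OF that add.hyps(3) vC] by (intro Bochner_Integration.integral_add)
      have "(\<Sum>i\<in>I. c i * (\<integral>x. v x + u x \<partial>\<mu> i)) = (\<Sum>i\<in>I. c i * (\<integral>x. v x \<partial>\<mu> i)) + (\<Sum>i\<in>I. c i * (\<integral>x. u x \<partial>\<mu> i))"
        unfolding sum.distrib[symmetric] by (intro sum.cong refl) (simp add: split \<mu> distrib_left)
      then show "?E (\<lambda>x. v x + u x)" using E split pq by simp
    qed
  next
    case (seq U)
    show ?case
    proof
      assume "\<exists>C. \<forall>x\<in>space M. u x \<le> C"
      then obtain C where C: "\<And>x. x \<in> space M \<Longrightarrow> u x \<le> C" by blast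
      have UC: "\<bar>U i x\<bar> \<le> C" if x: "x \<in> space M" for i x
      proof -
        have "incseq (\<lambda>i. U i x)" using seq.hyps(3) by (auto simp: incseq_def le_fun_def)
        then have "U i x \<le> u x" using seq.hyps(4)[OF x] by (rule incseq_le)
        then show ?thesis using C[OF x] seq.hyps(2)[of i x] by simp
      qed
      have E: "?E (U i)" for i
      proof -
        have "\<forall>x\<in>space M. U i x \<le> C" using UC[of _ i] by (auto simp: abs_le_iff)
        then show ?thesis using seq.IH[of i] by blast
      qed
      have lim: "(\<lambda>i. \<integral>x. U i x \<partial>\<kappa>) \<longlonglongrightarrow> (\<integral>x. u x \<partial>\<kappa>)"
        if \<kappa>: "finite_measure \<kappa>" "sets \<kappa> = sets M" for \<kappa>
      proof (rule integral_dominated_convergence[where w = "\<lambda>_. C"])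
        interpret \<kappa>: finite_measure \<kappa> by fact
        have sp: "space \<kappa> = space M" using \<kappa>(2) by (rule sets_eq_imp_space_eq)
        show "u \<in> borel_measurable \<kappa>" using u(1) \<kappa>(2) measurable_cong_sets by blast
        show "U i \<in> borel_measurable \<kappa>" for i using seq.hyps(1)[of i] \<kappa>(2) measurable_cong_sets by blast
        show "integrable \<kappa> (\<lambda>_. C)" by simp
        show "AE x in \<kappa>. (\<lambda>i. U i x) \<longlonglongrightarrow> u x" using seq.hyps(4) by (auto simp: sp)
        show "AE x in \<kappa>. norm (U i x) \<le> C" for i using UC by (auto simp: sp)
      qed
      have "(\<lambda>i. (\<integral>x. U i x \<partial>p) - (\<integral>x. U i x \<partial>q)) \<longlonglongrightarrow> (\<integral>x. u x \<partial>p) - (\<integral>x. u x \<partial>q)"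
        by (intro tendsto_diff lim pq)
      moreover have "(\<lambda>i. (\<Sum>j\<in>I. c j * (\<integral>x. U i x \<partial>\<mu> j))) \<longlonglongrightarrow> (\<Sum>j\<in>I. c j * (\<integral>x. u x \<partial>\<mu> j))"
        by (intro tendsto_sum tendsto_mult_left lim \<mu>)
      ultimately show "?E u" unfolding E by (rule LIMSEQ_unique)
    qed
  qed
  have B0: "0 \<le> B" using f(2)[of undefined] by linarith
  have fB: "0 \<le> f x + B" "f x + B \<le> 2 * B" for x using f(2)[of x] by linarith+
  have "(\<lambda>x. f x + B) \<in> borel_measurable M" using f(1) by measurable
  then have "?E (\<lambda>x. f x + B)" using nonneg fB by blast
  moreover have "?E (\<lambda>_. B)" using nonneg[of "\<lambda>_. B"] B0 by auto
  moreover have split: "(\<integral>x. f x + B \<partial>\<kappa>) = (\<integral>x. f x \<partial>\<kappa>) + (\<integral>x. B \<partial>\<kappa>)"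
    if "finite_measure \<kappa>" "sets \<kappa> = sets M" for \<kappa>
    using int[OF that f] int[OF that, of "\<lambda>_. B" B] B0 by (intro Bochner_Integration.integral_add) auto
  have "(\<Sum>i\<in>I. c i * (\<integral>x. f x + B \<partial>\<mu> i)) = (\<Sum>i\<in>I. c i * (\<integral>x. f x \<partial>\<mu> i)) + (\<Sum>i\<in>I. c i * (\<integral>x. B \<partial>\<mu> i))"
    unfolding sum.distrib[symmetric] by (intro sum.cong refl) (simp only: split \<mu> distrib_left)
  ultimately show ?thesis using split[OF pq(1,3)] split[OF pq(2,4)] by linarith
qed

text \<open>The bound on the variation is the triangle inequality, as the \<mu> i may overlap. The
  Jordan parts stay implicit, and the integral formula follows from the agreement on sets.\<close>

lemma signed_measure_combination:
  fixes c :: "'i \<Rightarrow> real"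
  assumes I: "finite I"
    and \<mu>: "\<And>i. i \<in> I \<Longrightarrow> finite_measure (\<mu> i)" "\<And>i. i \<in> I \<Longrightarrow> sets (\<mu> i) = sets M"
  defines "\<nu> \<equiv> \<lambda>A. \<Sum>i\<in>I. c i * measure (\<mu> i) A"
  shows "signed_measure M \<nu>"
    and "total_variation M \<nu> \<le> ennreal (\<Sum>i\<in>I. \<bar>c i\<bar> * measure (\<mu> i) (space M))"
    and "\<And>f B. f \<in> borel_measurable M \<Longrightarrow> (\<And>x. \<bar>f x\<bar> \<le> B) \<Longrightarrow>
      signed_integral M \<nu> f = (\<Sum>i\<in>I. c i * (\<integral>x. f x \<partial>\<mu> i))"
proof -
  show sm: "signed_measure M \<nu>"
    unfolding signed_measure_def
  proof (intro conjI allI impI)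
    show "\<nu> {} = 0" by (simp add: \<nu>_def)
    fix A :: "nat \<Rightarrow> _" assume A: "range A \<subseteq> sets M" "disjoint_family A"
    show "(\<lambda>i. \<nu> (A i)) sums \<nu> (\<Union>i. A i)"
      unfolding \<nu>_def
      by (intro sums_sum sums_mult finite_measure.finite_measure_UNION \<mu>) (use A \<mu> in auto)
  qed
  show tv: "total_variation M \<nu> \<le> ennreal (\<Sum>i\<in>I. \<bar>c i\<bar> * measure (\<mu> i) (space M))"
    unfolding total_variation_def
  proof (rule SUP_least)
    fix P assume "P \<in> {P. finite P \<and> P \<subseteq> sets M \<and> partition_on (space M) P}"
    then have P: "finite P" "P \<subseteq> sets M" "partition_on (space M) P" by auto
    have "(\<Sum>A\<in>P. ennreal \<bar>\<nu> A\<bar>) = ennreal (\<Sum>A\<in>P. \<bar>\<nu> A\<bar>)" by (rule sum_ennreal) simp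
    also have "\<dots> \<le> ennreal (\<Sum>i\<in>I. \<bar>c i\<bar> * measure (\<mu> i) (space M))"
    proof (rule ennreal_leI)
      have "(\<Sum>A\<in>P. \<bar>\<nu> A\<bar>) \<le> (\<Sum>A\<in>P. \<Sum>i\<in>I. \<bar>c i\<bar> * measure (\<mu> i) A)"
        unfolding \<nu>_def by (intro sum_mono order_trans[OF sum_abs]) (simp add: abs_mult)
      also have "\<dots> = (\<Sum>i\<in>I. \<bar>c i\<bar> * (\<Sum>A\<in>P. measure (\<mu> i) A))"
        unfolding sum_distrib_left by (rule sum.swap)
      also have "\<dots> = (\<Sum>i\<in>I. \<bar>c i\<bar> * measure (\<mu> i) (space M))"
      proof (intro sum.cong refl arg_cong2[where f = "(*)"])
        fix i assume i: "i \<in> I"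
        have "measure (\<mu> i) (\<Union>A\<in>P. A) = (\<Sum>A\<in>P. measure (\<mu> i) A)"
          using P \<mu>(2)[OF i]
          by (intro finite_measure.finite_measure_finite_Union \<mu>(1)[OF i])
             (auto simp: partition_on_def disjoint_def disjoint_family_on_def)
        then show "(\<Sum>A\<in>P. measure (\<mu> i) A) = measure (\<mu> i) (space M)"
          using P(3) by (simp add: partition_on_def)
      qed
      finally show "(\<Sum>A\<in>P. \<bar>\<nu> A\<bar>) \<le> (\<Sum>i\<in>I. \<bar>c i\<bar> * measure (\<mu> i) (space M))" .
    qed
    finally show "(\<Sum>A\<in>P. ennreal \<bar>\<nu> A\<bar>) \<le> ennreal (\<Sum>i\<in>I. \<bar>c i\<bar> * measure (\<mu> i) (space M))" .
  qed
  fix f :: "_ \<Rightarrow> real" and B assume f: "f \<in> borel_measurable M" "\<And>x. \<bar>f x\<bar> \<le> B"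
  have nn: "0 \<le> (\<Sum>i\<in>I. \<bar>c i\<bar> * measure (\<mu> i) (space M))" by (intro sum_nonneg) auto
  note j = jordan_decomposition[OF sm tv nn]
  show "signed_integral M \<nu> f = (\<Sum>i\<in>I. c i * (\<integral>x. f x \<partial>\<mu> i))"
    unfolding signed_integral_def
  proof (rule signed_combination_integral[OF j(1,2) _ _ \<mu>(1) \<mu>(2) _ f])
    fix A assume "A \<in> sets M"
    from j(3)[OF this]
    show "measure (positive_part M \<nu>) A - measure (positive_part M (\<lambda>A. - \<nu> A)) A = (\<Sum>i\<in>I. c i * measure (\<mu> i) A)"
      by (simp add: \<nu>_def)
  qed simp_all
qed

section \<open>Balls of the function space\<close>

text \<open>The weight is not confined to the sphere, because rounded and rescaled weights leave
  it.\<close>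

definition neuron :: "nat \<Rightarrow> real \<Rightarrow> nat \<Rightarrow> (nat \<Rightarrow> real) \<Rightarrow> (nat \<Rightarrow> real) \<Rightarrow> real" where
  "neuron d R \<alpha> v x = pos_power \<alpha> (dot (Suc d) v (lift_input d R x))"

lemma dot_lift_input: "dot (Suc d) v (lift_input d R x) = dot d v x + v d * R"
  by (simp add: dot_def lift_input_def)

lemma L2_set_lift_input:
  assumes "x \<in> input_ball d R" "0 < R"
  shows "L2_set (lift_input d R x) {..<Suc d} \<le> sqrt 2 * R"
proof -
  have "(L2_set x {..<d})\<^sup>2 \<le> R\<^sup>2"
    using assms by (intro power_mono) (auto simp: input_ball_def)
  then have "(\<Sum>i<d. (x i)\<^sup>2) \<le> R\<^sup>2" by (simp add: L2_set_def sum_nonneg)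
  then have "L2_set (lift_input d R x) {..<Suc d} \<le> sqrt (2 * R\<^sup>2)"
    unfolding L2_set_def by (intro real_sqrt_le_mono) (simp add: lift_input_def)
  then show ?thesis using assms(2) by (simp add: real_sqrt_mult)
qed

lemma abs_dot_le: "\<bar>dot d u v\<bar> \<le> L2_set u {..<d} * L2_set v {..<d}"
proof -
  have "\<bar>dot d u v\<bar> \<le> (\<Sum>i<d. \<bar>u i\<bar> * \<bar>v i\<bar>)"
    unfolding dot_def by (rule order_trans[OF sum_abs]) (simp add: abs_mult)
  then show ?thesis using L2_set_mult_ineq[of u v "{..<d}"] by linarith
qed

lemma abs_dot_lift_le:
  assumes "x \<in> input_ball d R" "0 < R"
  shows "\<bar>dot (Suc d) v (lift_input d R x)\<bar> \<le> L2_set v {..<Suc d} * (sqrt 2 * R)"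
  using abs_dot_le[of "Suc d" v "lift_input d R x"]
    mult_left_mono[OF L2_set_lift_input[OF assms], of "L2_set v {..<Suc d}"] by simp

lemma space_weight_space [simp]: "space (weight_space d R) = weight_sphere d R"
  by (auto simp: weight_space_def space_restrict_space weight_sphere_def)

lemma pos_power_nonneg [simp]: "0 \<le> pos_power \<alpha> u"
  by (simp add: pos_power_def)

lemma pos_power_le: "u \<le> B \<Longrightarrow> 0 \<le> B \<Longrightarrow> pos_power \<alpha> u \<le> B ^ \<alpha>"
  by (auto simp: pos_power_def intro: power_mono)

lemma pos_power_measurable [measurable]: "pos_power \<alpha> \<in> borel_measurable borel"
  unfolding pos_power_def[abs_def] by measurable

text \<open>At \<alpha> = 0 the function is the indicator of u > 0, which is continuous from the
  left only; hence the approximation from below.\<close>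

lemma pos_power_tendsto_below:
  assumes le: "\<And>n. u n \<le> l" and lim: "u \<longlonglongrightarrow> l"
  shows "(\<lambda>n. pos_power \<alpha> (u n)) \<longlonglongrightarrow> pos_power \<alpha> l"
proof (cases "0 < l")
  case True
  then have "eventually (\<lambda>n. 0 < u n) sequentially" using lim by (rule order_tendstoD(1)[rotated])
  then have "eventually (\<lambda>n. u n ^ \<alpha> = pos_power \<alpha> (u n)) sequentially"
    by eventually_elim (simp add: pos_power_def)
  moreover have "(\<lambda>n. u n ^ \<alpha>) \<longlonglongrightarrow> l ^ \<alpha>" by (intro tendsto_power lim)
  ultimately show ?thesis using True by (simp add: pos_power_def[of _ l] Lim_transform_eventually)
next
  case False
  then have "pos_power \<alpha> (u n) = 0" for n using le[of n] by (simp add: pos_power_def)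
  then show ?thesis using False by (simp add: pos_power_def)
qed

text \<open>The factor \<open>c\<close> is 1 on the sphere and 2 for rounded weights.\<close>

lemma neuron_le:
  assumes "x \<in> input_ball d R" "0 < R" "L2_set v {..<Suc d} \<le> c / R"
  shows "neuron d R \<alpha> v x \<le> (c * sqrt 2) ^ \<alpha>"
  unfolding neuron_def
proof (rule pos_power_le)
  have c0: "0 \<le> c / R" using assms(3) by (rule order_trans[rotated]) simp
  then show "0 \<le> c * sqrt 2" using assms(2) by (simp add: zero_le_divide_iff)
  have "L2_set v {..<Suc d} * (sqrt 2 * R) \<le> c / R * (sqrt 2 * R)"
    using assms by (intro mult_right_mono) auto
  also have "\<dots> = c * sqrt 2" using assms(2) by simp
  finally show "dot (Suc d) v (lift_input d R x) \<le> c * sqrt 2"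
    using abs_dot_lift_le[OF assms(1,2), of v] by linarith
qed

lemma dot_lift_measurable_pair:
  "(\<lambda>(x, v). dot (Suc d) v (lift_input d R x)) \<in> borel_measurable (borel_vec d \<Otimes>\<^sub>M weight_space d R)"
proof -
  have v: "(\<lambda>v. v i) \<in> borel_measurable (weight_space d R)" if "i < Suc d" for i
    unfolding weight_space_def using that
    by (intro measurable_restrict_space1 measurable_component_singleton) auto
  have x: "(\<lambda>x. x i) \<in> borel_measurable (borel_vec d)" if "i < d" for i
    using that by (intro measurable_component_singleton) auto
  have "(\<lambda>p. (\<Sum>i<d. snd p i * fst p i) + snd p d * R) \<in> borel_measurable (borel_vec d \<Otimes>\<^sub>M weight_space d R)"
    by (intro borel_measurable_add borel_measurable_sum borel_measurable_times borel_measurable_const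
        measurable_compose[OF measurable_snd v] measurable_compose[OF measurable_fst x]) auto
  then show ?thesis unfolding case_prod_beta' dot_lift_input unfolding dot_def .
qed

lemma neuron_measurable_pair:
  "(\<lambda>(x, v). neuron d R \<alpha> v x) \<in> borel_measurable (borel_vec d \<Otimes>\<^sub>M weight_space d R)"
  using measurable_compose[OF dot_lift_measurable_pair pos_power_measurable, of \<alpha> d R]
  by (simp add: case_prod_beta' neuron_def)

lemma neuron_measurable_input: "(\<lambda>x. neuron d R \<alpha> v x) \<in> borel_measurable (borel_vec d)"
proof -
  have "(\<lambda>x. x i) \<in> borel_measurable (borel_vec d)" if "i < d" for i
    using that by (intro measurable_component_singleton) auto
  then have "(\<lambda>x. (\<Sum>i<d. v i * x i) + v d * R) \<in> borel_measurable (borel_vec d)"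
    by (intro borel_measurable_add borel_measurable_sum borel_measurable_times borel_measurable_const) auto
  then show ?thesis
    unfolding neuron_def dot_lift_input unfolding dot_def by (rule measurable_compose) (rule pos_power_measurable)
qed

lemma neuron_measurable_weight: "(\<lambda>v. neuron d R \<alpha> v x) \<in> borel_measurable (weight_space d R)"
proof -
  have "(\<lambda>v. v i) \<in> borel_measurable (weight_space d R)" if "i < Suc d" for i
    unfolding weight_space_def using that
    by (intro measurable_restrict_space1 measurable_component_singleton) auto
  then have "(\<lambda>v. (\<Sum>i<d. v i * x i) + v d * R) \<in> borel_measurable (weight_space d R)"
    by (intro borel_measurable_add borel_measurable_sum borel_measurable_times borel_measurable_const) auto
  then show ?thesis
    unfolding neuron_def dot_lift_input unfolding dot_def by (rule measurable_compose) (rule pos_power_measurable)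
qed

text \<open>\<open>gamma1\<close> is an infimum, so a representing measure is obtained for each mass
  T > \<delta>, but not for \<delta> itself.\<close>

lemma F1_ball_jordan:
  assumes f: "f \<in> F1_ball d R \<alpha> \<delta>" and T: "0 \<le> \<delta>" "\<delta> < T"
  shows "\<exists>p q. finite_measure p \<and> finite_measure q \<and> sets p = sets (weight_space d R) \<and> sets q = sets (weight_space d R)
    \<and> measure p (weight_sphere d R) + measure q (weight_sphere d R) \<le> T
    \<and> (\<forall>x\<in>input_ball d R. f x = (\<integral>v. neuron d R \<alpha> v x \<partial>p) - (\<integral>v. neuron d R \<alpha> v x \<partial>q))"
proof -
  have "gamma1 d R \<alpha> f < ennreal T"
    using f T by (auto simp: F1_ball_def intro: le_less_trans ennreal_lessI)
  then obtain \<mu> where \<mu>: "represents d R \<alpha> \<mu> f" "total_variation (weight_space d R) \<mu> < ennreal T"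
    unfolding gamma1_def by (auto simp: INF_less_iff)
  have sm: "signed_measure (weight_space d R) \<mu>" using \<mu>(1) by (simp add: represents_def)
  note j = jordan_decomposition[OF sm less_imp_le[OF \<mu>(2)]]
  show ?thesis
    by (rule exI[of _ "positive_part (weight_space d R) \<mu>"], rule exI[of _ "positive_part (weight_space d R) (\<lambda>A. - \<mu> A)"])
       (use j T \<mu>(1) in \<open>simp add: represents_def signed_integral_def neuron_def\<close>)
qed

lemma integrable_neuron:
  assumes "finite_measure p" "sets p = sets (weight_space d R)" "x \<in> input_ball d R" "0 < R"
  shows "integrable p (\<lambda>v. neuron d R \<alpha> v x)"
proof (rule finite_measure.integrable_const_bound[OF assms(1), of _ "sqrt 2 ^ \<alpha>"])
  have sp: "space p = weight_sphere d R" using sets_eq_imp_space_eq[OF assms(2)] by simp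
  have "norm (neuron d R \<alpha> v x) \<le> sqrt 2 ^ \<alpha>" if "v \<in> weight_sphere d R" for v
    using that neuron_le[OF assms(3,4), of v 1 \<alpha>] by (simp add: weight_sphere_def neuron_def)
  then show "AE v in p. norm (neuron d R \<alpha> v x) \<le> sqrt 2 ^ \<alpha>" by (auto simp: sp)
  show "(\<lambda>v. neuron d R \<alpha> v x) \<in> borel_measurable p"
    using neuron_measurable_weight assms(2) measurable_cong_sets by blast
qed

lemma F1_ball_abs_le:
  assumes f: "f \<in> F1_ball d R \<alpha> \<delta>" and \<delta>: "0 \<le> \<delta>" and x: "x \<in> input_ball d R" and R: "0 < R"
  shows "\<bar>f x\<bar> \<le> sqrt 2 ^ \<alpha> * \<delta>"
proof -
  have "\<bar>f x\<bar> / sqrt 2 ^ \<alpha> \<le> T" if T: "\<delta> < T" for T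
  proof -
    obtain p q where pq: "finite_measure p" "finite_measure q" "sets p = sets (weight_space d R)"
      "sets q = sets (weight_space d R)" "measure p (weight_sphere d R) + measure q (weight_sphere d R) \<le> T"
      "f x = (\<integral>v. neuron d R \<alpha> v x \<partial>p) - (\<integral>v. neuron d R \<alpha> v x \<partial>q)"
      using F1_ball_jordan[OF f \<delta> T] x by blast
    have bd: "0 \<le> (\<integral>v. neuron d R \<alpha> v x \<partial>\<kappa>) \<and> (\<integral>v. neuron d R \<alpha> v x \<partial>\<kappa>) \<le> sqrt 2 ^ \<alpha> * measure \<kappa> (weight_sphere d R)"
      if \<kappa>: "finite_measure \<kappa>" "sets \<kappa> = sets (weight_space d R)" for \<kappa>
    proof
      interpret \<kappa>: finite_measure \<kappa> by fact
      have sp: "space \<kappa> = weight_sphere d R" using sets_eq_imp_space_eq[OF \<kappa>(2)] by simp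
      show "0 \<le> (\<integral>v. neuron d R \<alpha> v x \<partial>\<kappa>)" by (simp add: neuron_def)
      have "(\<integral>v. neuron d R \<alpha> v x \<partial>\<kappa>) \<le> (\<integral>v. sqrt 2 ^ \<alpha> \<partial>\<kappa>)"
      proof (rule integral_mono[OF integrable_neuron[OF \<kappa> x R]])
        fix v assume "v \<in> space \<kappa>"
        then show "neuron d R \<alpha> v x \<le> sqrt 2 ^ \<alpha>"
          using neuron_le[OF x R, of v 1 \<alpha>] by (simp add: sp weight_sphere_def)
      qed simp
      then show "(\<integral>v. neuron d R \<alpha> v x \<partial>\<kappa>) \<le> sqrt 2 ^ \<alpha> * measure \<kappa> (weight_sphere d R)"
        by (simp add: sp mult.commute)
    qed
    have "\<bar>f x\<bar> \<le> sqrt 2 ^ \<alpha> * measure p (weight_sphere d R) + sqrt 2 ^ \<alpha> * measure q (weight_sphere d R)"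
      using bd[OF pq(1,3)] bd[OF pq(2,4)] unfolding pq(6) by linarith
    also have "\<dots> = sqrt 2 ^ \<alpha> * (measure p (weight_sphere d R) + measure q (weight_sphere d R))"
      by (simp add: distrib_left)
    also have "\<dots> \<le> sqrt 2 ^ \<alpha> * T" using pq(5) by (intro mult_left_mono) auto
    finally show ?thesis by (simp add: divide_le_eq mult.commute)
  qed
  \<comment> \<open>Here the slack disappears, since T > \<delta> was arbitrary.\<close>
  then have "\<bar>f x\<bar> / sqrt 2 ^ \<alpha> \<le> \<delta>" by (rule dense_ge)
  then show ?thesis by (simp add: divide_le_eq mult.commute)
qed

text \<open>A member is \<open>undefined\<close> off the ball, so measurability on the whole space
  is shown for the integrals that represent it.\<close>

lemma F1_ball_measurable_extension:
  assumes f: "f \<in> F1_ball d R \<alpha> \<delta>" and \<delta>: "0 \<le> \<delta>"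
  shows "\<exists>g \<in> borel_measurable (borel_vec d). \<forall>x\<in>input_ball d R. f x = g x"
proof -
  obtain p q where pq: "finite_measure p" "finite_measure q" "sets p = sets (weight_space d R)"
    "sets q = sets (weight_space d R)"
    "\<forall>x\<in>input_ball d R. f x = (\<integral>v. neuron d R \<alpha> v x \<partial>p) - (\<integral>v. neuron d R \<alpha> v x \<partial>q)"
    using F1_ball_jordan[OF f \<delta>, of "\<delta> + 1"] by auto
  have meas: "(\<lambda>x. \<integral>v. neuron d R \<alpha> v x \<partial>\<kappa>) \<in> borel_measurable (borel_vec d)"
    if \<kappa>: "finite_measure \<kappa>" "sets \<kappa> = sets (weight_space d R)" for \<kappa>
  proof -
    interpret \<kappa>: finite_measure \<kappa> by fact
    have "sets (borel_vec d \<Otimes>\<^sub>M \<kappa>) = sets (borel_vec d \<Otimes>\<^sub>M weight_space d R)"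
      by (intro sets_pair_measure_cong refl \<kappa>(2))
    then have "(\<lambda>(x, v). neuron d R \<alpha> v x) \<in> borel_measurable (borel_vec d \<Otimes>\<^sub>M \<kappa>)"
      using neuron_measurable_pair measurable_cong_sets by blast
    then show ?thesis by (rule \<kappa>.borel_measurable_lebesgue_integral)
  qed
  show ?thesis
    by (rule bexI[where x = "\<lambda>x. (\<integral>v. neuron d R \<alpha> v x \<partial>p) - (\<integral>v. neuron d R \<alpha> v x \<partial>q)"])
       (rule pq(5), intro borel_measurable_diff meas pq(1-4))
qed

text \<open>The source of all explicit members: point masses for finite networks, images of
  Stieltjes measures for \<alpha> = 0.\<close>

lemma F1_ball_combination:
  fixes c :: "'i \<Rightarrow> real"
  assumes I: "finite I" and R: "0 < R"
    and \<mu>: "\<And>i. i \<in> I \<Longrightarrow> finite_measure (\<mu> i)" "\<And>i. i \<in> I \<Longrightarrow> sets (\<mu> i) = sets (weight_space d R)"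
    and mass: "(\<Sum>i\<in>I. \<bar>c i\<bar> * measure (\<mu> i) (weight_sphere d R)) \<le> \<delta>"
  shows "restrict (\<lambda>x. \<Sum>i\<in>I. c i * (\<integral>v. neuron d R \<alpha> v x \<partial>\<mu> i)) (input_ball d R) \<in> F1_ball d R \<alpha> \<delta>"
proof -
  let ?W = "weight_space d R"
  let ?f = "restrict (\<lambda>x. \<Sum>i\<in>I. c i * (\<integral>v. neuron d R \<alpha> v x \<partial>\<mu> i)) (input_ball d R)"
  define \<nu> where "\<nu> A = (\<Sum>i\<in>I. c i * measure (\<mu> i) A)" for A
  have \<nu>: "\<nu> = (\<lambda>A. \<Sum>i\<in>I. c i * measure (\<mu> i) A)" by (auto simp: \<nu>_def)
  note comb = signed_measure_combination[where c = c and \<mu> = \<mu>, OF I \<mu>, folded \<nu>]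
  have tv: "total_variation ?W \<nu> \<le> ennreal \<delta>"
    using comb(2) mass by (auto intro: order_trans ennreal_leI)
  have "signed_integral ?W \<nu> (\<lambda>v. pos_power \<alpha> (dot (Suc d) v (lift_input d R x))) = (\<Sum>i\<in>I. c i * (\<integral>v. neuron d R \<alpha> v x \<partial>\<mu> i))"
    if x: "x \<in> input_ball d R" for x
  proof -
    \<comment> \<open>Cut off outside the sphere, because the integral formula wants one bound at
      all points, and neurons are bounded uniformly on the sphere only.\<close>
    let ?g = "\<lambda>v. if v \<in> space ?W then neuron d R \<alpha> v x else 0"
    have g: "?g \<in> borel_measurable ?W"
      by (subst measurable_cong[of ?W ?g "\<lambda>v. neuron d R \<alpha> v x"]) (simp_all add: neuron_measurable_weight)
    have gb: "\<bar>?g v\<bar> \<le> sqrt 2 ^ \<alpha>" for v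
      using neuron_le[OF x R, of v 1 \<alpha>] by (auto simp: weight_sphere_def neuron_def)
    have eq: "(\<integral>v. neuron d R \<alpha> v x \<partial>\<kappa>) = (\<integral>v. ?g v \<partial>\<kappa>)" if "space \<kappa> = space ?W" for \<kappa>
      using that by (intro Bochner_Integration.integral_cong) auto
    have "signed_integral ?W \<nu> (\<lambda>v. pos_power \<alpha> (dot (Suc d) v (lift_input d R x))) = signed_integral ?W \<nu> ?g"
      unfolding signed_integral_def neuron_def[symmetric] by (simp only: eq space_positive_part)
    also have "\<dots> = (\<Sum>i\<in>I. c i * (\<integral>v. ?g v \<partial>\<mu> i))" by (rule comb(3)[OF _ _ g gb])
    also have "\<dots> = (\<Sum>i\<in>I. c i * (\<integral>v. neuron d R \<alpha> v x \<partial>\<mu> i))"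
      by (intro sum.cong refl arg_cong2[where f = "(*)"] eq[symmetric] sets_eq_imp_space_eq \<mu>)
    finally show ?thesis .
  qed
  then have rep: "represents d R \<alpha> \<nu> ?f"
    using comb(1) tv unfolding represents_def
    by (auto simp: fun_eq_iff intro: le_less_trans)
  then have "gamma1 d R \<alpha> ?f \<le> ennreal \<delta>"
    unfolding gamma1_def using tv by (intro INF_lower2[of \<nu>]) auto
  then show ?thesis using rep by (auto simp: F1_ball_def F1_def)
qed

section \<open>Networks with grid weights\<close>

text \<open>
  Networks with weights on a grid form a countable family. Rounding the weights so that
  \<open>v\<^sup>T z\<close> never increases makes every neuron, also for \<open>\<alpha> = 0\<close>, a pointwise limit on the input ball.
\<close>

definition grid_point :: "nat \<Rightarrow> nat \<Rightarrow> (nat \<Rightarrow> real) \<Rightarrow> int list" where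
  "grid_point d N v = map (\<lambda>i. if i < d then \<lfloor>real N * v i\<rfloor> else \<lfloor>real N * v i\<rfloor> - int d) [0..<Suc d]"

definition grid_weight :: "nat \<Rightarrow> int list \<Rightarrow> nat \<Rightarrow> real" where
  "grid_weight N k i = real_of_int (k ! i) / real N"

lemma length_grid_point [simp]: "length (grid_point d N v) = Suc d"
  by (simp add: grid_point_def)

lemma nth_grid_point:
  "i < Suc d \<Longrightarrow> grid_point d N v ! i = (if i < d then \<lfloor>real N * v i\<rfloor> else \<lfloor>real N * v i\<rfloor> - int d)"
  unfolding grid_point_def by (subst nth_map) (auto simp del: upt_Suc)

lemma grid_weight_bounds:
  assumes N: "0 < N"
  shows "i < d \<Longrightarrow> v i - 1 / real N \<le> grid_weight N (grid_point d N v) i \<and> grid_weight N (grid_point d N v) i \<le> v i"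
    and "v d - (real d + 1) / real N \<le> grid_weight N (grid_point d N v) d \<and>
      grid_weight N (grid_point d N v) d \<le> v d - real d / real N"
proof -
  have fl: "real N * v i - 1 \<le> real_of_int \<lfloor>real N * v i\<rfloor>" "real_of_int \<lfloor>real N * v i\<rfloor> \<le> real N * v i" for i
    by linarith+
  have fl': "v i - 1 / real N \<le> real_of_int \<lfloor>real N * v i\<rfloor> / real N" "real_of_int \<lfloor>real N * v i\<rfloor> / real N \<le> v i" for i
    using divide_right_mono[OF fl(1)[of i], of "real N"] divide_right_mono[OF fl(2)[of i], of "real N"] N
    by (simp_all add: diff_divide_distrib)
  show "v i - 1 / real N \<le> grid_weight N (grid_point d N v) i \<and> grid_weight N (grid_point d N v) i \<le> v i" if "i < d"
    using fl'[of i] that by (simp add: grid_weight_def nth_grid_point)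
  show "v d - (real d + 1) / real N \<le> grid_weight N (grid_point d N v) d \<and>
      grid_weight N (grid_point d N v) d \<le> v d - real d / real N"
    using fl'[of d] by (simp add: grid_weight_def nth_grid_point diff_divide_distrib add_divide_distrib)
qed

lemma input_ball_component_le:
  assumes "x \<in> input_ball d R" "i < d"
  shows "\<bar>x i\<bar> \<le> R"
proof -
  have "\<bar>x i\<bar> \<le> L2_set (\<lambda>i. \<bar>x i\<bar>) {..<d}" using assms(2) by (intro member_le_L2_set) auto
  also have "\<dots> = L2_set x {..<d}" by (simp add: L2_set_def)
  finally show ?thesis using assms(1) by (simp add: input_ball_def)
qed

text \<open>Rounding \<open>d\<close> weights down moves their part of the inner product by at most
  d R / N, but in either direction, since inputs may be negative. The bias is lowered by a further d
  / N to compensate, which is the shift by \<open>d\<close> in \<open>grid_point\<close>.\<close>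

lemma grid_dot_bounds:
  assumes N: "0 < N" and x: "x \<in> input_ball d R" and R: "0 < R"
  shows "dot (Suc d) (grid_weight N (grid_point d N v)) (lift_input d R x) \<le> dot (Suc d) v (lift_input d R x)"
    and "dot (Suc d) v (lift_input d R x) - (2 * real d + 1) * R / real N
      \<le> dot (Suc d) (grid_weight N (grid_point d N v)) (lift_input d R x)"
proof -
  let ?g = "grid_weight N (grid_point d N v)"
  have "\<bar>dot d ?g x - dot d v x\<bar> = \<bar>\<Sum>i<d. (?g i - v i) * x i\<bar>"
    by (simp add: dot_def sum_subtractf left_diff_distrib)
  also have "\<dots> \<le> (\<Sum>i<d. 1 / real N * R)"
  proof (intro order_trans[OF sum_abs] sum_mono)
    fix i assume i: "i \<in> {..<d}"
    have "\<bar>?g i - v i\<bar> \<le> 1 / real N" using grid_weight_bounds(1)[OF N, of i d v] i by (auto simp: abs_le_iff)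
    then show "\<bar>(?g i - v i) * x i\<bar> \<le> 1 / real N * R"
      unfolding abs_mult using input_ball_component_le[OF x, of i] i by (intro mult_mono) auto
  qed
  finally have 1: "\<bar>dot d ?g x - dot d v x\<bar> \<le> real d * R / real N" by simp
  define X where "X = real d * R / real N"
  define Y where "Y = (real d + 1) * R / real N"
  have "?g d * R \<le> (v d - real d / real N) * R" "(v d - (real d + 1) / real N) * R \<le> ?g d * R"
    using grid_weight_bounds(2)[OF N, of v d] R by (auto intro!: mult_right_mono)
  moreover have "(v d - real d / real N) * R = v d * R - X" "(v d - (real d + 1) / real N) * R = v d * R - Y"
    by (simp_all add: left_diff_distrib X_def Y_def)
  ultimately have 2: "?g d * R \<le> v d * R - X" "v d * R - Y \<le> ?g d * R" by simp_all
  have 3: "(2 * real d + 1) * R / real N = X + Y"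
    by (simp add: X_def Y_def add_divide_distrib[symmetric] distrib_right)
  show "dot (Suc d) ?g (lift_input d R x) \<le> dot (Suc d) v (lift_input d R x)"
    "dot (Suc d) v (lift_input d R x) - (2 * real d + 1) * R / real N \<le> dot (Suc d) ?g (lift_input d R x)"
    unfolding dot_lift_input 3 using 1[folded X_def] 2 by linarith+
qed

text \<open>Rounding moves the weight by at most (2 d + 1) / N in norm, and for such
  \<open>N\<close> this is at most 1 / R, the radius of the sphere.\<close>

lemma grid_weight_norm:
  assumes v: "v \<in> weight_sphere d R" and R: "0 < R" and N: "(2 * real d + 1) * R \<le> real N" "0 < N"
  shows "L2_set (grid_weight N (grid_point d N v)) {..<Suc d} \<le> 2 / R"
proof -
  let ?g = "grid_weight N (grid_point d N v)"
  have "L2_set ?g {..<Suc d} = L2_set (\<lambda>i. v i + (?g i - v i)) {..<Suc d}" by simp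
  also have "\<dots> \<le> L2_set v {..<Suc d} + L2_set (\<lambda>i. ?g i - v i) {..<Suc d}" by (rule L2_set_triangle_ineq)
  also have "L2_set v {..<Suc d} = 1 / R" using v by (simp add: weight_sphere_def)
  also have "L2_set (\<lambda>i. ?g i - v i) {..<Suc d} \<le> (\<Sum>i<Suc d. \<bar>?g i - v i\<bar>)" by (rule L2_set_le_sum_abs)
  also have "\<dots> \<le> (\<Sum>i<d. 1 / real N) + (real d + 1) / real N"
    unfolding sum.lessThan_Suc
  proof (rule add_mono[OF sum_mono])
    show "\<bar>?g i - v i\<bar> \<le> 1 / real N" if "i \<in> {..<d}" for i
      using grid_weight_bounds(1)[OF N(2), of i d v] that by (auto simp: abs_le_iff)
    have "0 \<le> real d / real N" "0 \<le> 1 / real N" by simp_all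
    then show "\<bar>?g d - v d\<bar> \<le> (real d + 1) / real N"
      using grid_weight_bounds(2)[OF N(2), of v d] unfolding abs_le_iff add_divide_distrib by linarith
  qed
  also have "\<dots> = (2 * real d + 1) / real N" by (simp add: add_divide_distrib)
  also have "\<dots> \<le> 1 / R" using N R by (simp add: field_simps)
  finally show ?thesis by simp
qed

lemma finite_grid_points: "0 < R \<Longrightarrow> finite (grid_point d N ` weight_sphere d R)"
proof (rule finite_subset)
  assume R: "0 < R"
  define K where "K = \<lceil>real N / R\<rceil> + int d + 1"
  show "grid_point d N ` weight_sphere d R \<subseteq> {k. set k \<subseteq> {-K..K} \<and> length k = Suc d}"
  proof clarify
    fix v assume v: "v \<in> weight_sphere d R"
    have "grid_point d N v ! i \<in> {-K..K}" if i: "i < Suc d" for i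
    proof -
      have "\<bar>v i\<bar> \<le> L2_set (\<lambda>i. \<bar>v i\<bar>) {..<Suc d}" using i by (intro member_le_L2_set) auto
      also have "\<dots> = 1 / R" using v by (simp add: weight_sphere_def L2_set_def)
      finally have "real N * \<bar>v i\<bar> \<le> real N * (1 / R)" by (intro mult_left_mono) auto
      then have "\<bar>real N * v i\<bar> \<le> real N / R" by (simp add: abs_mult)
      moreover have "real N / R \<le> real_of_int \<lceil>real N / R\<rceil>" by linarith
      ultimately have "real N * v i \<le> real_of_int \<lceil>real N / R\<rceil>" "- real_of_int \<lceil>real N / R\<rceil> \<le> real N * v i" by linarith+
      then have "\<lfloor>real N * v i\<rfloor> \<le> \<lceil>real N / R\<rceil>" "- \<lceil>real N / R\<rceil> \<le> \<lfloor>real N * v i\<rfloor>" by linarith+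
      then show ?thesis unfolding nth_grid_point[OF i] K_def by auto
    qed
    then have "set (grid_point d N v) \<subseteq> {-K..K}" by (auto simp: in_set_conv_nth simp del: atLeastAtMost_iff)
    then show "set (grid_point d N v) \<subseteq> {-K..K} \<and> length (grid_point d N v) = Suc d" by simp
  qed
  show "finite {k. set k \<subseteq> {-K..K} \<and> length k = Suc d}" by (rule finite_lists_length_eq) simp
qed

lemma grid_cell_measurable:
  "{v \<in> weight_sphere d R. grid_point d N v = k} \<in> sets (weight_space d R)"
proof (cases "length k = Suc d")
  case True
  have v: "(\<lambda>v. v i) \<in> borel_measurable (weight_space d R)" if "i \<in> {..<Suc d}" for i
    unfolding weight_space_def using that
    by (intro measurable_restrict_space1 measurable_component_singleton) auto
  have "{v \<in> space (weight_space d R). \<forall>i\<in>{..<Suc d}. \<lfloor>real N * v i\<rfloor> = (if i < d then k ! i else k ! i + int d)} \<in> sets (weight_space d R)"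
  proof (rule sets.sets_Collect_finite_All)
    fix i assume i: "i \<in> {..<Suc d}"
    note v[OF i, measurable]
    show "{v \<in> space (weight_space d R). \<lfloor>real N * v i\<rfloor> = (if i < d then k ! i else k ! i + int d)} \<in> sets (weight_space d R)"
      unfolding floor_eq_iff by measurable
  qed simp
  moreover have "grid_point d N v = k \<longleftrightarrow> (\<forall>i\<in>{..<Suc d}. \<lfloor>real N * v i\<rfloor> = (if i < d then k ! i else k ! i + int d))" for v
    using True by (auto simp: list_eq_iff_nth_eq nth_grid_point split: if_splits)
  ultimately show ?thesis by simp
next
  case False
  then have "{v \<in> weight_sphere d R. grid_point d N v = k} = {}" by (metis (mono_tags, lifting) Collect_empty_eq length_grid_point)
  then show ?thesis by (simp only: sets.empty_sets)
qed

lemma integral_grid_neuron: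
  assumes \<kappa>: "finite_measure \<kappa>" "sets \<kappa> = sets (weight_space d R)" and R: "0 < R"
  shows "(\<integral>v. neuron d R \<alpha> (grid_weight N (grid_point d N v)) x \<partial>\<kappa>) =
    (\<Sum>k\<in>grid_point d N ` weight_sphere d R. measure \<kappa> {v \<in> weight_sphere d R. grid_point d N v = k} * neuron d R \<alpha> (grid_weight N k) x)"
proof -
  interpret \<kappa>: finite_measure \<kappa> by fact
  let ?G = "grid_point d N ` weight_sphere d R"
  let ?C = "\<lambda>k. {v \<in> weight_sphere d R. grid_point d N v = k}"
  have sp: "space \<kappa> = weight_sphere d R" using sets_eq_imp_space_eq[OF \<kappa>(2)] by simp
  have C: "?C k \<in> sets \<kappa>" for k using grid_cell_measurable \<kappa>(2) by blast
  have "neuron d R \<alpha> (grid_weight N (grid_point d N v)) x = (\<Sum>k\<in>?G. indicator (?C k) v * neuron d R \<alpha> (grid_weight N k) x)"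
    if v: "v \<in> space \<kappa>" for v
  proof -
    have "(\<Sum>k\<in>?G. indicator (?C k) v * neuron d R \<alpha> (grid_weight N k) x) =
      (\<Sum>k\<in>?G. if k = grid_point d N v then neuron d R \<alpha> (grid_weight N k) x else 0)"
      using v by (intro sum.cong) (auto simp: sp indicator_def)
    also have "\<dots> = neuron d R \<alpha> (grid_weight N (grid_point d N v)) x"
      using v finite_grid_points[OF R] by (subst sum.delta) (auto simp: sp)
    finally show ?thesis ..
  qed
  then have "(\<integral>v. neuron d R \<alpha> (grid_weight N (grid_point d N v)) x \<partial>\<kappa>) =
     (\<integral>v. (\<Sum>k\<in>?G. indicator (?C k) v * neuron d R \<alpha> (grid_weight N k) x) \<partial>\<kappa>)"
    by (intro Bochner_Integration.integral_cong refl)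
  also have "\<dots> = (\<Sum>k\<in>?G. measure \<kappa> (?C k) * neuron d R \<alpha> (grid_weight N k) x)"
    using C by (subst Bochner_Integration.integral_sum) (auto simp: sp Int_absorb2 Collect_restrict less_top[symmetric])
  finally show ?thesis .
qed

text \<open>The neurons converge for each single weight, because the rounded inner products increase
  to the limit in value from below, and the norm bound 2 / R gives a constant majorant.\<close>

lemma integral_grid_neuron_tendsto:
  assumes \<kappa>: "finite_measure \<kappa>" "sets \<kappa> = sets (weight_space d R)" and R: "0 < R"
    and x: "x \<in> input_ball d R" and N: "\<And>m. (2 * real d + 1) * R \<le> real (N m)" "\<And>m. 0 < N m"
    and lim: "(\<lambda>m. 1 / real (N m)) \<longlonglongrightarrow> 0"
  shows "(\<lambda>m. \<integral>v. neuron d R \<alpha> (grid_weight (N m) (grid_point d (N m) v)) x \<partial>\<kappa>) \<longlonglongrightarrow> (\<integral>v. neuron d R \<alpha> v x \<partial>\<kappa>)"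
proof (rule integral_dominated_convergence[where w = "\<lambda>_. (2 * sqrt 2) ^ \<alpha>"])
  interpret \<kappa>: finite_measure \<kappa> by fact
  have sp: "space \<kappa> = weight_sphere d R" using sets_eq_imp_space_eq[OF \<kappa>(2)] by simp
  show "(\<lambda>v. neuron d R \<alpha> v x) \<in> borel_measurable \<kappa>"
    using neuron_measurable_weight \<kappa>(2) measurable_cong_sets by blast
  show "(\<lambda>v. neuron d R \<alpha> (grid_weight (N m) (grid_point d (N m) v)) x) \<in> borel_measurable \<kappa>" for m
  proof -
    have "{v \<in> space \<kappa>. grid_point d (N m) v = k} \<in> sets \<kappa>" for k
      using grid_cell_measurable[of d R "N m" k] \<kappa>(2) sp by simp
    moreover have "countable (grid_point d (N m) ` space \<kappa>)"
      unfolding sp using finite_grid_points[OF R] by (rule countable_finite)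
    ultimately have "grid_point d (N m) \<in> measurable \<kappa> (count_space UNIV)"
      by (intro measurable_count_space_eq_countable[THEN iffD2] conjI)
         (auto simp: vimage_def Int_def conj_commute)
    then show ?thesis by (rule measurable_compose) simp
  qed
  show "integrable \<kappa> (\<lambda>_. (2 * sqrt 2) ^ \<alpha>)" by simp
  show "AE v in \<kappa>. (\<lambda>m. neuron d R \<alpha> (grid_weight (N m) (grid_point d (N m) v)) x) \<longlonglongrightarrow> neuron d R \<alpha> v x"
  proof (rule AE_I2)
    fix v
    let ?t = "dot (Suc d) v (lift_input d R x)"
    have l: "(\<lambda>m. ?t - (2 * real d + 1) * R * (1 / real (N m))) \<longlonglongrightarrow> ?t - (2 * real d + 1) * R * 0"
      by (intro tendsto_diff tendsto_mult lim tendsto_const)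
    have "(\<lambda>m. dot (Suc d) (grid_weight (N m) (grid_point d (N m) v)) (lift_input d R x)) \<longlonglongrightarrow> ?t"
      by (rule tendsto_sandwich[OF _ _ _ tendsto_const])
         (use grid_dot_bounds[OF N(2) x R] l in auto)
    then show "(\<lambda>m. neuron d R \<alpha> (grid_weight (N m) (grid_point d (N m) v)) x) \<longlonglongrightarrow> neuron d R \<alpha> v x"
      unfolding neuron_def by (rule pos_power_tendsto_below[rotated]) (rule grid_dot_bounds(1)[OF N(2) x R])
  qed
  show "AE v in \<kappa>. norm (neuron d R \<alpha> (grid_weight (N m) (grid_point d (N m) v)) x) \<le> (2 * sqrt 2) ^ \<alpha>" for m
  proof (rule AE_I2)
    fix v assume "v \<in> space \<kappa>"
    then have "neuron d R \<alpha> (grid_weight (N m) (grid_point d (N m) v)) x \<le> (2 * sqrt 2) ^ \<alpha>"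
      unfolding sp by (intro neuron_le[OF x R] grid_weight_norm R N)
    then show "norm (neuron d R \<alpha> (grid_weight (N m) (grid_point d (N m) v)) x) \<le> (2 * sqrt 2) ^ \<alpha>"
      by (simp add: neuron_def)
  qed
qed

text \<open>Rounding towards 0, so that the total absolute weight of a network does not
  grow.\<close>

lemma exists_truncation:
  fixes a :: real
  assumes "0 < M"
  shows "\<exists>c::int. \<bar>real_of_int c / real M\<bar> \<le> \<bar>a\<bar> \<and> \<bar>real_of_int c / real M - a\<bar> \<le> 1 / real M"
proof -
  define b where "b = real M * a"
  have "\<exists>c::int. \<bar>real_of_int c\<bar> \<le> \<bar>b\<bar> \<and> \<bar>real_of_int c - b\<bar> \<le> 1"
  proof (cases "0 \<le> b")
    case True
    then have "0 \<le> \<lfloor>b\<rfloor>" by simp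
    then have "\<bar>real_of_int \<lfloor>b\<rfloor>\<bar> \<le> \<bar>b\<bar>" "\<bar>real_of_int \<lfloor>b\<rfloor> - b\<bar> \<le> 1" using True by linarith+
    then show ?thesis by blast
  next
    case False
    then have "\<lceil>b\<rceil> \<le> 0" by simp
    then have "\<bar>real_of_int \<lceil>b\<rceil>\<bar> \<le> \<bar>b\<bar>" "\<bar>real_of_int \<lceil>b\<rceil> - b\<bar> \<le> 1" using False by linarith+
    then show ?thesis by blast
  qed
  then obtain c :: int where c: "\<bar>real_of_int c\<bar> \<le> \<bar>b\<bar>" "\<bar>real_of_int c - b\<bar> \<le> 1" by blast
  have "a = b / real M" using assms by (simp add: b_def)
  then have "\<bar>real_of_int c / real M - a\<bar> = \<bar>real_of_int c - b\<bar> / real M"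
    using assms by (simp add: diff_divide_distrib[symmetric])
  moreover have "\<bar>real_of_int c / real M\<bar> \<le> \<bar>a\<bar>"
    using c(1) assms by (simp add: b_def abs_mult divide_le_eq mult.commute)
  ultimately show ?thesis using c(2) assms by (intro exI[of _ c]) (simp add: divide_right_mono)
qed

text \<open>A grid resolution for the weights, a denominator for the coefficients, and the list of
  neurons. The type is countable, so \<open>to_nat\<close> can enumerate all networks.\<close>

type_synonym net_code = "nat \<times> nat \<times> (int \<times> int list) list"

fun grid_net :: "nat \<Rightarrow> real \<Rightarrow> nat \<Rightarrow> net_code \<Rightarrow> (nat \<Rightarrow> real) \<Rightarrow> real" where
  "grid_net d R \<alpha> (N, M, L) x = (\<Sum>(c, k)\<leftarrow>L. real_of_int c / real M * neuron d R \<alpha> (grid_weight N k) x)"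

fun net_admissible :: "nat \<Rightarrow> real \<Rightarrow> real \<Rightarrow> net_code \<Rightarrow> bool" where
  "net_admissible d R B (N, M, L) \<longleftrightarrow> (\<Sum>(c, k)\<leftarrow>L. \<bar>real_of_int c / real M\<bar>) \<le> B \<and>
     (\<forall>(c, k)\<in>set L. L2_set (grid_weight N k) {..<Suc d} \<le> 2 / R)"

text \<open>Every grid cell is contracted to its grid point and carries its charge, the difference
  of the two Jordan parts; the charges are then made rational. The mass 2 \<delta> is a convenient
  choice above \<delta>.\<close>

lemma F1_ball_grid_approximation:
  assumes f: "f \<in> F1_ball d R \<alpha> \<delta>" and \<delta>: "0 < \<delta>" and R: "0 < R"
  shows "\<exists>\<L>. (\<forall>m. net_admissible d R (2 * \<delta>) (\<L> m)) \<and>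
    (\<forall>x\<in>input_ball d R. (\<lambda>m::nat. grid_net d R \<alpha> (\<L> m) x) \<longlonglongrightarrow> f x)"
proof -
  obtain p q where pq: "finite_measure p" "finite_measure q" "sets p = sets (weight_space d R)"
    "sets q = sets (weight_space d R)" "measure p (weight_sphere d R) + measure q (weight_sphere d R) \<le> 2 * \<delta>"
    "\<forall>x\<in>input_ball d R. f x = (\<integral>v. neuron d R \<alpha> v x \<partial>p) - (\<integral>v. neuron d R \<alpha> v x \<partial>q)"
    using F1_ball_jordan[OF f, of "2 * \<delta>"] \<delta> by auto
  define N where "N m = nat \<lceil>(2 * real d + 1) * R\<rceil> + Suc m" for m
  have N: "(2 * real d + 1) * R \<le> real (N m)" "0 < N m" for m unfolding N_def by linarith+
  have Nlim: "(\<lambda>m. 1 / real (N m)) \<longlonglongrightarrow> 0"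
  proof (rule tendsto_sandwich[OF _ _ tendsto_const LIMSEQ_inverse_real_of_nat])
    show "\<forall>\<^sub>F m in sequentially. 1 / real (N m) \<le> inverse (real (Suc m))"
      by (intro always_eventually allI) (simp add: N_def inverse_eq_divide frac_le)
  qed simp
  define G where "G m = grid_point d (N m) ` weight_sphere d R" for m
  have finG: "finite (G m)" for m unfolding G_def by (rule finite_grid_points[OF R])
  define C where "C m k = {v \<in> weight_sphere d R. grid_point d (N m) v = k}" for m k
  define a where "a m k = measure p (C m k) - measure q (C m k)" for m k
  have suma: "(\<Sum>k\<in>G m. \<bar>a m k\<bar>) \<le> 2 * \<delta>" for m
  proof -
    have tot: "(\<Sum>k\<in>G m. measure \<kappa> (C m k)) = measure \<kappa> (weight_sphere d R)"
      if \<kappa>: "finite_measure \<kappa>" "sets \<kappa> = sets (weight_space d R)" for \<kappa>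
    proof -
      have "measure \<kappa> (\<Union>k\<in>G m. C m k) = (\<Sum>k\<in>G m. measure \<kappa> (C m k))"
        using grid_cell_measurable \<kappa>(2)
        by (intro finite_measure.finite_measure_finite_Union[OF \<kappa>(1) finG])
           (auto simp: C_def disjoint_family_on_def)
      moreover have "(\<Union>k\<in>G m. C m k) = weight_sphere d R" by (auto simp: C_def G_def)
      ultimately show ?thesis by simp
    qed
    have "(\<Sum>k\<in>G m. \<bar>a m k\<bar>) \<le> (\<Sum>k\<in>G m. measure p (C m k) + measure q (C m k))"
      unfolding a_def by (intro sum_mono) (auto simp: abs_le_iff add_increasing add_increasing2)
    then show ?thesis using pq(5) by (simp add: sum.distrib tot[OF pq(1,3)] tot[OF pq(2,4)])
  qed
  \<comment> \<open>More than \<open>N m\<close> times the number of cells, so that the rounding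
    errors of all coefficients together are below 1 / N m.\<close>
  define M where "M m = Suc (N m * card (G m))" for m
  have "\<exists>c. \<forall>m k. \<bar>real_of_int (c m k) / real (M m)\<bar> \<le> \<bar>a m k\<bar> \<and> \<bar>real_of_int (c m k) / real (M m) - a m k\<bar> \<le> 1 / real (M m)"
    using exists_truncation[of "M _" "a _ _"] by (intro choice allI) (simp add: M_def)
  then obtain c where c: "\<And>m k. \<bar>real_of_int (c m k) / real (M m)\<bar> \<le> \<bar>a m k\<bar>"
    "\<And>m k. \<bar>real_of_int (c m k) / real (M m) - a m k\<bar> \<le> 1 / real (M m)" by blast
  have "\<exists>ks. \<forall>m. set (ks m) = G m \<and> distinct (ks m)"
    using finite_distinct_list[OF finG] by (intro choice allI) blast
  then obtain ks where ks: "\<And>m. set (ks m) = G m" "\<And>m. distinct (ks m)" by blast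
  define \<L> where "\<L> m = (N m, M m, map (\<lambda>k. (c m k, k)) (ks m))" for m
  have sl: "(\<Sum>(c, k)\<leftarrow>map (\<lambda>k. (c m k, k)) (ks m). h c k) = (\<Sum>k\<in>G m. h (c m k) k)" for m and h :: "int \<Rightarrow> int list \<Rightarrow> real"
    using ks[of m] by (simp add: comp_def sum_list_distinct_conv_sum_set)
  have "net_admissible d R (2 * \<delta>) (\<L> m)" for m
    unfolding \<L>_def net_admissible.simps sl
  proof
    have "(\<Sum>k\<in>G m. \<bar>real_of_int (c m k) / real (M m)\<bar>) \<le> (\<Sum>k\<in>G m. \<bar>a m k\<bar>)" by (intro sum_mono c)
    then show "(\<Sum>k\<in>G m. \<bar>real_of_int (c m k) / real (M m)\<bar>) \<le> 2 * \<delta>" using suma[of m] by linarith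
    show "\<forall>(c, k)\<in>set (map (\<lambda>k. (c m k, k)) (ks m)). L2_set (grid_weight (N m) k) {..<Suc d} \<le> 2 / R"
      using ks(1)[of m] grid_weight_norm[OF _ R N] by (auto simp: G_def)
  qed
  moreover have "(\<lambda>m. grid_net d R \<alpha> (\<L> m) x) \<longlonglongrightarrow> f x" if x: "x \<in> input_ball d R" for x
  proof -
    define h where "h m = (\<Sum>k\<in>G m. a m k * neuron d R \<alpha> (grid_weight (N m) k) x)" for m
    have "h m = (\<integral>v. neuron d R \<alpha> (grid_weight (N m) (grid_point d (N m) v)) x \<partial>p) -
        (\<integral>v. neuron d R \<alpha> (grid_weight (N m) (grid_point d (N m) v)) x \<partial>q)" for m
      unfolding integral_grid_neuron[OF pq(1,3) R] integral_grid_neuron[OF pq(2,4) R] h_def a_def C_def G_def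
      by (simp add: left_diff_distrib sum_subtractf)
    then have h: "h = (\<lambda>m. (\<integral>v. neuron d R \<alpha> (grid_weight (N m) (grid_point d (N m) v)) x \<partial>p) -
        (\<integral>v. neuron d R \<alpha> (grid_weight (N m) (grid_point d (N m) v)) x \<partial>q))" by (intro ext)
    have fx: "f x = (\<integral>v. neuron d R \<alpha> v x \<partial>p) - (\<integral>v. neuron d R \<alpha> v x \<partial>q)" using pq(6) x by blast
    have hlim: "h \<longlonglongrightarrow> f x"
      unfolding h fx
      by (intro tendsto_diff integral_grid_neuron_tendsto[OF pq(1,3) R x N Nlim] integral_grid_neuron_tendsto[OF pq(2,4) R x N Nlim])
    define B where "B = (2 * sqrt 2) ^ \<alpha>"
    have B0: "0 \<le> B" by (simp add: B_def)
    have nB: "\<bar>neuron d R \<alpha> (grid_weight (N m) k) x\<bar> \<le> B" if "k \<in> G m" for m k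
    proof -
      have "neuron d R \<alpha> (grid_weight (N m) k) x \<le> B"
        using that grid_weight_norm[OF _ R N] unfolding B_def by (intro neuron_le[OF x R]) (auto simp: G_def)
      then show ?thesis by (simp add: neuron_def)
    qed
    have diff: "norm (grid_net d R \<alpha> (\<L> m) x - h m) \<le> B * (1 / real (N m))" for m
    proof -
      have "\<bar>grid_net d R \<alpha> (\<L> m) x - h m\<bar> = \<bar>\<Sum>k\<in>G m. (real_of_int (c m k) / real (M m) - a m k) * neuron d R \<alpha> (grid_weight (N m) k) x\<bar>"
        unfolding \<L>_def grid_net.simps sl h_def by (simp add: sum_subtractf left_diff_distrib)
      also have "\<dots> \<le> (\<Sum>k\<in>G m. 1 / real (M m) * B)"
        unfolding sum_subtractf[symmetric]
        by (intro order_trans[OF sum_abs] sum_mono) (simp only: abs_mult, intro mult_mono c nB, auto)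
      also have "\<dots> = B * (real (card (G m)) / real (M m))" by simp
      also have "\<dots> \<le> B * (1 / real (N m))"
      proof (intro mult_left_mono B0)
        have "real (card (G m)) * real (N m) \<le> real (M m)" "0 < real (M m)" by (simp_all add: M_def add_pos_nonneg)
        then show "real (card (G m)) / real (M m) \<le> 1 / real (N m)"
          using N(2)[of m] by (simp add: pos_divide_le_eq pos_le_divide_eq)
      qed
      finally show ?thesis by simp
    qed
    have "(\<lambda>m. grid_net d R \<alpha> (\<L> m) x - h m) \<longlonglongrightarrow> 0"
    proof (rule Lim_null_comparison)
      show "\<forall>\<^sub>F m in sequentially. norm (grid_net d R \<alpha> (\<L> m) x - h m) \<le> B * (1 / real (N m))"
        using diff by (intro always_eventually allI)
      show "(\<lambda>m. B * (1 / real (N m))) \<longlonglongrightarrow> 0" using tendsto_mult[OF tendsto_const Nlim, of B] by simp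
    qed
    from tendsto_add[OF this hlim] show ?thesis by simp
  qed
  ultimately show ?thesis by blast
qed

section \<open>Approximation of projection pursuit\<close>

definition bias_weight :: "nat \<Rightarrow> real \<Rightarrow> nat \<Rightarrow> real" where
  "bias_weight d R = (\<lambda>i\<in>{..<Suc d}. if i = d then 1 / R else 0)"

lemma space_borel_vec: "space (borel_vec d) = {x. x \<in> extensional {..<d}}"
  by (auto simp: space_PiM PiE_def)

lemma bias_weight_sphere: "0 < R \<Longrightarrow> bias_weight d R \<in> weight_sphere d R"
  by (simp add: weight_sphere_def space_borel_vec bias_weight_def L2_set_def)

lemma neuron_bias_weight: "0 < R \<Longrightarrow> neuron d R 0 (bias_weight d R) x = 1"
  unfolding neuron_def dot_lift_input by (simp add: dot_def bias_weight_def pos_power_def)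

lemma integral_return_neuron:
  "v \<in> weight_sphere d R \<Longrightarrow> (\<integral>v. neuron d R \<alpha> v x \<partial>return (weight_space d R) v) = neuron d R \<alpha> v x"
  by (rule integral_return) (auto simp: neuron_measurable_weight)

lemma measure_return_sphere:
  "v \<in> weight_sphere d R \<Longrightarrow> measure (return (weight_space d R) v) (weight_sphere d R) = 1"
  using sets.top[of "weight_space d R"] by (subst measure_return) auto

lemma finite_measure_return_weight:
  "v \<in> weight_sphere d R \<Longrightarrow> finite_measure (return (weight_space d R) v)"
  using prob_space_return[of v "weight_space d R"] by (auto simp: prob_space_def)

text \<open>For u = w^T x, the difference F u - F (- b) is the integral of the indicator of t < u
  against dF over (- b, b]. That indicator is a threshold neuron with weights proportional to (w, -
  t / R), so dF is pushed forward to the sphere along the normalized weights.\<close>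

lemma stieltjes_threshold_representation:
  fixes F :: "real \<Rightarrow> real" and w :: "nat \<Rightarrow> real" and d :: nat
  assumes R: "0 < R" and mono: "\<And>s t. s \<le> t \<Longrightarrow> F s \<le> F t" and cont: "continuous_on UNIV F"
  defines "b \<equiv> L2_set w {..<d} * R"
  shows "\<exists>\<kappa>. finite_measure \<kappa> \<and> sets \<kappa> = sets (weight_space d R) \<and> measure \<kappa> (weight_sphere d R) \<le> F b - F (- b)
    \<and> (\<forall>x\<in>input_ball d R. (\<integral>v. neuron d R 0 v x \<partial>\<kappa>) = F (dot d w x) - F (- b))"
proof (cases "L2_set w {..<d} = 0")
  case True
  \<comment> \<open>For zero weights the ridge function is constant and b = 0. Treating them apart
    keeps the normalizer \<open>r\<close> positive below.\<close>
  then have "dot d w x = 0" for x by (simp add: L2_set_eq_0_iff dot_def)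
  moreover have "finite_measure (null_measure (weight_space d R))"
    by (rule finite_measureI) simp
  moreover have "(\<integral>v. g v \<partial>null_measure M) = 0" for g :: "_ \<Rightarrow> real" and M :: "(nat \<Rightarrow> real) measure"
    by (rule integral_eq_zero_AE, rule AE_I'[of "space M"]) (auto simp: null_sets_def)
  ultimately show ?thesis
    using True by (intro exI[of _ "null_measure (weight_space d R)"]) (simp add: b_def measure_def)
next
  case False
  define \<omega> where "\<omega> = L2_set w {..<d}"
  have \<omega>: "0 < \<omega>" using False L2_set_nonneg[of w "{..<d}"] unfolding \<omega>_def by linarith
  have b0: "0 \<le> b" using \<omega> R by (simp add: b_def \<omega>_def[symmetric])
  define r where "r t = sqrt (\<omega>\<^sup>2 + (t / R)\<^sup>2)" for t
  have r: "0 < r t" for t using \<omega> by (simp add: r_def add_pos_nonneg)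
  define V where "V t = (\<lambda>i\<in>{..<Suc d}. (if i < d then w i else - t / R) * (1 / (R * r t)))" for t
  have V_sphere: "V t \<in> weight_sphere d R" for t
  proof -
    have "L2_set (V t) {..<Suc d} = L2_set (\<lambda>i. (if i < d then w i else - t / R) * (1 / (R * r t))) {..<Suc d}"
      by (rule L2_set_cong) (auto simp: V_def)
    also have "\<dots> = L2_set (\<lambda>i. if i < d then w i else - t / R) {..<Suc d} * (1 / (R * r t))"
      using R r[of t] by (intro L2_set_left_distrib[symmetric]) simp
    also have "L2_set (\<lambda>i. if i < d then w i else - t / R) {..<Suc d} = r t"
      by (simp add: L2_set_def r_def \<omega>_def sum_nonneg power_divide)
    also have "r t * (1 / (R * r t)) = 1 / R" using r[of t] by simp
    finally have "L2_set (V t) {..<Suc d} = 1 / R" .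
    moreover have "V t \<in> space (borel_vec (Suc d))" by (simp add: space_borel_vec V_def)
    ultimately show ?thesis unfolding weight_sphere_def by blast
  qed
  have V_meas: "V \<in> measurable borel (weight_space d R)"
    unfolding weight_space_def
  proof (rule measurable_restrict_space2)
    show "V \<in> space borel \<rightarrow> weight_sphere d R" using V_sphere by auto
    show "V \<in> measurable borel (borel_vec (Suc d))"
      unfolding V_def[abs_def] r_def[abs_def]
      by (intro measurable_restrict) measurable
  qed
  let ?N = "interval_measure F"
  define \<kappa>0 where "\<kappa>0 = density ?N (indicator {-b<..b})"
  define \<kappa> where "\<kappa> = distr \<kappa>0 (weight_space d R) V"
  have contF: "continuous (at t) F" for t
    using cont by (simp add: continuous_on_eq_continuous_at)
  have Ioc: "emeasure ?N {s<..t} = ennreal (F t - F s)" if "s \<le> t" for s t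
    using that mono contF by (intro emeasure_interval_measure_Ioc) (auto intro: continuous_at_imp_continuous_at_within)
  have single: "emeasure ?N {t} = 0" for t
    using emeasure_interval_measure_Icc[of t t F] mono cont by simp
  \<comment> \<open>Neurons are strict thresholds, so the mass of an open interval is wanted;
    continuity of \<open>F\<close> excludes atoms.\<close>
  have Ioo: "emeasure ?N {s<..<t} = ennreal (F t - F s)" if "s \<le> t" for s t
  proof (cases "s < t")
    case True
    then have "{s<..t} = {s<..<t} \<union> {t}" by auto
    moreover have "emeasure ?N ({s<..<t} \<union> {t}) = emeasure ?N {s<..<t} + emeasure ?N {t}"
      by (intro plus_emeasure[symmetric]) auto
    ultimately show ?thesis using Ioc[OF that] single[of t] by simp
  next
    case False
    then show ?thesis using that by simp
  qed
  have e\<kappa>0: "emeasure \<kappa>0 A = emeasure ?N ({-b<..b} \<inter> A)" if "A \<in> sets borel" for A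
    unfolding \<kappa>0_def using that by (intro emeasure_restricted) auto
  have sets\<kappa>0 [measurable_cong]: "sets \<kappa>0 = sets borel" and space\<kappa>0: "space \<kappa>0 = UNIV"
    by (simp_all add: \<kappa>0_def)
  have total: "emeasure \<kappa>0 UNIV = ennreal (F b - F (- b))"
    using e\<kappa>0[of UNIV] Ioc[of "-b" b] b0 by simp
  interpret \<kappa>0: finite_measure \<kappa>0
    by (rule finite_measureI) (simp add: space\<kappa>0 total)
  have V_meas0: "V \<in> measurable \<kappa>0 (weight_space d R)"
    using V_meas sets\<kappa>0 measurable_cong_sets by blast
  have fin: "finite_measure \<kappa>" unfolding \<kappa>_def by (rule \<kappa>0.finite_measure_distr[OF V_meas0])
  have "measure \<kappa> (weight_sphere d R) = measure \<kappa>0 (V -` weight_sphere d R \<inter> space \<kappa>0)"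
    unfolding \<kappa>_def using sets.top[of "weight_space d R"] by (intro measure_distr V_meas0) simp
  also have "V -` weight_sphere d R \<inter> space \<kappa>0 = UNIV" using V_sphere by (auto simp: space\<kappa>0)
  also have "measure \<kappa>0 UNIV = F b - F (- b)"
    using total mono[of "-b" b] b0 by (simp add: measure_def)
  finally have mass: "measure \<kappa> (weight_sphere d R) \<le> F b - F (- b)" by simp
  have "(\<integral>v. neuron d R 0 v x \<partial>\<kappa>) = F (dot d w x) - F (- b)" if x: "x \<in> input_ball d R" for x
  proof -
    define u where "u = dot d w x"
    have "\<bar>u\<bar> \<le> \<omega> * L2_set x {..<d}" unfolding u_def \<omega>_def by (rule abs_dot_le)
    also have "\<dots> \<le> \<omega> * R" using x \<omega> by (intro mult_left_mono) (auto simp: input_ball_def)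
    finally have u: "- b \<le> u" "u \<le> b" by (auto simp: b_def \<omega>_def abs_le_iff)
    have nV: "neuron d R 0 (V t) x = indicator {..<u} t" for t
    proof -
      have "dot (Suc d) (V t) (lift_input d R x) = (u - t) * (1 / (R * r t))"
        unfolding dot_lift_input using R r[of t]
        by (simp add: V_def dot_def u_def sum_divide_distrib[symmetric] diff_divide_distrib)
      moreover have "0 < 1 / (R * r t)" using R r[of t] by simp
      ultimately have "0 < dot (Suc d) (V t) (lift_input d R x) \<longleftrightarrow> t < u"
        by (simp only: zero_less_mult_iff) auto
      then show ?thesis by (simp add: neuron_def pos_power_def)
    qed
    have "(\<integral>v. neuron d R 0 v x \<partial>\<kappa>) = (\<integral>t. neuron d R 0 (V t) x \<partial>\<kappa>0)"
      unfolding \<kappa>_def by (rule integral_distr[OF V_meas0 neuron_measurable_weight])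
    also have "\<dots> = measure \<kappa>0 {..<u}" unfolding nV by (simp add: space\<kappa>0)
    also have "emeasure \<kappa>0 {..<u} = emeasure ?N {-b<..<u}"
    proof -
      have "{-b<..b} \<inter> {..<u} = {-b<..<u}" using u by auto
      then show ?thesis using e\<kappa>0[of "{..<u}"] by simp
    qed
    then have "measure \<kappa>0 {..<u} = F u - F (- b)"
      using Ioo[OF u(1)] mono[OF u(1)] by (simp add: measure_def)
    finally show ?thesis by (simp add: u_def)
  qed
  then show ?thesis using fin mass by (intro exI[of _ \<kappa>]) (simp add: \<kappa>_def)
qed

text \<open>Each ridge function is its value at - b plus the increments of (t + f t) / 2 minus those
  of (t - f t) / 2. The constant costs at most \<eta> R, and the two Stieltjes measures together
  weigh at most 2 b \<le> 2 \<eta> R; hence the 3.\<close>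

lemma projection_pursuit_in_F1_ball:
  assumes params: "projection_pursuit_params d k R \<eta> w f" and R: "0 < R" and \<eta>: "0 < \<eta>"
  shows "restrict (projection_pursuit d k w f) (input_ball d R) \<in> F1_ball d R 0 (3 * real k * R * \<eta>)"
proof -
  define b where "b j = L2_set (w j) {..<d} * R" for j
  have lip: "\<bar>f j s - f j t\<bar> \<le> \<bar>s - t\<bar>" if "j < k" for j s t
    using params that by (auto simp: projection_pursuit_params_def lipschitz_on_def dist_real_def)
  have bnd: "\<bar>f j t\<bar> \<le> \<eta> * R" if "j < k" for j t
    using params that by (auto simp: projection_pursuit_params_def)
  have b: "0 \<le> b j" "b j \<le> \<eta> * R" if "j < k" for j
    using params that R by (auto simp: projection_pursuit_params_def b_def)
  have cont: "continuous_on UNIV (f j)" if "j < k" for j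
    using params that by (auto simp: projection_pursuit_params_def intro: lipschitz_on_continuous_on)
  define P where "P j s \<kappa> \<longleftrightarrow> finite_measure \<kappa> \<and> sets \<kappa> = sets (weight_space d R) \<and>
      measure \<kappa> (weight_sphere d R) \<le> (b j + s * f j (b j)) / 2 - (- b j + s * f j (- b j)) / 2 \<and>
      (\<forall>x\<in>input_ball d R. (\<integral>v. neuron d R 0 v x \<partial>\<kappa>) =
        (dot d (w j) x + s * f j (dot d (w j) x)) / 2 - (- b j + s * f j (- b j)) / 2)" for j s \<kappa>
  have ex: "\<exists>\<kappa>. P j s \<kappa>" if "j < k" "s = 1 \<or> s = -1" for j s
    unfolding P_def b_def
  proof (rule stieltjes_threshold_representation[OF R, where F = "\<lambda>t. (t + s * f j t) / 2"])
    fix t t' :: real assume "t \<le> t'"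
    then show "(t + s * f j t) / 2 \<le> (t' + s * f j t') / 2"
      using lip[OF that(1), of t t'] that(2) by (auto simp: abs_le_iff)
  qed (intro continuous_intros cont that; simp)
  define \<kappa> where "\<kappa> j s = (SOME \<kappa>. P j s \<kappa>)" for j s
  have \<kappa>: "P j s (\<kappa> j s)" if "j < k" "s = 1 \<or> s = -1" for j s
    unfolding \<kappa>_def using ex[OF that] by (rule someI_ex)
  let ?ret = "return (weight_space d R) (bias_weight d R)"
  \<comment> \<open>The index 0 stands for the constant, carried by a point mass at the bias neuron;
    1 and -1 stand for the two monotone parts and are also their coefficients.\<close>
  define S where "S = {0, 1, -1 :: real}"
  define I where "I = {..<k} \<times> S"
  define \<mu> where "\<mu> = (\<lambda>(j, s). if s = 0 then ?ret else \<kappa> j s)"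
  define c where "c = (\<lambda>(j, s). if s = 0 then f j (- b j) else s)"
  have sumI: "(\<Sum>p\<in>I. g p) = (\<Sum>j<k. g (j, 0) + (g (j, 1) + g (j, -1)))" for g :: "nat \<times> real \<Rightarrow> real"
  proof -
    have "(\<Sum>p\<in>I. g p) = (\<Sum>j<k. \<Sum>s\<in>S. g (j, s))"
      unfolding I_def by (simp add: sum.cartesian_product)
    then show ?thesis by (simp add: S_def)
  qed
  have "restrict (\<lambda>x. \<Sum>p\<in>I. c p * (\<integral>v. neuron d R 0 v x \<partial>\<mu> p)) (input_ball d R) \<in> F1_ball d R 0 (3 * real k * R * \<eta>)"
  proof (rule F1_ball_combination[OF _ R])
    show "finite I" by (simp add: I_def S_def)
    show "finite_measure (\<mu> p)" if "p \<in> I" for p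
      using that \<kappa>[unfolded P_def] finite_measure_return_weight[OF bias_weight_sphere[OF R]] by (auto simp: I_def S_def \<mu>_def)
    show "sets (\<mu> p) = sets (weight_space d R)" if "p \<in> I" for p
      using that \<kappa>[unfolded P_def] by (auto simp: I_def S_def \<mu>_def)
    have "(\<Sum>p\<in>I. \<bar>c p\<bar> * measure (\<mu> p) (weight_sphere d R)) \<le> (\<Sum>j<k. 3 * (\<eta> * R))"
      unfolding sumI
    proof (rule sum_mono)
      fix j assume j: "j \<in> {..<k}"
      have "measure (\<kappa> j 1) (weight_sphere d R) + measure (\<kappa> j (-1)) (weight_sphere d R) \<le> 2 * b j"
        using \<kappa>[of j 1] \<kappa>[of j "-1"] j by (auto simp: P_def field_simps)
      then show "\<bar>c (j, 0)\<bar> * measure (\<mu> (j, 0)) (weight_sphere d R) + (\<bar>c (j, 1)\<bar> * measure (\<mu> (j, 1)) (weight_sphere d R) +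
          \<bar>c (j, -1)\<bar> * measure (\<mu> (j, -1)) (weight_sphere d R)) \<le> 3 * (\<eta> * R)"
        using bnd[of j "- b j"] b[of j] j measure_return_sphere[OF bias_weight_sphere[OF R, of d]]
        by (simp add: c_def \<mu>_def)
    qed
    then show "(\<Sum>p\<in>I. \<bar>c p\<bar> * measure (\<mu> p) (weight_sphere d R)) \<le> 3 * real k * R * \<eta>"
      by (simp add: mult_ac)
  qed
  also have "restrict (\<lambda>x. \<Sum>p\<in>I. c p * (\<integral>v. neuron d R 0 v x \<partial>\<mu> p)) (input_ball d R) =
     restrict (projection_pursuit d k w f) (input_ball d R)"
  proof (rule restrict_ext)
    fix x assume x: "x \<in> input_ball d R"
    show "(\<Sum>p\<in>I. c p * (\<integral>v. neuron d R 0 v x \<partial>\<mu> p)) = projection_pursuit d k w f x"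
      unfolding sumI projection_pursuit_def
    proof (rule sum.cong[OF refl])
      fix j assume j: "j \<in> {..<k}"
      show "c (j, 0) * (\<integral>v. neuron d R 0 v x \<partial>\<mu> (j, 0)) + (c (j, 1) * (\<integral>v. neuron d R 0 v x \<partial>\<mu> (j, 1)) +
          c (j, -1) * (\<integral>v. neuron d R 0 v x \<partial>\<mu> (j, -1))) = f j (dot d (w j) x)"
      proof -
        have "(\<integral>v. neuron d R 0 v x \<partial>\<kappa> j s) =
            (dot d (w j) x + s * f j (dot d (w j) x)) / 2 - (- b j + s * f j (- b j)) / 2" if "s = 1 \<or> s = -1" for s
          using \<kappa>[of j s] that j x by (simp add: P_def)
        then show ?thesis
          by (simp add: c_def \<mu>_def integral_return_neuron[OF bias_weight_sphere[OF R]] neuron_bias_weight[OF R])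
             (simp add: field_simps)
      qed
    qed
  qed
  finally show ?thesis .
qed

section \<open>Approximation by truncated powers\<close>

lemma pos_power_scale: "0 < r \<Longrightarrow> pos_power \<alpha> (r * u) = r ^ \<alpha> * pos_power \<alpha> u"
  by (simp add: pos_power_def zero_less_mult_iff power_mult_distrib)

text \<open>Positive homogeneity of degree \<alpha>. A zero weight has no direction, but then the
  factor is 0 since \<alpha> \<ge> 1, and any point of the sphere serves.\<close>

lemma neuron_normalize:
  assumes R: "0 < R" and \<alpha>: "1 \<le> \<alpha>"
  shows "\<exists>u\<in>weight_sphere d R. \<forall>x. neuron d R \<alpha> v x = (L2_set v {..<Suc d} * R) ^ \<alpha> * neuron d R \<alpha> u x"
proof (cases "L2_set v {..<Suc d} = 0")
  case True
  then have "v i = 0" if "i < Suc d" for i using that by (simp add: L2_set_eq_0_iff)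
  then have "neuron d R \<alpha> v x = 0" for x by (simp add: neuron_def dot_def pos_power_def)
  then show ?thesis
    using True \<alpha> bias_weight_sphere[OF R, of d] by (intro bexI[of _ "bias_weight d R"]) auto
next
  case False
  define N where "N = L2_set v {..<Suc d}"
  have N: "0 < N" using False L2_set_nonneg[of v "{..<Suc d}"] unfolding N_def by linarith
  define u where "u = (\<lambda>i\<in>{..<Suc d}. v i * (1 / (N * R)))"
  have "L2_set u {..<Suc d} = L2_set (\<lambda>i. v i * (1 / (N * R))) {..<Suc d}"
    by (rule L2_set_cong) (auto simp: u_def)
  also have "\<dots> = N * (1 / (N * R))"
    unfolding N_def[symmetric] using N R unfolding N_def by (intro L2_set_left_distrib[symmetric]) simp
  also have "\<dots> = 1 / R" using N by simp
  finally have "u \<in> weight_sphere d R" by (simp add: weight_sphere_def space_borel_vec u_def)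
  moreover have "neuron d R \<alpha> v x = (N * R) ^ \<alpha> * neuron d R \<alpha> u x" for x
  proof -
    have "dot (Suc d) v (lift_input d R x) = (N * R) * dot (Suc d) u (lift_input d R x)"
      unfolding dot_def sum_distrib_left using N R by (intro sum.cong) (auto simp: u_def)
    then show ?thesis unfolding neuron_def using N R by (simp add: pos_power_scale)
  qed
  ultimately show ?thesis unfolding N_def by blast
qed

lemma L2_set_Suc_le: "L2_set v {..<Suc d} \<le> \<bar>v d\<bar> + L2_set v {..<d}"
proof -
  have "L2_set v {..<Suc d} = sqrt ((v d)\<^sup>2 + (L2_set v {..<d})\<^sup>2)"
    by (simp add: lessThan_Suc)
  also have "\<dots> \<le> \<bar>v d\<bar> + \<bar>L2_set v {..<d}\<bar>" by (rule sqrt_sum_squares_le_sum_abs)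
  finally show ?thesis by simp
qed

text \<open>A truncated power with knot \<open>s\<close> of the rescaled ridge is the neuron with
  weight (w / (\<eta> R), - s / R). Its norm is at most (1 + |s|) / R, so moving it to the sphere
  costs at most the factor (S + 1)^\<alpha>.\<close>

lemma ridge_combination_in_F1_ball:
  fixes xs :: "nat \<Rightarrow> (real \<times> real) list"
  assumes R: "0 < R" and \<eta>: "0 < \<eta>" and \<alpha>: "1 \<le> \<alpha>"
    and w: "\<And>j. j < k \<Longrightarrow> L2_set (w j) {..<d} \<le> \<eta>"
    and s: "\<And>j c s. j < k \<Longrightarrow> (c, s) \<in> set (xs j) \<Longrightarrow> \<bar>s\<bar> \<le> S"
    and c: "\<And>j. j < k \<Longrightarrow> (\<Sum>(c, s)\<leftarrow>xs j. \<bar>c\<bar>) \<le> B"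
    and \<delta>: "real k * (\<eta> * R) * B * (S + 1) ^ \<alpha> \<le> \<delta>" and S: "0 \<le> S"
  shows "restrict (\<lambda>x. \<Sum>j<k. \<eta> * R * (\<Sum>(c, s)\<leftarrow>xs j. c * pos_power \<alpha> (dot d (w j) x / (\<eta> * R) - s))) (input_ball d R)
    \<in> F1_ball d R \<alpha> \<delta>"
proof -
  define v where "v j s = (\<lambda>i. if i < d then w j i * (1 / (\<eta> * R)) else - s / R)" for j s
  define N where "N j s = L2_set (v j s) {..<Suc d}" for j s
  have Nle: "N j s * R \<le> S + 1" if "j < k" "\<bar>s\<bar> \<le> S" for j s
  proof -
    have "N j s \<le> \<bar>v j s d\<bar> + L2_set (v j s) {..<d}" unfolding N_def by (rule L2_set_Suc_le)
    also have "L2_set (v j s) {..<d} = L2_set (\<lambda>i. w j i * (1 / (\<eta> * R))) {..<d}"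
      by (rule L2_set_cong) (auto simp: v_def)
    also have "\<dots> = L2_set (w j) {..<d} * (1 / (\<eta> * R))"
      using R \<eta> by (intro L2_set_left_distrib[symmetric]) simp
    also have "\<dots> \<le> \<eta> * (1 / (\<eta> * R))" using w[OF that(1)] R \<eta> by (intro mult_right_mono) auto
    also have "\<dots> = 1 / R" using \<eta> by simp
    also have "\<bar>v j s d\<bar> + 1 / R = (\<bar>s\<bar> + 1) / R" using R by (simp add: v_def add_divide_distrib)
    finally have "N j s * R \<le> \<bar>s\<bar> + 1" using R by (simp add: le_divide_eq)
    then show ?thesis using that(2) by simp
  qed
  have N0: "0 \<le> N j s" for j s by (simp add: N_def)
  obtain u where u: "\<And>j s. u j s \<in> weight_sphere d R"
    "\<And>j s x. neuron d R \<alpha> (v j s) x = (N j s * R) ^ \<alpha> * neuron d R \<alpha> (u j s) x"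
    using neuron_normalize[OF R \<alpha>, of d "v _ _"] unfolding N_def by metis
  have ridge: "pos_power \<alpha> (dot d (w j) x / (\<eta> * R) - s) = (N j s * R) ^ \<alpha> * neuron d R \<alpha> (u j s) x" for j s x
  proof -
    have "dot (Suc d) (v j s) (lift_input d R x) = dot d (w j) x / (\<eta> * R) - s"
      unfolding dot_lift_input using R by (simp add: v_def dot_def sum_divide_distrib)
    then show ?thesis using u(2)[of j s x] by (simp add: neuron_def)
  qed
  define I where "I = Sigma {..<k} (\<lambda>j. {..<length (xs j)})"
  define \<mu> where "\<mu> = (\<lambda>(j, i). return (weight_space d R) (u j (snd (xs j ! i))))"
  define e where "e = (\<lambda>(j, i). \<eta> * R * (fst (xs j ! i) * (N j (snd (xs j ! i)) * R) ^ \<alpha>))"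
  have sumI: "(\<Sum>p\<in>I. g p) = (\<Sum>j<k. \<Sum>i<length (xs j). g (j, i))" for g :: "nat \<times> nat \<Rightarrow> real"
    unfolding I_def by (subst sum.Sigma) auto
  have suml: "(\<Sum>(c, s)\<leftarrow>xs j. g c s) = (\<Sum>i<length (xs j). g (fst (xs j ! i)) (snd (xs j ! i)))" for j and g :: "real \<Rightarrow> real \<Rightarrow> real"
    by (simp add: sum_list_sum_nth case_prod_beta' atLeast0LessThan)
  have "restrict (\<lambda>x. \<Sum>p\<in>I. e p * (\<integral>v. neuron d R \<alpha> v x \<partial>\<mu> p)) (input_ball d R) \<in> F1_ball d R \<alpha> \<delta>"
  proof (rule F1_ball_combination[OF _ R])
    show "finite I" by (simp add: I_def)
    show "finite_measure (\<mu> p)" if "p \<in> I" for p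
      using finite_measure_return_weight[OF u(1)] by (simp add: \<mu>_def split: prod.split)
    show "sets (\<mu> p) = sets (weight_space d R)" if "p \<in> I" for p by (simp add: \<mu>_def split: prod.split)
    have "(\<Sum>p\<in>I. \<bar>e p\<bar> * measure (\<mu> p) (weight_sphere d R)) = (\<Sum>j<k. \<Sum>i<length (xs j). \<bar>e (j, i)\<bar>)"
      unfolding sumI by (simp add: \<mu>_def measure_return_sphere[OF u(1)])
    also have "\<dots> \<le> (\<Sum>j<k. \<eta> * R * (B * (S + 1) ^ \<alpha>))"
    proof (rule sum_mono)
      fix j assume j: "j \<in> {..<k}"
      have "(\<Sum>i<length (xs j). \<bar>e (j, i)\<bar>) \<le> (\<Sum>i<length (xs j). \<eta> * R * (\<bar>fst (xs j ! i)\<bar> * (S + 1) ^ \<alpha>))"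
      proof (rule sum_mono)
        fix i assume i: "i \<in> {..<length (xs j)}"
        have "\<bar>snd (xs j ! i)\<bar> \<le> S" using s[of j "fst (xs j ! i)" "snd (xs j ! i)"] i j by simp
        then have "(N j (snd (xs j ! i)) * R) ^ \<alpha> \<le> (S + 1) ^ \<alpha>"
          using Nle[of j] j N0 R by (intro power_mono) auto
        then have "\<bar>fst (xs j ! i)\<bar> * (N j (snd (xs j ! i)) * R) ^ \<alpha> \<le> \<bar>fst (xs j ! i)\<bar> * (S + 1) ^ \<alpha>"
          by (intro mult_left_mono) auto
        then show "\<bar>e (j, i)\<bar> \<le> \<eta> * R * (\<bar>fst (xs j ! i)\<bar> * (S + 1) ^ \<alpha>)"
          using N0 R \<eta> by (simp add: e_def abs_mult power_abs)
      qed
      also have "\<dots> = \<eta> * R * ((\<Sum>(c, s)\<leftarrow>xs j. \<bar>c\<bar>) * (S + 1) ^ \<alpha>)"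
        unfolding suml by (simp add: sum_distrib_left sum_distrib_right)
      also have "\<dots> \<le> \<eta> * R * (B * (S + 1) ^ \<alpha>)"
        using c[of j] j R \<eta> S by (intro mult_left_mono mult_right_mono) auto
      finally show "(\<Sum>i<length (xs j). \<bar>e (j, i)\<bar>) \<le> \<eta> * R * (B * (S + 1) ^ \<alpha>)" .
    qed
    also have "\<dots> = real k * (\<eta> * R) * B * (S + 1) ^ \<alpha>" by simp
    finally show "(\<Sum>p\<in>I. \<bar>e p\<bar> * measure (\<mu> p) (weight_sphere d R)) \<le> \<delta>" using \<delta> by linarith
  qed
  also have "(\<lambda>x. \<Sum>p\<in>I. e p * (\<integral>v. neuron d R \<alpha> v x \<partial>\<mu> p)) =
    (\<lambda>x. \<Sum>j<k. \<eta> * R * (\<Sum>(c, s)\<leftarrow>xs j. c * pos_power \<alpha> (dot d (w j) x / (\<eta> * R) - s)))"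
    unfolding sumI suml ridge sum_distrib_left
    by (simp add: \<mu>_def e_def integral_return_neuron[OF u(1)] mult.assoc)
  finally show ?thesis .
qed

lemma projection_pursuit_abs_le:
  assumes "projection_pursuit_params d k R \<eta> w f"
  shows "\<bar>projection_pursuit d k w f x\<bar> \<le> real k * (\<eta> * R)"
proof -
  have "\<bar>projection_pursuit d k w f x\<bar> \<le> (\<Sum>j<k. \<bar>f j (dot d (w j) x)\<bar>)"
    unfolding projection_pursuit_def by (rule sum_abs)
  also have "\<dots> \<le> (\<Sum>j<k. \<eta> * R)"
    using assms by (intro sum_mono) (auto simp: projection_pursuit_params_def)
  finally show ?thesis by simp
qed

text \<open>Rescaling by \<eta> R turns every component into a function with bound and Lipschitz
  constant 1. The spline estimate then applies with a knot distance chosen so that the cost stays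
  within the given radius.\<close>

lemma projection_pursuit_approximation:
  assumes \<alpha>: "1 \<le> \<alpha>"
  shows "\<exists>C\<ge>0. \<forall>d k n R \<eta> w f. 1 \<le> n \<longrightarrow> 0 < R \<longrightarrow> 0 < \<eta> \<longrightarrow> projection_pursuit_params d k R \<eta> w f \<longrightarrow>
    (\<exists>g\<in>F1_ball d R \<alpha> (real k * \<eta> * R * real n powr (real \<alpha> / (2 * (real \<alpha> + 1)))).
      \<forall>x\<in>input_ball d R. \<bar>g x - projection_pursuit d k w f x\<bar> \<le> C * (real k * (\<eta> * R)) * real n powr (- 1 / (2 * real \<alpha> + 2)))"
proof -
  define K where "K = 2 ^ Suc \<alpha> * real (\<alpha> + 4) ^ (\<alpha> + 2)"
  define K' where "K' = K * (real \<alpha> + 2 + 1) ^ \<alpha>"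
  have K: "1 \<le> K"
  proof -
    have "1 * 1 \<le> (2::real) ^ Suc \<alpha> * real (\<alpha> + 4) ^ (\<alpha> + 2)"
      by (intro mult_mono one_le_power) auto
    then show ?thesis by (simp add: K_def)
  qed
  have K': "1 \<le> K'"
  proof -
    have "1 * 1 \<le> K * (real \<alpha> + 2 + 1) ^ \<alpha>" using K by (intro mult_mono one_le_power) auto
    then show ?thesis by (simp add: K'_def)
  qed
  have main: "\<exists>g\<in>F1_ball d R \<alpha> (real k * \<eta> * R * real n powr (real \<alpha> / (2 * (real \<alpha> + 1)))).
      \<forall>x\<in>input_ball d R. \<bar>g x - projection_pursuit d k w f x\<bar> \<le> (K * K') * (real k * (\<eta> * R)) * real n powr (- 1 / (2 * real \<alpha> + 2))"
    if n: "1 \<le> n" and R: "0 < R" and \<eta>: "0 < \<eta>" and params: "projection_pursuit_params d k R \<eta> w f"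
    for d k n R \<eta> w f
  proof -
    \<comment> \<open>The factor \<open>K'\<close> brings the cost K' (1 / e)^\<alpha> below the
      power of \<open>n\<close> in the radius, with no constant left.\<close>
    define e where "e = K' * real n powr (- 1 / (2 * real \<alpha> + 2))"
    define D where "D = real n powr (real \<alpha> / (2 * (real \<alpha> + 1)))"
    have e0: "0 < e" using K' n by (simp add: e_def)
    have \<eta>R: "0 < \<eta> * R" using \<eta> R by simp
    show ?thesis
    proof (cases "e \<le> 1")
      case True
      have lip: "\<bar>f j s - f j t\<bar> \<le> \<bar>s - t\<bar>" if "j < k" for j s t
        using params that by (auto simp: projection_pursuit_params_def lipschitz_on_def dist_real_def)
      have bnd: "\<bar>f j t\<bar> \<le> \<eta> * R" if "j < k" for j t
        using params that by (auto simp: projection_pursuit_params_def)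
      have wb: "L2_set (w j) {..<d} \<le> \<eta>" if "j < k" for j
        using params that by (auto simp: projection_pursuit_params_def)
      define h where "h j t = f j (\<eta> * R * t) / (\<eta> * R)" for j t
      have fh: "f j t = \<eta> * R * h j (t / (\<eta> * R))" for j t using \<eta> R by (simp add: h_def)
      have "\<exists>g. spline_combination \<alpha> (real \<alpha> + 2) (K * (1 / e) ^ \<alpha>) g \<and> (\<forall>t\<in>{-1..1}. \<bar>g t - h j t\<bar> \<le> K * e)"
        if j: "j < k" for j
        unfolding K_def
      proof (rule spline_approximation[OF \<alpha> e0 True])
        fix s t
        have "\<bar>f j (\<eta> * R * s) - f j (\<eta> * R * t)\<bar> \<le> \<bar>\<eta> * R * s - \<eta> * R * t\<bar>" by (rule lip[OF j])
        also have "\<dots> = \<eta> * R * \<bar>s - t\<bar>" 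
          unfolding right_diff_distrib[symmetric] abs_mult[of "\<eta> * R"] using \<eta>R by simp
        finally show "\<bar>h j s - h j t\<bar> \<le> \<bar>s - t\<bar>"
          unfolding h_def diff_divide_distrib[symmetric] abs_divide using \<eta>R by (simp add: divide_le_eq mult.commute)
      next
        fix t show "\<bar>h j t\<bar> \<le> 1" using bnd[OF j, of "\<eta> * R * t"] \<eta>R by (simp add: h_def divide_le_eq)
      qed
      then have "\<exists>xs. j < k \<longrightarrow> (\<forall>(c, s)\<in>set xs. \<bar>s\<bar> \<le> real \<alpha> + 2) \<and> (\<Sum>(c, s)\<leftarrow>xs. \<bar>c\<bar>) \<le> K * (1 / e) ^ \<alpha> \<and>
          (\<forall>t\<in>{-1..1}. \<bar>(\<Sum>(c, s)\<leftarrow>xs. c * pos_power \<alpha> (t - s)) - h j t\<bar> \<le> K * e)" for j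
        unfolding spline_combination_def by blast
      then obtain xs where xs: "\<And>j. j < k \<Longrightarrow> (\<forall>(c, s)\<in>set (xs j). \<bar>s\<bar> \<le> real \<alpha> + 2) \<and> (\<Sum>(c, s)\<leftarrow>xs j. \<bar>c\<bar>) \<le> K * (1 / e) ^ \<alpha> \<and>
          (\<forall>t\<in>{-1..1}. \<bar>(\<Sum>(c, s)\<leftarrow>xs j. c * pos_power \<alpha> (t - s)) - h j t\<bar> \<le> K * e)"
        by metis
      let ?g = "\<lambda>x. \<Sum>j<k. \<eta> * R * (\<Sum>(c, s)\<leftarrow>xs j. c * pos_power \<alpha> (dot d (w j) x / (\<eta> * R) - s))"
      have cost: "K' * (1 / e) ^ \<alpha> \<le> D"
      proof -
        have "(1 / e) ^ \<alpha> = (1 / K') ^ \<alpha> * (real n powr (1 / (2 * real \<alpha> + 2))) ^ \<alpha>"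
          by (simp add: e_def powr_minus_divide power_mult_distrib power_divide)
        also have "(real n powr (1 / (2 * real \<alpha> + 2))) ^ \<alpha> = D"
          unfolding D_def using n by (simp add: powr_power algebra_simps)
        finally have E: "K' * (1 / e) ^ \<alpha> = (K' * (1 / K') ^ \<alpha>) * D" by simp
        have "K' * (1 / K') ^ \<alpha> \<le> 1"
        proof -
          have "K' * (1 / K') ^ \<alpha> \<le> K' * (1 / K') ^ 1"
            using K' \<alpha> by (intro mult_left_mono power_decreasing) auto
          then show ?thesis using K' by simp
        qed
        then have "(K' * (1 / K') ^ \<alpha>) * D \<le> 1 * D" by (rule mult_right_mono) (simp add: D_def)
        then show ?thesis unfolding E by simp
      qed
      have "restrict ?g (input_ball d R) \<in> F1_ball d R \<alpha> (real k * \<eta> * R * D)"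
      proof (rule ridge_combination_in_F1_ball[OF R \<eta> \<alpha> wb, where S = "real \<alpha> + 2" and B = "K * (1 / e) ^ \<alpha>"])
        show "\<bar>s\<bar> \<le> real \<alpha> + 2" if "j < k" "(c, s) \<in> set (xs j)" for j c s using xs that by fast
        show "(\<Sum>(c, s)\<leftarrow>xs j. \<bar>c\<bar>) \<le> K * (1 / e) ^ \<alpha>" if "j < k" for j using xs that by blast
        have "real k * (\<eta> * R) * (K' * (1 / e) ^ \<alpha>) \<le> real k * (\<eta> * R) * D"
          using \<eta>R cost by (intro mult_left_mono) auto
        then show "real k * (\<eta> * R) * (K * (1 / e) ^ \<alpha>) * (real \<alpha> + 2 + 1) ^ \<alpha> \<le> real k * \<eta> * R * D"
          by (simp add: K'_def mult_ac)
      qed simp_all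
      moreover have "\<bar>?g x - projection_pursuit d k w f x\<bar> \<le> (K * K') * (real k * (\<eta> * R)) * real n powr (- 1 / (2 * real \<alpha> + 2))"
        if x: "x \<in> input_ball d R" for x
      proof -
        have "\<bar>?g x - projection_pursuit d k w f x\<bar> =
          \<bar>\<Sum>j<k. \<eta> * R * ((\<Sum>(c, s)\<leftarrow>xs j. c * pos_power \<alpha> (dot d (w j) x / (\<eta> * R) - s)) - h j (dot d (w j) x / (\<eta> * R)))\<bar>"
          unfolding projection_pursuit_def fh right_diff_distrib sum_subtractf by simp
        also have "\<dots> \<le> (\<Sum>j<k. \<eta> * R * (K * e))"
        proof (intro order_trans[OF sum_abs] sum_mono)
          fix j assume j: "j \<in> {..<k}"
          have "\<bar>dot d (w j) x\<bar> \<le> L2_set (w j) {..<d} * L2_set x {..<d}" by (rule abs_dot_le)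
          also have "\<dots> \<le> \<eta> * R" using wb[of j] j x \<eta> by (intro mult_mono) (auto simp: input_ball_def)
          finally have "\<bar>dot d (w j) x / (\<eta> * R)\<bar> \<le> 1" using \<eta>R by (simp add: abs_divide divide_le_eq)
          then have "dot d (w j) x / (\<eta> * R) \<in> {-1..1}" unfolding abs_le_iff atLeastAtMost_iff by linarith
          then have "\<bar>(\<Sum>(c, s)\<leftarrow>xs j. c * pos_power \<alpha> (dot d (w j) x / (\<eta> * R) - s)) - h j (dot d (w j) x / (\<eta> * R))\<bar> \<le> K * e"
            using xs[of j] j by blast
          then show "\<bar>\<eta> * R * ((\<Sum>(c, s)\<leftarrow>xs j. c * pos_power \<alpha> (dot d (w j) x / (\<eta> * R) - s)) - h j (dot d (w j) x / (\<eta> * R)))\<bar> \<le> \<eta> * R * (K * e)"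
            unfolding abs_mult[of "\<eta> * R"] using \<eta>R by (simp add: mult_left_mono)
        qed
        also have "\<dots> = (K * K') * (real k * (\<eta> * R)) * real n powr (- 1 / (2 * real \<alpha> + 2))"
          by (simp add: e_def)
        finally show ?thesis .
      qed
      ultimately show ?thesis unfolding D_def
        by (intro bexI[of _ "restrict ?g (input_ball d R)"]) auto
    next
      case False
      \<comment> \<open>For e > 1 the claimed error exceeds the bound k \<eta> R of the target, so
        the zero function, written as an empty combination, suffices.\<close>
      have "restrict (\<lambda>x. \<Sum>i\<in>({}::nat set). 0 * (\<integral>v. neuron d R \<alpha> v x \<partial>return (weight_space d R) (bias_weight d R))) (input_ball d R)
         \<in> F1_ball d R \<alpha> (real k * \<eta> * R * D)"
        by (rule F1_ball_combination[OF _ R]) (use \<eta> R in \<open>auto simp: D_def\<close>)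
      moreover have "\<bar>0 - projection_pursuit d k w f x\<bar> \<le> (K * K') * (real k * (\<eta> * R)) * real n powr (- 1 / (2 * real \<alpha> + 2))" for x
      proof -
        have "\<bar>0 - projection_pursuit d k w f x\<bar> \<le> real k * (\<eta> * R)" using projection_pursuit_abs_le[OF params, of x] by simp
        also have "\<dots> \<le> real k * (\<eta> * R) * (K * e)"
          using mult_left_mono[of 1 "K * e" "real k * (\<eta> * R)"] mult_mono[of 1 K 1 e] \<eta>R K False by simp
        also have "\<dots> = (K * K') * (real k * (\<eta> * R)) * real n powr (- 1 / (2 * real \<alpha> + 2))"
          by (simp add: e_def)
        finally show ?thesis .
      qed
      ultimately show ?thesis unfolding D_def
        by (intro bexI[of _ "restrict (\<lambda>x. \<Sum>i\<in>({}::nat set). 0 * (\<integral>v. neuron d R \<alpha> v x \<partial>return (weight_space d R) (bias_weight d R))) (input_ball d R)"]) auto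
    qed
  qed
  show ?thesis by (rule exI[of _ "K * K'"]) (use main K K' in auto)
qed

section \<open>Rademacher averages of neurons\<close>

lemma input_ball_measurable: "input_ball d R \<in> sets (borel_vec d)"
proof -
  have "(\<lambda>x. x i) \<in> borel_measurable (borel_vec d)" if "i \<in> {..<d}" for i
    using that by (rule measurable_component_singleton)
  then have "(\<lambda>x. L2_set x {..<d}) \<in> borel_measurable (borel_vec d)"
    unfolding L2_set_def
    by (intro measurable_compose[OF _ borel_measurable_sqrt] borel_measurable_sum borel_measurable_power)
  then show ?thesis unfolding input_ball_def by measurable
qed

text \<open>Zero off the ball, so that the Rademacher bounds hold for every sample and not only
  almost surely.\<close>

definition masked_neuron :: "nat \<Rightarrow> real \<Rightarrow> nat \<Rightarrow> (nat \<Rightarrow> real) \<Rightarrow> (nat \<Rightarrow> real) \<Rightarrow> real" where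
  "masked_neuron d R \<alpha> v x = (if x \<in> input_ball d R then neuron d R \<alpha> v x else 0)"

lemma rademacher_threshold_neurons:
  assumes n: "0 < n" and V: "finite V" "V \<noteq> {}"
  shows "sign_avg n (\<lambda>\<sigma>. Max ((\<lambda>v. \<bar>\<Sum>i<n. \<sigma> i * masked_neuron d R 0 v (s i)\<bar>) ` V))
    \<le> 26 * sqrt (real n * real (Suc d))"
proof -
  let ?F = "range (\<lambda>v. {z. 0 < dot (Suc d) v z})"
  \<comment> \<open>A point off the ball is replaced by 0, which lies in no open halfspace whose
    boundary passes through the origin.\<close>
  define z where "z i = (if s i \<in> input_ball d R then lift_input d R (s i) else (\<lambda>_. 0))" for i
  define S where "S v = {i\<in>{..<n}. z i \<in> {z. 0 < dot (Suc d) v z}}" for v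
  have S: "S v \<in> trace_sets z {..<n} ?F" for v unfolding S_def trace_sets_def by blast
  have "trace_sets z {..<n} ?F \<subseteq> Pow {..<n}" by (auto simp: trace_sets_def)
  then have fin: "finite (trace_sets z {..<n} ?F)" by (rule finite_subset) simp
  have "(\<Sum>i<n. \<sigma> i * masked_neuron d R 0 v (s i)) = (\<Sum>i<n. \<sigma> i * indicator (S v) i)" for \<sigma> v
    by (intro sum.cong refl) (auto simp: S_def z_def masked_neuron_def neuron_def pos_power_def dot_def)
  then have "Max ((\<lambda>v. \<bar>\<Sum>i<n. \<sigma> i * masked_neuron d R 0 v (s i)\<bar>) ` V)
      \<le> Max ((\<lambda>S. \<bar>\<Sum>i<n. \<sigma> i * indicator S i\<bar>) ` trace_sets z {..<n} ?F)" for \<sigma>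
    using V fin S by (intro Max.boundedI) (auto intro!: Max_ge)
  then have "sign_avg n (\<lambda>\<sigma>. Max ((\<lambda>v. \<bar>\<Sum>i<n. \<sigma> i * masked_neuron d R 0 v (s i)\<bar>) ` V))
    \<le> sign_avg n (\<lambda>\<sigma>. Max ((\<lambda>S. \<bar>\<Sum>i<n. \<sigma> i * indicator S i\<bar>) ` trace_sets z {..<n} ?F))"
    by (intro sign_avg_mono)
  also have "\<dots> \<le> 26 * sqrt (real n * real (Suc d))"
    by (rule rademacher_vc[OF vc_halfspaces _ n]) auto
  finally show ?thesis .
qed

lemma abs_power_diff_le:
  fixes x y :: real
  assumes "0 \<le> x" "x \<le> 3" "0 \<le> y" "y \<le> 3"
  shows "\<bar>x ^ m - y ^ m\<bar> \<le> real m * 3 ^ m * \<bar>x - y\<bar>"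
proof (induction m)
  case (Suc m)
  have "x ^ Suc m - y ^ Suc m = x * (x ^ m - y ^ m) + (x - y) * y ^ m" by (simp add: algebra_simps)
  then have "\<bar>x ^ Suc m - y ^ Suc m\<bar> \<le> \<bar>x\<bar> * \<bar>x ^ m - y ^ m\<bar> + \<bar>x - y\<bar> * \<bar>y ^ m\<bar>"
    by (metis abs_mult abs_triangle_ineq)
  also have "\<dots> \<le> 3 * (real m * 3 ^ m * \<bar>x - y\<bar>) + \<bar>x - y\<bar> * 3 ^ m"
    using assms Suc.IH by (intro add_mono mult_mono) (auto simp: power_mono)
  also have "\<dots> \<le> real (Suc m) * 3 ^ Suc m * \<bar>x - y\<bar>"
    by (simp add: algebra_simps)
  finally show ?case .
qed simp

text \<open>The range 3 covers 2 / R * sqrt 2 * R, the bound on the inner product for weights of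
  norm at most 2 / R.\<close>

lemma pos_power_lipschitz:
  assumes "1 \<le> \<alpha>" "\<bar>u\<bar> \<le> 3" "\<bar>v\<bar> \<le> 3"
  shows "\<bar>pos_power \<alpha> u - pos_power \<alpha> v\<bar> \<le> real \<alpha> * 3 ^ \<alpha> * \<bar>u - v\<bar>"
proof -
  have eq: "pos_power \<alpha> t = (max t 0) ^ \<alpha>" for t using assms(1) by (auto simp: pos_power_def max_def)
  have "\<bar>pos_power \<alpha> u - pos_power \<alpha> v\<bar> \<le> real \<alpha> * 3 ^ \<alpha> * \<bar>max u 0 - max v 0\<bar>"
    unfolding eq using assms by (intro abs_power_diff_le) auto
  also have "\<dots> \<le> real \<alpha> * 3 ^ \<alpha> * \<bar>u - v\<bar>" by (intro mult_left_mono) auto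
  finally show ?thesis .
qed

text \<open>After contraction, Cauchy-Schwarz bounds the maximum over weights of norm at most 2 / R
  by a multiple of the norm of the signed sum of the lifted inputs. The second moment of that norm
  is at most 2 n R^2, whatever the dimension.\<close>

lemma rademacher_power_neurons:
  assumes n: "0 < n" and V: "finite V" "V \<noteq> {}" and \<alpha>: "1 \<le> \<alpha>" and R: "0 < R"
    and norm: "\<And>v. v \<in> V \<Longrightarrow> L2_set v {..<Suc d} \<le> 2 / R"
  shows "sign_avg n (\<lambda>\<sigma>. Max ((\<lambda>v. \<bar>\<Sum>i<n. \<sigma> i * masked_neuron d R \<alpha> v (s i)\<bar>) ` V))
    \<le> 6 * (real \<alpha> * 3 ^ \<alpha>) * sqrt (real n)"
proof -
  define L where "L = real \<alpha> * 3 ^ \<alpha>"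
  have L0: "0 \<le> L" by (simp add: L_def)
  define z where "z i = (if s i \<in> input_ball d R then lift_input d R (s i) else (\<lambda>_. 0))" for i
  \<comment> \<open>With the zero weight included, both one-sided maxima are nonnegative, and their
    sum dominates the maximum of absolute values.\<close>
  define V' where "V' = insert (\<lambda>_. 0) V"
  have V': "finite V'" "V' \<noteq> {}" using V by (auto simp: V'_def)
  have norm': "L2_set v {..<Suc d} \<le> 2 / R" if "v \<in> V'" for v
    using that norm R by (auto simp: V'_def L2_set_0' simp del: lessThan_Suc sum.lessThan_Suc)
  have zn: "L2_set (z i) {..<Suc d} \<le> sqrt 2 * R" for i
    using L2_set_lift_input[of "s i" d R] R by (auto simp: z_def L2_set_def)
  have mask: "masked_neuron d R \<alpha> v (s i) = pos_power \<alpha> (dot (Suc d) v (z i))" for v i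
    by (simp add: masked_neuron_def neuron_def z_def dot_def pos_power_def)
  have tb: "\<bar>dot (Suc d) v (z i)\<bar> \<le> 3" if "v \<in> V'" for v i
  proof -
    have "\<bar>dot (Suc d) v (z i)\<bar> \<le> L2_set v {..<Suc d} * L2_set (z i) {..<Suc d}" by (rule abs_dot_le)
    also have "\<dots> \<le> 2 / R * (sqrt 2 * R)" using norm'[OF that] zn[of i] R by (intro mult_mono) auto
    also have "\<dots> = 2 * sqrt 2" using R by simp
    also have "\<dots> \<le> 3"
    proof -
      have "sqrt 2 \<le> sqrt (1.5\<^sup>2)" by (intro real_sqrt_le_mono) (simp add: power2_eq_square)
      then show ?thesis by simp
    qed
    finally show ?thesis .
  qed
  let ?\<psi> = "\<lambda>v i. masked_neuron d R \<alpha> v (s i)"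
  let ?A = "\<lambda>\<sigma>. Max ((\<lambda>v. \<Sum>i<n. \<sigma> i * ?\<psi> v i) ` V')"
  let ?Z = "\<lambda>\<sigma>. L2_set (\<lambda>l. \<Sum>i<n. \<sigma> i * z i l) {..<Suc d}"
  have "Max ((\<lambda>v. \<bar>\<Sum>i<n. \<sigma> i * ?\<psi> v i\<bar>) ` V) \<le> ?A \<sigma> + ?A (\<lambda>i. - \<sigma> i)" for \<sigma>
  proof (rule Max.boundedI)
    fix t assume "t \<in> (\<lambda>v. \<bar>\<Sum>i<n. \<sigma> i * ?\<psi> v i\<bar>) ` V"
    then obtain v where v: "v \<in> V" "t = \<bar>\<Sum>i<n. \<sigma> i * ?\<psi> v i\<bar>" by auto
    have le: "(\<Sum>i<n. \<tau> i * ?\<psi> u i) \<le> ?A \<tau>" if "u \<in> V'" for u \<tau>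
      using V' that by (intro Max_ge) auto
    have "(\<Sum>i<n. \<tau> i * ?\<psi> (\<lambda>_. 0) i) = 0" for \<tau>
      by (simp add: mask dot_def pos_power_def)
    then have nn: "0 \<le> ?A \<tau>" for \<tau> using le[of "\<lambda>_. 0" \<tau>] by (simp add: V'_def)
    have "(\<Sum>i<n. \<sigma> i * ?\<psi> v i) \<le> ?A \<sigma>" "(\<Sum>i<n. - \<sigma> i * ?\<psi> v i) \<le> ?A (\<lambda>i. - \<sigma> i)"
      using v(1) by (intro le; simp add: V'_def)+
    then have "(\<Sum>i<n. \<sigma> i * ?\<psi> v i) \<le> ?A \<sigma>" "- (\<Sum>i<n. \<sigma> i * ?\<psi> v i) \<le> ?A (\<lambda>i. - \<sigma> i)"
      by (simp_all add: sum_negf)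
    then show "t \<le> ?A \<sigma> + ?A (\<lambda>i. - \<sigma> i)"
      using nn[of \<sigma>] nn[of "\<lambda>i. - \<sigma> i"] unfolding v(2) by linarith
  qed (use V in auto)
  then have "sign_avg n (\<lambda>\<sigma>. Max ((\<lambda>v. \<bar>\<Sum>i<n. \<sigma> i * ?\<psi> v i\<bar>) ` V)) \<le> sign_avg n (\<lambda>\<sigma>. ?A \<sigma> + ?A (\<lambda>i. - \<sigma> i))"
    by (intro sign_avg_mono)
  also have "\<dots> = 2 * sign_avg n ?A"
    by (simp only: sign_avg_add sign_avg_uminus[where F = ?A])
  also have "sign_avg n ?A \<le> sign_avg n (\<lambda>\<sigma>. Max ((\<lambda>v. \<Sum>i<n. \<sigma> i * (L * dot (Suc d) v (z i))) ` V'))"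
  proof -
    have "sign_avg n (\<lambda>\<sigma>. Max ((\<lambda>v. 0 + (\<Sum>i<n. \<sigma> i * ?\<psi> v i)) ` V')) \<le>
        sign_avg n (\<lambda>\<sigma>. Max ((\<lambda>v. 0 + (\<Sum>i<n. \<sigma> i * (L * dot (Suc d) v (z i)))) ` V'))"
    proof (rule ledoux_talagrand_comparison[OF V', where u = "\<lambda>v i. ?\<psi> v i" and w = "\<lambda>v i. L * dot (Suc d) v (z i)" and a = "\<lambda>_. 0"])
      fix i v v' assume "v \<in> V'" "v' \<in> V'"
      then have "\<bar>?\<psi> v i - ?\<psi> v' i\<bar> \<le> L * \<bar>dot (Suc d) v (z i) - dot (Suc d) v' (z i)\<bar>"
        unfolding mask L_def by (intro pos_power_lipschitz[OF \<alpha>] tb)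
      then show "\<bar>?\<psi> v i - ?\<psi> v' i\<bar> \<le> \<bar>L * dot (Suc d) v (z i) - L * dot (Suc d) v' (z i)\<bar>"
        using L0 by (simp add: abs_mult flip: right_diff_distrib)
    qed
    then show ?thesis by simp
  qed
  also have "\<dots> \<le> sign_avg n (\<lambda>\<sigma>. (L * (2 / R)) * ?Z \<sigma>)"
  proof (rule sign_avg_mono, rule Max.boundedI)
    fix \<sigma> t assume "t \<in> (\<lambda>v. \<Sum>i<n. \<sigma> i * (L * dot (Suc d) v (z i))) ` V'"
    then obtain v where v: "v \<in> V'" "t = (\<Sum>i<n. \<sigma> i * (L * dot (Suc d) v (z i)))" by auto
    have "t = L * dot (Suc d) v (\<lambda>l. \<Sum>i<n. \<sigma> i * z i l)"
      unfolding v(2) dot_def sum_distrib_left by (subst sum.swap) (simp only: mult_ac)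
    also have "\<dots> \<le> L * (2 / R * ?Z \<sigma>)"
    proof (rule mult_left_mono[OF _ L0])
      have "dot (Suc d) v (\<lambda>l. \<Sum>i<n. \<sigma> i * z i l) \<le> L2_set v {..<Suc d} * ?Z \<sigma>"
        using abs_dot_le[of "Suc d" v "\<lambda>l. \<Sum>i<n. \<sigma> i * z i l"] by linarith
      also have "\<dots> \<le> 2 / R * ?Z \<sigma>" using norm'[OF v(1)] by (intro mult_right_mono L2_set_nonneg)
      finally show "dot (Suc d) v (\<lambda>l. \<Sum>i<n. \<sigma> i * z i l) \<le> 2 / R * ?Z \<sigma>" .
    qed
    finally show "t \<le> L * (2 / R) * ?Z \<sigma>" by (simp only: mult.assoc)
  qed (use V' in auto)
  also have "\<dots> = L * (2 / R) * sign_avg n ?Z" by (rule sign_avg_cmult)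
  also have "\<dots> \<le> L * (2 / R) * (sqrt 2 * R * sqrt (real n))"
  proof (rule mult_left_mono)
    show "sign_avg n ?Z \<le> sqrt 2 * R * sqrt (real n)"
    proof (rule sign_avg_le_sqrt)
      have sq: "(?Z \<sigma>)\<^sup>2 = (\<Sum>l<Suc d. (0 + (\<Sum>i<n. \<sigma> i * z i l))\<^sup>2)" for \<sigma>
        unfolding L2_set_def by (subst real_sqrt_pow2) (auto intro: sum_nonneg simp del: sum.lessThan_Suc)
      have "sign_avg n (\<lambda>\<sigma>. (?Z \<sigma>)\<^sup>2) = (\<Sum>l<Suc d. \<Sum>i<n. (z i l)\<^sup>2)"
        unfolding sq sign_avg_sum sign_avg_square by simp
      also have "\<dots> = (\<Sum>i<n. (L2_set (z i) {..<Suc d})\<^sup>2)"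
        unfolding L2_set_def by (subst sum.swap) (auto simp: real_sqrt_pow2 sum_nonneg simp del: sum.lessThan_Suc)
      also have "\<dots> \<le> (\<Sum>i<n. (sqrt 2 * R)\<^sup>2)" by (intro sum_mono power_mono zn) auto
      also have "\<dots> = (sqrt 2 * R * sqrt (real n))\<^sup>2" by (simp add: power_mult_distrib)
      finally show "sign_avg n (\<lambda>\<sigma>. (?Z \<sigma>)\<^sup>2) \<le> (sqrt 2 * R * sqrt (real n))\<^sup>2" .
    qed (use R n in simp)
  qed (use L0 R in simp)
  also have "\<dots> = (2 * sqrt 2) * L * sqrt (real n)" using R by simp
  also have "2 * \<dots> \<le> 6 * L * sqrt (real n)"
  proof -
    have "sqrt 2 \<le> sqrt (1.5\<^sup>2)" by (intro real_sqrt_le_mono) (simp add: power2_eq_square)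
    then have "(4 * sqrt 2) * (L * sqrt (real n)) \<le> 6 * (L * sqrt (real n))"
      using L0 by (intro mult_right_mono) auto
    then show ?thesis by (simp add: mult_ac)
  qed
  finally show ?thesis unfolding L_def by simp
qed

text \<open>Networks of total weight 2 \<delta> with rounded weights can exceed the range on which
  the loss is Lipschitz. Clipping brings them back, does not move values within the range, and is
  absorbed by contraction.\<close>

definition clip :: "real \<Rightarrow> real \<Rightarrow> real" where
  "clip B u = max (- B) (min B u)"

lemma clip_bounds: "0 \<le> B \<Longrightarrow> \<bar>clip B u\<bar> \<le> B"
  by (auto simp: clip_def)

lemma clip_id: "\<bar>u\<bar> \<le> B \<Longrightarrow> clip B u = u"
  by (auto simp: clip_def)

lemma clip_lipschitz: "\<bar>clip B u - clip B v\<bar> \<le> \<bar>u - v\<bar>"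
  by (auto simp: clip_def max_def min_def)

lemma clip_measurable [measurable]: "clip B \<in> borel_measurable borel"
  unfolding clip_def[abs_def] by measurable

lemma grid_net_measurable: "grid_net d R \<alpha> q \<in> borel_measurable (borel_vec d)"
proof (cases q)
  case (fields N M L)
  have "(\<lambda>x. \<Sum>(c, k)\<leftarrow>L. real_of_int c / real M * neuron d R \<alpha> (grid_weight N k) x) \<in> borel_measurable (borel_vec d)"
  proof (induction L)
    case (Cons a L)
    obtain c k where a: "a = (c, k)" by (cases a)
    have "(\<lambda>x. real_of_int c / real M * neuron d R \<alpha> (grid_weight N k) x) \<in> borel_measurable (borel_vec d)"
      by (intro borel_measurable_times borel_measurable_const neuron_measurable_input)
    from borel_measurable_add[OF this Cons.IH] show ?case by (simp add: a)
  qed simp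
  moreover have "grid_net d R \<alpha> q = (\<lambda>x. \<Sum>(c, k)\<leftarrow>L. real_of_int c / real M * neuron d R \<alpha> (grid_weight N k) x)"
    unfolding fields by (rule ext) simp
  ultimately show ?thesis by simp
qed

section \<open>Generalization\<close>

text \<open>Duality between the sum norm of the coefficients and the maximum over neurons: a linear
  functional on a convex hull is controlled by its generators.\<close>

lemma net_correlation_le:
  assumes m: "0 \<le> m" and le: "\<And>c k. (c, k) \<in> set L \<Longrightarrow> \<bar>\<Sum>i<n. \<sigma> i * masked_neuron d R \<alpha> (grid_weight N k) (x i)\<bar> \<le> m"
  shows "(\<Sum>i<n. \<sigma> i * (if x i \<in> input_ball d R then grid_net d R \<alpha> (N, M, L) (x i) else 0))
    \<le> (\<Sum>(c, k)\<leftarrow>L. \<bar>real_of_int c / real M\<bar>) * m"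
  using le
proof (induction L)
  case (Cons a L)
  obtain c k where a: "a = (c, k)" by (cases a)
  let ?S = "\<lambda>h. \<Sum>i<n. \<sigma> i * h (x i)"
  let ?net = "\<lambda>L y. if y \<in> input_ball d R then grid_net d R \<alpha> (N, M, L) y else 0"
  let ?c = "real_of_int c / real M"
  have IH: "?S (?net L) \<le> (\<Sum>(c, k)\<leftarrow>L. \<bar>real_of_int c / real M\<bar>) * m"
    using Cons.prems by (intro Cons.IH) auto
  have "?S (?net (a # L)) = ?S (\<lambda>y. ?c * masked_neuron d R \<alpha> (grid_weight N k) y + ?net L y)"
    by (intro sum.cong refl) (auto simp: a masked_neuron_def)
  also have "\<dots> = ?c * ?S (masked_neuron d R \<alpha> (grid_weight N k)) + ?S (?net L)"
    by (simp add: distrib_left sum.distrib sum_distrib_left mult_ac)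
  also have "?c * ?S (masked_neuron d R \<alpha> (grid_weight N k)) \<le> \<bar>?c\<bar> * m"
  proof -
    have "?c * ?S (masked_neuron d R \<alpha> (grid_weight N k)) \<le> \<bar>?c\<bar> * \<bar>?S (masked_neuron d R \<alpha> (grid_weight N k))\<bar>"
      unfolding abs_mult[symmetric] by (rule abs_ge_self)
    also have "\<dots> \<le> \<bar>?c\<bar> * m" using Cons.prems[of c k] by (intro mult_left_mono) (auto simp: a)
    finally show ?thesis .
  qed
  finally show ?case using IH by (simp add: a distrib_right)
next
  case Nil
  have z: "(if x i \<in> input_ball d R then grid_net d R \<alpha> (N, M, []) (x i) else 0) = 0" for i by simp
  show ?case unfolding z by simp
qed

section \<open>Risks in a fixed learning problem\<close>

locale erm_problem =
  fixes d :: nat and R :: real and \<alpha> :: nat and Y :: "'y measure"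
    and D :: "((nat \<Rightarrow> real) \<times> 'y) measure" and loss :: "'y \<Rightarrow> real \<Rightarrow> real" and G \<delta> :: real
  assumes R: "0 < R" and G: "0 < G" and \<delta>: "0 < \<delta>"
    and data: "data_law d R Y D" and assm_L: "assumption_L \<alpha> Y D loss G \<delta>"
begin

definition range_bound :: real where
  "range_bound = sqrt 2 ^ max 1 \<alpha> * \<delta>"

definition good :: "(nat \<Rightarrow> real) \<times> 'y \<Rightarrow> bool" where
  "good p \<longleftrightarrow> fst p \<in> input_ball d R \<and> snd p \<in> space Y"

text \<open>The loss at 0 is bounded above only, but the difference to it is bounded on the range of
  the predictors. At points that are not \<open>good\<close>, a null set, it is set to 0, so that
  bounds hold everywhere.\<close>

definition excess :: "((nat \<Rightarrow> real) \<Rightarrow> real) \<Rightarrow> (nat \<Rightarrow> real) \<times> 'y \<Rightarrow> real" where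
  "excess \<phi> p = (if good p then loss (snd p) (\<phi> (fst p)) - loss (snd p) 0 else 0)"

definition predictor :: "((nat \<Rightarrow> real) \<Rightarrow> real) \<Rightarrow> bool" where
  "predictor \<phi> \<longleftrightarrow> \<phi> \<in> borel_measurable (borel_vec d) \<and> (\<forall>x\<in>input_ball d R. \<bar>\<phi> x\<bar> \<le> range_bound)"

lemma prob_D: "prob_space D" and sets_D: "sets D = sets (borel_vec d \<Otimes>\<^sub>M Y)"
  using data by (auto simp: data_law_def)

sublocale prob_space D by (rule prob_D)

lemma space_D: "space D = space (borel_vec d) \<times> space Y"
  using sets_eq_imp_space_eq[OF sets_D] by (simp add: space_pair_measure)

lemma AE_good: "AE p in D. good p"
proof -
  have "AE p in D. L2_set (fst p) {..<d} \<le> R" using data by (simp add: data_law_def)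
  then show ?thesis using AE_space
    by eventually_elim (auto simp: good_def input_ball_def space_D)
qed

lemma range_bound_ge: "\<delta> \<le> range_bound"
proof -
  have "1 * \<delta> \<le> sqrt 2 ^ max 1 \<alpha> * \<delta>" using \<delta> by (intro mult_right_mono one_le_power) auto
  then show ?thesis by (simp add: range_bound_def)
qed

lemma range_bound_pos: "0 < range_bound"
  using range_bound_ge \<delta> by linarith

lemma loss_lipschitz:
  assumes "y \<in> space Y" "\<bar>u\<bar> \<le> range_bound" "\<bar>v\<bar> \<le> range_bound"
  shows "\<bar>loss y u - loss y v\<bar> \<le> G * \<bar>u - v\<bar>"
proof -
  have "lipschitz_on G {u. \<bar>u\<bar> \<le> range_bound} (loss y)"
    using assm_L assms(1) by (auto simp: assumption_L_def range_bound_def)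
  from lipschitz_onD[OF this, of u v] assms show ?thesis by (simp add: dist_real_def)
qed

lemma excess_diff_le:
  assumes "good p \<Longrightarrow> \<bar>\<phi> (fst p)\<bar> \<le> range_bound" "good p \<Longrightarrow> \<bar>\<psi> (fst p)\<bar> \<le> range_bound"
  shows "\<bar>excess \<phi> p - excess \<psi> p\<bar> \<le> G * \<bar>\<phi> (fst p) - \<psi> (fst p)\<bar>"
  using loss_lipschitz[of "snd p" "\<phi> (fst p)" "\<psi> (fst p)"] assms G by (auto simp: excess_def good_def)

lemma predictorD: "predictor \<phi> \<Longrightarrow> good p \<Longrightarrow> \<bar>\<phi> (fst p)\<bar> \<le> range_bound"
  by (auto simp: predictor_def good_def)

lemma abs_excess_le:
  assumes "predictor \<phi>"
  shows "\<bar>excess \<phi> p\<bar> \<le> G * range_bound"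
proof (cases "good p")
  case True
  have "\<bar>excess \<phi> p\<bar> \<le> G * \<bar>\<phi> (fst p) - 0\<bar>"
    using loss_lipschitz[of "snd p" "\<phi> (fst p)" 0] predictorD[OF assms True] True range_bound_pos
    by (auto simp: excess_def good_def)
  also have "\<dots> \<le> G * range_bound" using predictorD[OF assms True] G by (intro mult_left_mono) auto
  finally show ?thesis .
qed (use G range_bound_pos in \<open>auto simp: excess_def\<close>)

lemma loss_measurable:
  assumes "\<phi> \<in> borel_measurable (borel_vec d)"
  shows "(\<lambda>p. loss (snd p) (\<phi> (fst p))) \<in> borel_measurable D"
proof -
  have "(\<lambda>p. (snd p, \<phi> (fst p))) \<in> measurable (borel_vec d \<Otimes>\<^sub>M Y) (Y \<Otimes>\<^sub>M borel)"
    by (intro measurable_Pair measurable_snd measurable_compose[OF measurable_fst assms])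
  moreover have "(\<lambda>(y, u). loss y u) \<in> borel_measurable (Y \<Otimes>\<^sub>M borel)"
    using assm_L by (simp add: assumption_L_def)
  ultimately have "(\<lambda>p. (\<lambda>(y, u). loss y u) (snd p, \<phi> (fst p))) \<in> borel_measurable (borel_vec d \<Otimes>\<^sub>M Y)"
    by (rule measurable_compose)
  then show ?thesis by (simp add: measurable_cong_sets[OF sets_D refl])
qed

lemma good_measurable: "{p \<in> space D. good p} \<in> sets D"
proof -
  have "input_ball d R \<times> space Y \<in> sets (borel_vec d \<Otimes>\<^sub>M Y)"
    by (intro pair_measureI input_ball_measurable sets.top)
  moreover have "{p \<in> space D. good p} = input_ball d R \<times> space Y"
    by (auto simp: good_def space_D input_ball_def)
  ultimately show ?thesis by (simp add: sets_D)
qed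

lemma excess_measurable:
  assumes "predictor \<phi>"
  shows "excess \<phi> \<in> borel_measurable D"
  unfolding excess_def[abs_def]
  using assms
  by (intro measurable_If borel_measurable_diff loss_measurable loss_measurable[of "\<lambda>_. 0"] good_measurable)
     (auto simp: predictor_def)

lemma integrable_excess: "predictor \<phi> \<Longrightarrow> integrable D (excess \<phi>)"
  by (rule integrable_const_bound[of _ "G * range_bound"]) (auto simp: abs_excess_le excess_measurable)

lemma AE_excess: "AE p in D. loss (snd p) (\<phi> (fst p)) = excess \<phi> p + loss (snd p) 0"
  using AE_good by eventually_elim (simp add: excess_def)

lemma risk_eq_excess:
  assumes int: "integrable D (\<lambda>p. loss (snd p) 0)" and \<phi>: "predictor \<phi>"
  shows "risk D loss \<phi> = (\<integral>p. excess \<phi> p \<partial>D) + (\<integral>p. loss (snd p) 0 \<partial>D)"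
proof -
  have "risk D loss \<phi> = (\<integral>p. excess \<phi> p + loss (snd p) 0 \<partial>D)"
    unfolding risk_def
    using \<phi> loss_measurable[of "\<lambda>_. 0"] AE_excess
    by (intro integral_cong_AE loss_measurable borel_measurable_add excess_measurable) (auto simp: predictor_def)
  also have "\<dots> = (\<integral>p. excess \<phi> p \<partial>D) + (\<integral>p. loss (snd p) 0 \<partial>D)"
    by (intro Bochner_Integration.integral_add integrable_excess \<phi> int)
  finally show ?thesis .
qed

text \<open>
  The loss is only bounded above at 0, so it may fail to be integrable; then every risk has the junk
  value 0.
\<close>

lemma risk_eq_0:
  assumes nint: "\<not> integrable D (\<lambda>p. loss (snd p) 0)" and \<phi>: "predictor \<phi>"
  shows "risk D loss \<phi> = 0"
proof -
  have "\<not> integrable D (\<lambda>p. loss (snd p) (\<phi> (fst p)))"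
  proof
    assume "integrable D (\<lambda>p. loss (snd p) (\<phi> (fst p)))"
    then have "integrable D (\<lambda>p. loss (snd p) (\<phi> (fst p)) - excess \<phi> p)"
      by (intro Bochner_Integration.integrable_diff integrable_excess \<phi>)
    then have "integrable D (\<lambda>p. loss (snd p) 0)"
    proof (rule integrable_cong_AE_imp)
      show "(\<lambda>p. loss (snd p) 0) \<in> borel_measurable D" using loss_measurable[of "\<lambda>_. 0"] by simp
      show "AE p in D. loss (snd p) (\<phi> (fst p)) - excess \<phi> p = loss (snd p) 0"
        using AE_excess[of \<phi>] by eventually_elim simp
    qed
    then show False using nint by blast
  qed
  then show ?thesis unfolding risk_def by (rule not_integrable_integral_eq)
qed

lemma risk_le_risk:
  assumes \<phi>: "predictor \<phi>" and \<psi>: "predictor \<psi>" and e: "0 \<le> e" "\<And>x. x \<in> input_ball d R \<Longrightarrow> \<bar>\<phi> x - \<psi> x\<bar> \<le> e"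
  shows "risk D loss \<phi> \<le> risk D loss \<psi> + G * e"
proof (cases "integrable D (\<lambda>p. loss (snd p) 0)")
  case True
  have "(\<integral>p. excess \<phi> p \<partial>D) \<le> (\<integral>p. excess \<psi> p + G * e \<partial>D)"
  proof (rule integral_mono)
    fix p
    show "excess \<phi> p \<le> excess \<psi> p + G * e"
    proof (cases "good p")
      case True
      have "\<bar>excess \<phi> p - excess \<psi> p\<bar> \<le> G * \<bar>\<phi> (fst p) - \<psi> (fst p)\<bar>"
        by (intro excess_diff_le predictorD \<phi> \<psi>)
      also have "\<dots> \<le> G * e" using True e G by (intro mult_left_mono) (auto simp: good_def)
      finally show ?thesis by linarith
    qed (use e G in \<open>simp add: excess_def\<close>)
  qed (intro Bochner_Integration.integrable_add integrable_excess integrable_const \<phi> \<psi>)+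
  also have "\<dots> = (\<integral>p. excess \<psi> p \<partial>D) + G * e"
    using integrable_excess[OF \<psi>] by (simp add: prob_space)
  finally show ?thesis using risk_eq_excess[OF True] \<phi> \<psi> by simp
next
  case False
  then show ?thesis using risk_eq_0[OF False] \<phi> \<psi> e G by simp
qed

lemma F1_ball_predictor:
  assumes f: "f \<in> F1_ball d R \<alpha> \<delta>"
  shows "predictor f"
proof -
  obtain g where g: "g \<in> borel_measurable (borel_vec d)" "\<forall>x\<in>input_ball d R. f x = g x"
    using F1_ball_measurable_extension[OF f] \<delta> by auto
  obtain \<mu> where "represents d R \<alpha> \<mu> f" using f by (auto simp: F1_ball_def F1_def)
  \<comment> \<open>Off the ball the function has one constant value, so measurability carries over
    from the extension.\<close>
  then have out: "f x = undefined" if "x \<notin> input_ball d R" for x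
    using that by (auto simp: represents_def)
  have "f = (\<lambda>x. if x \<in> input_ball d R then g x else undefined)" using g(2) out by auto
  moreover have "{x \<in> space (borel_vec d). x \<in> input_ball d R} \<in> sets (borel_vec d)"
    using input_ball_measurable[of d R] by (simp add: input_ball_def)
  ultimately have "f \<in> borel_measurable (borel_vec d)" using g(1) by simp
  moreover have "\<bar>f x\<bar> \<le> range_bound" if "x \<in> input_ball d R" for x
  proof -
    have "\<bar>f x\<bar> \<le> sqrt 2 ^ \<alpha> * \<delta>" using F1_ball_abs_le[OF f _ that R] \<delta> by simp
    also have "\<dots> \<le> range_bound"
      unfolding range_bound_def using \<delta> by (intro mult_right_mono power_increasing) auto
    finally show ?thesis .
  qed
  ultimately show ?thesis by (simp add: predictor_def)
qed

section \<open>Deviation bound for clipped networks\<close>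

definition net :: "net_code \<Rightarrow> (nat \<Rightarrow> real) \<Rightarrow> real" where
  "net q x = clip range_bound (grid_net d R \<alpha> q x)"

lemma net_predictor: "predictor (net q)"
  unfolding predictor_def net_def
  using measurable_compose[OF grid_net_measurable clip_measurable] clip_bounds range_bound_pos
  by (auto simp: less_imp_le)

text \<open>Loss and clipping form a Lipschitz map of the network output with constant
  \<open>G\<close>, so contraction removes both; what remains is linear in coefficients of total
  weight at most 2 \<delta>.\<close>

lemma rademacher_nets:
  assumes rademacher: "\<And>s V. finite V \<Longrightarrow> V \<noteq> {} \<Longrightarrow> (\<And>v. v \<in> V \<Longrightarrow> L2_set v {..<Suc d} \<le> 2 / R) \<Longrightarrow>
      sign_avg n (\<lambda>\<sigma>. Max ((\<lambda>v. \<bar>\<Sum>i<n. \<sigma> i * masked_neuron d R \<alpha> v (s i)\<bar>) ` V)) \<le> \<rho>"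
    and Q: "finite Q" "Q \<noteq> {}" "\<And>q. q \<in> Q \<Longrightarrow> net_admissible d R (2 * \<delta>) q"
  shows "sign_avg n (\<lambda>\<sigma>. Max ((\<lambda>q. \<Sum>i<n. \<sigma> i * excess (net q) (s i)) ` Q)) \<le> G * (2 * \<delta>) * \<rho>"
proof -
  define m where "m q x = (if x \<in> input_ball d R then grid_net d R \<alpha> q x else 0)" for q x
  \<comment> \<open>The zero weight keeps the set nonempty even when all lists are empty.\<close>
  define V where "V = insert (\<lambda>_. 0) (\<Union>(N, M, L)\<in>Q. (\<lambda>(c, k). grid_weight N k) ` set L)"
  have V: "finite V" "V \<noteq> {}" using Q(1) by (auto simp: V_def)
  have normV: "L2_set v {..<Suc d} \<le> 2 / R" if v: "v \<in> V" for v
  proof (cases "v = (\<lambda>_. 0)")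
    case True
    then show ?thesis using R by (simp add: L2_set_0' del: lessThan_Suc)
  next
    case False
    then obtain N M L c k where "(N, M, L) \<in> Q" "(c, k) \<in> set L" "v = grid_weight N k"
      using v by (auto simp: V_def)
    then show ?thesis using Q(3)[of "(N, M, L)"] by auto
  qed
  let ?T = "\<lambda>\<sigma>. Max ((\<lambda>v. \<bar>\<Sum>i<n. \<sigma> i * masked_neuron d R \<alpha> v (fst (s i))\<bar>) ` V)"
  have "sign_avg n (\<lambda>\<sigma>. Max ((\<lambda>q. 0 + (\<Sum>i<n. \<sigma> i * excess (net q) (s i))) ` Q)) \<le>
      sign_avg n (\<lambda>\<sigma>. Max ((\<lambda>q. 0 + (\<Sum>i<n. \<sigma> i * (G * m q (fst (s i))))) ` Q))"
  proof (rule ledoux_talagrand_comparison[OF Q(1,2), where a = "\<lambda>_. 0" and u = "\<lambda>q i. excess (net q) (s i)" and w = "\<lambda>q i. G * m q (fst (s i))"])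
    fix i q q'
    show "\<bar>excess (net q) (s i) - excess (net q') (s i)\<bar> \<le> \<bar>G * m q (fst (s i)) - G * m q' (fst (s i))\<bar>"
    proof (cases "good (s i)")
      case True
      have "\<bar>excess (net q) (s i) - excess (net q') (s i)\<bar> \<le> G * \<bar>net q (fst (s i)) - net q' (fst (s i))\<bar>"
        by (intro excess_diff_le predictorD net_predictor)
      also have "\<dots> \<le> G * \<bar>m q (fst (s i)) - m q' (fst (s i))\<bar>"
        using True G unfolding net_def m_def good_def by (simp add: clip_lipschitz)
      also have "\<dots> = \<bar>G * m q (fst (s i)) - G * m q' (fst (s i))\<bar>"
        using G by (simp add: abs_mult flip: right_diff_distrib)
      finally show ?thesis .
    qed (simp add: excess_def)
  qed
  also have "\<dots> \<le> sign_avg n (\<lambda>\<sigma>. G * (2 * \<delta>) * ?T \<sigma>)"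
  proof (rule sign_avg_mono, rule Max.boundedI)
    fix \<sigma> t assume "t \<in> (\<lambda>q. 0 + (\<Sum>i<n. \<sigma> i * (G * m q (fst (s i))))) ` Q"
    then obtain q where q: "q \<in> Q" "t = (\<Sum>i<n. \<sigma> i * (G * m q (fst (s i))))" by auto
    obtain N M L where L: "q = (N, M, L)" by (cases q)
    have le: "\<bar>\<Sum>i<n. \<sigma> i * masked_neuron d R \<alpha> v (fst (s i))\<bar> \<le> ?T \<sigma>" if "v \<in> V" for v
      using V(1) that by (intro Max_ge) auto
    have T0: "0 \<le> ?T \<sigma>" using le[of "\<lambda>_. 0"] by (simp add: V_def)
    have "t = G * (\<Sum>i<n. \<sigma> i * m q (fst (s i)))"
      unfolding q(2) sum_distrib_left by (simp add: mult_ac)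
    also have "\<dots> \<le> G * ((\<Sum>(c, k)\<leftarrow>L. \<bar>real_of_int c / real M\<bar>) * ?T \<sigma>)"
      unfolding m_def L
    proof (intro mult_left_mono net_correlation_le T0)
      fix c k assume "(c, k) \<in> set L"
      then have "grid_weight N k \<in> V" using q(1) L unfolding V_def by force
      then show "\<bar>\<Sum>i<n. \<sigma> i * masked_neuron d R \<alpha> (grid_weight N k) (fst (s i))\<bar> \<le> ?T \<sigma>" by (rule le)
    qed (use G in simp)
    also have "\<dots> \<le> G * (2 * \<delta> * ?T \<sigma>)"
      using Q(3)[OF q(1)] G T0 by (intro mult_left_mono mult_right_mono) (auto simp: L)
    finally show "t \<le> G * (2 * \<delta>) * ?T \<sigma>" by (simp only: mult.assoc)
  qed (use Q in auto)
  also have "\<dots> = G * (2 * \<delta>) * sign_avg n ?T" by (rule sign_avg_cmult)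
  also have "\<dots> \<le> G * (2 * \<delta>) * \<rho>"
    using rademacher[OF V normV, of "\<lambda>i. fst (s i)"] G \<delta> by (intro mult_left_mono) auto
  finally show ?thesis by simp
qed

text \<open>Clipping leaves the values of \<open>f\<close> on the ball fixed, so clipped networks
  converge to them too, and all excess losses share one bound. Hence deviations over the ball are at
  most the supremum over countably many networks.\<close>

lemma F1_ball_excess_limit:
  assumes f: "f \<in> F1_ball d R \<alpha> \<delta>"
  shows "\<exists>\<L>. (\<forall>m::nat. net_admissible d R (2 * \<delta>) (\<L> m)) \<and>
    (\<forall>p. (\<lambda>m. excess (net (\<L> m)) p) \<longlonglongrightarrow> excess f p) \<and>
    (\<lambda>m. \<integral>p. excess (net (\<L> m)) p \<partial>D) \<longlonglongrightarrow> (\<integral>p. excess f p \<partial>D)"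
proof -
  obtain \<L> where \<L>: "\<And>m::nat. net_admissible d R (2 * \<delta>) (\<L> m)"
    "\<And>x. x \<in> input_ball d R \<Longrightarrow> (\<lambda>m. grid_net d R \<alpha> (\<L> m) x) \<longlonglongrightarrow> f x"
    using F1_ball_grid_approximation[OF f \<delta> R] by blast
  note pf = F1_ball_predictor[OF f]
  have lim: "(\<lambda>m. excess (net (\<L> m)) p) \<longlonglongrightarrow> excess f p" for p
  proof (cases "good p")
    case True
    have "(\<lambda>m. excess (net (\<L> m)) p - excess f p) \<longlonglongrightarrow> 0"
    proof (rule Lim_null_comparison)
      show "\<forall>\<^sub>F m in sequentially. norm (excess (net (\<L> m)) p - excess f p) \<le> G * \<bar>grid_net d R \<alpha> (\<L> m) (fst p) - f (fst p)\<bar>"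
      proof (intro always_eventually allI)
        fix m
        have "\<bar>excess (net (\<L> m)) p - excess f p\<bar> \<le> G * \<bar>net (\<L> m) (fst p) - f (fst p)\<bar>"
          by (intro excess_diff_le predictorD net_predictor pf)
        also have "f (fst p) = clip range_bound (f (fst p))" by (rule clip_id[symmetric]) (rule predictorD[OF pf True])
        also have "G * \<bar>net (\<L> m) (fst p) - clip range_bound (f (fst p))\<bar> \<le> G * \<bar>grid_net d R \<alpha> (\<L> m) (fst p) - f (fst p)\<bar>"
          unfolding net_def using G by (intro mult_left_mono clip_lipschitz) auto
        finally show "norm (excess (net (\<L> m)) p - excess f p) \<le> G * \<bar>grid_net d R \<alpha> (\<L> m) (fst p) - f (fst p)\<bar>" by simp
      qed
      have "(\<lambda>m. grid_net d R \<alpha> (\<L> m) (fst p)) \<longlonglongrightarrow> f (fst p)" using True by (intro \<L>(2)) (simp add: good_def)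
      then have "(\<lambda>m. grid_net d R \<alpha> (\<L> m) (fst p) - f (fst p)) \<longlonglongrightarrow> 0" by (rule LIM_zero)
      from tendsto_mult[OF tendsto_const tendsto_rabs[OF this], of G]
      show "(\<lambda>m. G * \<bar>grid_net d R \<alpha> (\<L> m) (fst p) - f (fst p)\<bar>) \<longlonglongrightarrow> 0" by simp
    qed
    then show ?thesis by (rule LIM_zero_cancel)
  qed (simp add: excess_def)
  have "(\<lambda>m. \<integral>p. excess (net (\<L> m)) p \<partial>D) \<longlonglongrightarrow> (\<integral>p. excess f p \<partial>D)"
    by (rule integral_dominated_convergence[where w = "\<lambda>_. G * range_bound"])
       (auto intro: excess_measurable net_predictor pf lim simp: abs_excess_le[OF net_predictor])
  then show ?thesis using \<L>(1) lim by blast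
qed

text \<open>Up to the loss at 0, the risk of the minimizer is at most its empirical risk plus
  \<Psi>, hence at most the empirical risk of \<open>f0\<close> plus \<Psi>, where \<Psi> is the
  supremum of the one-sided deviations. The factor 4 is the 2 of symmetrization times the 2 of the
  weight 2 \<delta>.\<close>

lemma generalization_bound:
  assumes n: "0 < n" and \<rho>: "0 \<le> \<rho>"
    and rademacher: "\<And>s V. finite V \<Longrightarrow> V \<noteq> {} \<Longrightarrow> (\<And>v. v \<in> V \<Longrightarrow> L2_set v {..<Suc d} \<le> 2 / R) \<Longrightarrow>
      sign_avg n (\<lambda>\<sigma>. Max ((\<lambda>v. \<bar>\<Sum>i<n. \<sigma> i * masked_neuron d R \<alpha> v (s i)\<bar>) ` V)) \<le> \<rho>"
    and erm: "empirical_minimizer d R \<alpha> \<delta> n D loss fhat"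
    and f0: "f0 \<in> F1_ball d R \<alpha> \<delta>"
  shows "(\<integral>s. risk D loss (fhat s) \<partial>sample_law n D) \<le> risk D loss f0 + 4 * G * \<delta> * \<rho> / real n"
proof -
  let ?S = "sample_law n D"
  interpret S: prob_space ?S by (rule prob_space_PiM) (rule prob_D)
  have AE_erm: "AE s in ?S. fhat s \<in> F1_ball d R \<alpha> \<delta> \<and>
      (\<forall>f \<in> F1_ball d R \<alpha> \<delta>. empirical_risk n loss s (fhat s) \<le> empirical_risk n loss s f)"
    and meas: "(\<lambda>s. risk D loss (fhat s)) \<in> borel_measurable ?S"
    using erm by (auto simp: empirical_minimizer_def)
  have K0: "0 \<le> 4 * G * \<delta> * \<rho> / real n" using G \<delta> \<rho> by simp
  show ?thesis
  proof (cases "integrable D (\<lambda>p. loss (snd p) 0)")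
    case False
    have "AE s in ?S. risk D loss (fhat s) = 0"
      using AE_erm by eventually_elim (auto intro: risk_eq_0[OF False] F1_ball_predictor)
    then have "(\<integral>s. risk D loss (fhat s) \<partial>?S) = 0" by (rule integral_eq_zero_AE)
    then show ?thesis using risk_eq_0[OF False F1_ball_predictor[OF f0]] K0 by simp
  next
    case True
    define m0 where "m0 = (\<integral>p. loss (snd p) 0 \<partial>D)"
    define M where "M = G * range_bound"
    have M0: "0 \<le> M" using G range_bound_pos by (simp add: M_def)
    define E where "E q = (\<integral>p. excess (net q) p \<partial>D)" for q
    define A where "A q s = E q - (\<Sum>i<n. excess (net q) (s i)) / real n" for q and s :: "nat \<Rightarrow> (nat \<Rightarrow> real) \<times> 'y"
    \<comment> \<open>Finite classes that increase to all admissible networks; the empty network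
      makes them nonempty.\<close>
    define H where "H N = insert (0, 0, []) {q :: net_code. net_admissible d R (2 * \<delta>) q \<and> to_nat q \<le> N}" for N
    have finH: "finite (H N)" for N
    proof -
      have "finite (to_nat -` {..N} :: net_code set)" by (intro finite_vimageI) auto
      then have "finite {q :: net_code. net_admissible d R (2 * \<delta>) q \<and> to_nat q \<le> N}"
        by (rule rev_finite_subset) auto
      then show ?thesis by (simp add: H_def)
    qed
    have neH: "H N \<noteq> {}" for N by (simp add: H_def)
    have admH: "net_admissible d R (2 * \<delta>) q" if "q \<in> H N" for q N
      using that \<delta> by (auto simp: H_def)
    define \<Phi> where "\<Phi> N s = Max ((\<lambda>q. A q s) ` H N)" for N s
    have A_bd: "\<bar>A q s\<bar> \<le> 2 * M" for q s
    proof -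
      have "\<bar>E q\<bar> \<le> M" unfolding E_def M_def
        by (intro abs_integral_le excess_measurable abs_excess_le net_predictor)
      moreover have "\<bar>\<Sum>i<n. excess (net q) (s i)\<bar> \<le> (\<Sum>i<n. M)"
        unfolding M_def by (intro order_trans[OF sum_abs] sum_mono abs_excess_le net_predictor)
      then have "\<bar>(\<Sum>i<n. excess (net q) (s i)) / real n\<bar> \<le> M" using n by (simp add: field_simps)
      ultimately show ?thesis unfolding A_def by linarith
    qed
    have \<Phi>_bd: "\<bar>\<Phi> N s\<bar> \<le> 2 * M" for N s unfolding \<Phi>_def by (rule abs_Max_le[OF finH neH A_bd])
    have comp: "(\<lambda>s. excess \<phi> (s i)) \<in> borel_measurable ?S" if "predictor \<phi>" "i < n" for \<phi> i
    proof -
      have "(\<lambda>s. s i) \<in> measurable ?S D" using that(2) by (intro measurable_component_singleton) simp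
      then show ?thesis by (rule measurable_compose) (rule excess_measurable[OF that(1)])
    qed
    have \<Phi>_meas: "\<Phi> N \<in> borel_measurable ?S" for N
      unfolding \<Phi>_def A_def
      by (intro borel_measurable_Max finH neH borel_measurable_diff borel_measurable_const borel_measurable_divide
          borel_measurable_sum comp net_predictor) auto
    have \<Phi>_le: "(\<integral>s. \<Phi> N s \<partial>?S) \<le> 4 * G * \<delta> * \<rho> / real n" for N
    proof -
      have "(\<integral>s. \<Phi> N s \<partial>?S) \<le> 2 * (G * (2 * \<delta>) * \<rho>) / real n"
        unfolding \<Phi>_def A_def E_def
      proof (rule symmetrization[OF prob_D finH neH n, where B = M])
        fix s
        show "sign_avg n (\<lambda>\<sigma>. Max ((\<lambda>q. \<Sum>i<n. \<sigma> i * excess (net q) (s i)) ` H N)) \<le> G * (2 * \<delta>) * \<rho>"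
          by (rule rademacher_nets[OF rademacher finH neH admH])
      qed (auto simp: M_def intro: excess_measurable net_predictor abs_excess_le)
      then show ?thesis by (simp add: mult_ac)
    qed
    \<comment> \<open>A measurable majorant of all deviations over the ball, as the limit of finite
      maxima.\<close>
    define \<Psi> where "\<Psi> s = (SUP N. \<Phi> N s)" for s
    have bdd: "bdd_above (range (\<lambda>N. \<Phi> N s))" for s
      using \<Phi>_bd by (intro bdd_aboveI[of _ "2 * M"]) (auto simp: abs_le_iff)
    have \<Phi>_lim: "(\<lambda>N. \<Phi> N s) \<longlonglongrightarrow> \<Psi> s" for s
      unfolding \<Psi>_def
    proof (rule LIMSEQ_incseq_SUP[OF bdd])
      show "incseq (\<lambda>N. \<Phi> N s)"
      proof (rule incseq_SucI)
        fix N
        have "H N \<subseteq> H (Suc N)" by (auto simp: H_def)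
        then show "\<Phi> N s \<le> \<Phi> (Suc N) s"
          unfolding \<Phi>_def using neH finH by (intro Max_mono image_mono) auto
      qed
    qed
    have \<Psi>_meas: "\<Psi> \<in> borel_measurable ?S"
      by (rule borel_measurable_LIMSEQ_real[OF \<Phi>_lim \<Phi>_meas])
    have \<Psi>_bd: "\<bar>\<Psi> s\<bar> \<le> 2 * M" for s
      by (rule LIMSEQ_le_const2[OF tendsto_rabs[OF \<Phi>_lim]]) (auto simp: \<Phi>_bd)
    have \<Psi>_int: "integrable ?S \<Psi>"
      by (rule S.integrable_const_bound[of _ "2 * M"]) (auto simp: \<Psi>_bd \<Psi>_meas)
    have \<Psi>_le: "(\<integral>s. \<Psi> s \<partial>?S) \<le> 4 * G * \<delta> * \<rho> / real n"
    proof (rule LIMSEQ_le_const2)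
      show "(\<lambda>N. \<integral>s. \<Phi> N s \<partial>?S) \<longlonglongrightarrow> (\<integral>s. \<Psi> s \<partial>?S)"
        by (rule integral_dominated_convergence[where w = "\<lambda>_. 2 * M"])
           (auto simp: \<Phi>_bd \<Phi>_lim intro: \<Phi>_meas \<Psi>_meas)
      show "\<exists>N. \<forall>n'\<ge>N. (\<integral>s. \<Phi> n' s \<partial>?S) \<le> 4 * G * \<delta> * \<rho> / real n" using \<Phi>_le by blast
    qed
    have A_le: "A q s \<le> \<Psi> s" if "net_admissible d R (2 * \<delta>) q" for q s
    proof -
      have "A q s \<le> \<Phi> (to_nat q) s" unfolding \<Phi>_def using that finH by (intro Max_ge) (auto simp: H_def)
      also have "\<dots> \<le> \<Psi> s" unfolding \<Psi>_def by (rule cSUP_upper[OF UNIV_I bdd])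
      finally show ?thesis .
    qed
    have dev: "(\<integral>p. excess f p \<partial>D) - (\<Sum>i<n. excess f (s i)) / real n \<le> \<Psi> s" if f: "f \<in> F1_ball d R \<alpha> \<delta>" for f s
    proof -
      obtain \<L> where \<L>: "\<And>m::nat. net_admissible d R (2 * \<delta>) (\<L> m)" "\<And>p. (\<lambda>m. excess (net (\<L> m)) p) \<longlonglongrightarrow> excess f p"
        "(\<lambda>m. E (\<L> m)) \<longlonglongrightarrow> (\<integral>p. excess f p \<partial>D)"
        using F1_ball_excess_limit[OF f] unfolding E_def by blast
      have "(\<lambda>m. A (\<L> m) s) \<longlonglongrightarrow> (\<integral>p. excess f p \<partial>D) - (\<Sum>i<n. excess f (s i)) / real n"
        unfolding A_def using n by (intro tendsto_intros \<L>) auto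
      then show ?thesis by (rule LIMSEQ_le_const2) (use A_le \<L>(1) in auto)
    qed
    \<comment> \<open>The empirical excess of the fixed comparison function; its mean is exactly the
      expected excess, so it contributes no deviation term.\<close>
    define T where "T s = (\<Sum>i<n. excess f0 (s i)) / real n" for s
    note pf0 = F1_ball_predictor[OF f0]
    have int_comp: "integrable ?S (\<lambda>s. excess f0 (s i))" if "i < n" for i
      using that by (intro S.integrable_const_bound[of _ M]) (auto simp: M_def abs_excess_le[OF pf0] intro: comp pf0)
    have T_int: "integrable ?S T" unfolding T_def using int_comp by (intro integrable_divide Bochner_Integration.integrable_sum) auto
    have T_eq: "(\<integral>s. T s \<partial>?S) = (\<integral>p. excess f0 p \<partial>D)"
    proof -
      have "(\<integral>s. T s \<partial>?S) = (\<Sum>i<n. \<integral>s. excess f0 (s i) \<partial>?S) / real n"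
        unfolding T_def using int_comp by simp
      also have "\<dots> = (\<Sum>i<n. \<integral>p. excess f0 p \<partial>D) / real n"
        by (intro arg_cong2[where f = "(/)"] sum.cong refl integral_PiM_component prob_D excess_measurable pf0)
      finally show ?thesis using n by simp
    qed
    have AE_good_sample: "AE s in ?S. \<forall>i\<in>{..<n}. good (s i)"
      by (rule AE_finite_allI) (auto intro: AE_PiM_component[where M = "\<lambda>_. D"] prob_D AE_good)
    have key: "AE s in ?S. risk D loss (fhat s) \<le> m0 + (\<Psi> s + T s)"
      using AE_erm AE_good_sample
    proof eventually_elim
      case (elim s)
      then have fs: "fhat s \<in> F1_ball d R \<alpha> \<delta>" and min: "empirical_risk n loss s (fhat s) \<le> empirical_risk n loss s f0"
        and good: "\<And>i. i < n \<Longrightarrow> good (s i)"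
        using f0 by auto
      have emp: "empirical_risk n loss s f = (\<Sum>i<n. excess f (s i)) / real n + (\<Sum>i<n. loss (snd (s i)) 0) / real n" for f
        unfolding empirical_risk_def add_divide_distrib[symmetric] sum.distrib[symmetric]
        by (intro arg_cong2[where f = "(/)"] sum.cong refl) (simp add: excess_def good)
      have "(\<Sum>i<n. excess (fhat s) (s i)) / real n \<le> T s" using min unfolding emp T_def by simp
      moreover have "risk D loss (fhat s) = (\<integral>p. excess (fhat s) p \<partial>D) + m0"
        unfolding m0_def by (rule risk_eq_excess[OF True F1_ball_predictor[OF fs]])
      ultimately show ?case using dev[OF fs, of s] by linarith
    qed
    have risk_int: "integrable ?S (\<lambda>s. risk D loss (fhat s))"
    proof (rule S.integrable_const_bound[of _ "M + \<bar>m0\<bar>", OF _ meas])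
      show "AE s in ?S. norm (risk D loss (fhat s)) \<le> M + \<bar>m0\<bar>"
        using AE_erm
      proof eventually_elim
        case (elim s)
        then have p: "predictor (fhat s)" by (intro F1_ball_predictor) simp
        have "\<bar>\<integral>p. excess (fhat s) p \<partial>D\<bar> \<le> M"
          unfolding M_def by (intro abs_integral_le excess_measurable abs_excess_le p)
        then show ?case using risk_eq_excess[OF True p] unfolding m0_def[symmetric] by simp
      qed
    qed
    have "(\<integral>s. risk D loss (fhat s) \<partial>?S) \<le> (\<integral>s. m0 + (\<Psi> s + T s) \<partial>?S)"
      by (rule integral_mono_AE[OF risk_int _ key]) (intro Bochner_Integration.integrable_add S.integrable_const \<Psi>_int T_int)
    also have "\<dots> = m0 + ((\<integral>s. \<Psi> s \<partial>?S) + (\<integral>p. excess f0 p \<partial>D))"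
      using \<Psi>_int T_int by (simp add: S.prob_space T_eq)
    also have "\<dots> \<le> risk D loss f0 + 4 * G * \<delta> * \<rho> / real n"
      using \<Psi>_le risk_eq_excess[OF True pf0] by (simp add: m0_def)
    finally show ?thesis .
  qed
qed

lemma projection_pursuit_predictor:
  assumes params: "projection_pursuit_params d k R \<eta> w f" and le: "real k * (\<eta> * R) \<le> range_bound"
  shows "predictor (projection_pursuit d k w f)"
  unfolding predictor_def
proof
  have "f j \<in> borel_measurable borel" if "j < k" for j
    using params that
    by (intro borel_measurable_continuous_onI) (auto simp: projection_pursuit_params_def intro: lipschitz_on_continuous_on)
  moreover have "(\<lambda>x. dot d v x) \<in> borel_measurable (borel_vec d)" for v
    unfolding dot_def
    by (intro borel_measurable_sum borel_measurable_times borel_measurable_const measurable_component_singleton) auto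
  ultimately show "projection_pursuit d k w f \<in> borel_measurable (borel_vec d)"
    unfolding projection_pursuit_def[abs_def]
    by (intro borel_measurable_sum) (auto intro: measurable_compose)
  show "\<forall>x\<in>input_ball d R. \<bar>projection_pursuit d k w f x\<bar> \<le> range_bound"
    using projection_pursuit_abs_le[OF params] le by (blast intro: order_trans)
qed

end

section \<open>Balance of approximation and estimation errors\<close>

theorem mainTheorem7:
  shows
    "(\<forall>\<alpha>::nat. \<alpha> \<ge> 1 \<longrightarrow>
       (\<exists>C::real. \<forall>(d::nat) (k::nat) (n::nat) (R::real) (\<eta>::real) (G::real) w f
            (Y :: 'y measure) D loss fhat (\<delta>::real).
          d \<ge> 1 \<longrightarrow> k \<ge> 1 \<longrightarrow> n \<ge> 2 \<longrightarrow> R > 0 \<longrightarrow> \<eta> > 0 \<longrightarrow> G > 0 \<longrightarrow>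
          projection_pursuit_params d k R \<eta> w f \<longrightarrow>
          data_law d R Y D \<longrightarrow>
          \<delta> = real k * \<eta> * R * real n powr (real \<alpha> / (2 * (real \<alpha> + 1))) \<longrightarrow>
          assumption_L \<alpha> Y D loss G \<delta> \<longrightarrow>
          empirical_minimizer d R \<alpha> \<delta> n D loss fhat \<longrightarrow>
          (\<integral>s. risk D loss (fhat s) \<partial>sample_law n D) - risk D loss (projection_pursuit d k w f)
            \<le> C * real k * G * R * \<eta> * (ln (real n) / real n powr (1 / (2 * real \<alpha> + 2)))))
     \<and>
     (\<exists>(c::real) (C::real). c > 0 \<and>
       (\<forall>(d::nat) (k::nat) (n::nat) (R::real) (\<eta>::real) (G::real) w f.
          d \<ge> 1 \<longrightarrow> k \<ge> 1 \<longrightarrow> n \<ge> 1 \<longrightarrow> R > 0 \<longrightarrow> \<eta> > 0 \<longrightarrow> G > 0 \<longrightarrow>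
          projection_pursuit_params d k R \<eta> w f \<longrightarrow>
          (restrict (projection_pursuit d k w f) (input_ball d R) \<in> F1 d R 0 \<and>
           gamma1 d R 0 (restrict (projection_pursuit d k w f) (input_ball d R))
             \<le> ennreal (c * real k * R * \<eta>)) \<and>
          (\<forall>(Y :: 'y measure) D loss fhat (\<delta>::real).
             data_law d R Y D \<longrightarrow>
             \<delta> = c * real k * R * \<eta> \<longrightarrow>
             assumption_L 0 Y D loss G \<delta> \<longrightarrow>
             empirical_minimizer d R 0 \<delta> n D loss fhat \<longrightarrow>
             (\<integral>s. risk D loss (fhat s) \<partial>sample_law n D) - risk D loss (projection_pursuit d k w f)
               \<le> C * (real k * G * R * \<eta> * sqrt (real d) / sqrt (real n)))))"
proof (rule conjI, intro allI impI)
  fix \<alpha> :: nat assume \<alpha>: "\<alpha> \<ge> 1"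
  obtain Ca where Ca: "0 \<le> Ca" and approx: "\<And>d k n R \<eta> w f. 1 \<le> n \<Longrightarrow> 0 < R \<Longrightarrow> 0 < \<eta> \<Longrightarrow> projection_pursuit_params d k R \<eta> w f \<Longrightarrow>
    (\<exists>g\<in>F1_ball d R \<alpha> (real k * \<eta> * R * real n powr (real \<alpha> / (2 * (real \<alpha> + 1)))).
      \<forall>x\<in>input_ball d R. \<bar>g x - projection_pursuit d k w f x\<bar> \<le> Ca * (real k * (\<eta> * R)) * real n powr (- 1 / (2 * real \<alpha> + 2)))"
    using projection_pursuit_approximation[OF \<alpha>] by blast
  define L where "L = real \<alpha> * 3 ^ \<alpha>"
  have L0: "0 \<le> L" by (simp add: L_def)
  show "\<exists>C::real. \<forall>(d::nat) (k::nat) (n::nat) (R::real) (\<eta>::real) (G::real) w f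
            (Y :: 'y measure) D loss fhat (\<delta>::real).
          d \<ge> 1 \<longrightarrow> k \<ge> 1 \<longrightarrow> n \<ge> 2 \<longrightarrow> R > 0 \<longrightarrow> \<eta> > 0 \<longrightarrow> G > 0 \<longrightarrow>
          projection_pursuit_params d k R \<eta> w f \<longrightarrow>
          data_law d R Y D \<longrightarrow>
          \<delta> = real k * \<eta> * R * real n powr (real \<alpha> / (2 * (real \<alpha> + 1))) \<longrightarrow>
          assumption_L \<alpha> Y D loss G \<delta> \<longrightarrow>
          empirical_minimizer d R \<alpha> \<delta> n D loss fhat \<longrightarrow>
          (\<integral>s. risk D loss (fhat s) \<partial>sample_law n D) - risk D loss (projection_pursuit d k w f)
            \<le> C * real k * G * R * \<eta> * (ln (real n) / real n powr (1 / (2 * real \<alpha> + 2)))"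
  \<comment> \<open>24 is the 4 of the deviation bound times the 6 of the Rademacher bound; the 2
    comes from 1 \<le> 2 ln n.\<close>
  proof (rule exI[of _ "2 * (Ca + 24 * L)"], intro allI impI)
    fix d k n :: nat and R \<eta> G :: real and w f and Y :: "'y measure" and D loss fhat and \<delta> :: real
    assume d: "d \<ge> 1" and k: "k \<ge> 1" and n: "n \<ge> 2" and R: "R > 0" and \<eta>: "\<eta> > 0" and G: "G > 0"
      and params: "projection_pursuit_params d k R \<eta> w f" and data: "data_law d R Y D"
      and \<delta>_eq: "\<delta> = real k * \<eta> * R * real n powr (real \<alpha> / (2 * (real \<alpha> + 1)))"
      and assm_L: "assumption_L \<alpha> Y D loss G \<delta>" and erm: "empirical_minimizer d R \<alpha> \<delta> n D loss fhat"
    define X where "X = real k * (\<eta> * R)"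
    define P where "P = real n powr (1 / (2 * real \<alpha> + 2))"
    have X: "0 < X" using k R \<eta> by (simp add: X_def)
    have P: "0 < P" using n by (simp add: P_def)
    have \<delta>X: "X \<le> \<delta>"
    proof -
      have "1 \<le> real n powr (real \<alpha> / (2 * (real \<alpha> + 1)))" using n by (intro ge_one_powr_ge_zero) auto
      then have "X * 1 \<le> X * real n powr (real \<alpha> / (2 * (real \<alpha> + 1)))" using X by (intro mult_left_mono) auto
      then show ?thesis by (simp add: \<delta>_eq X_def mult_ac)
    qed
    have \<delta>: "0 < \<delta>" using X \<delta>X by linarith
    interpret erm_problem d R \<alpha> Y D loss G \<delta> by unfold_locales fact+
    have Pinv: "real n powr (- 1 / (2 * real \<alpha> + 2)) = 1 / P"
      by (simp add: P_def powr_minus_divide)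
    obtain g where g: "g \<in> F1_ball d R \<alpha> \<delta>"
      "\<And>x. x \<in> input_ball d R \<Longrightarrow> \<bar>g x - projection_pursuit d k w f x\<bar> \<le> Ca * X * (1 / P)"
      using approx[OF _ R \<eta> params, of n] n unfolding \<delta>_eq Pinv X_def by auto
    have pp: "predictor (projection_pursuit d k w f)"
      using \<delta>X range_bound_ge by (intro projection_pursuit_predictor[OF params]) (simp add: X_def)
    have "risk D loss g \<le> risk D loss (projection_pursuit d k w f) + G * (Ca * X * (1 / P))"
      using Ca X P by (intro risk_le_risk F1_ball_predictor pp g) auto
    moreover have "(\<integral>s. risk D loss (fhat s) \<partial>sample_law n D) \<le> risk D loss g + 4 * G * \<delta> * (6 * L * sqrt (real n)) / real n"
    proof (rule generalization_bound[OF _ _ _ erm g(1)])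
      fix s V assume "finite V" "V \<noteq> {}" "\<And>v. v \<in> V \<Longrightarrow> L2_set v {..<Suc d} \<le> 2 / R"
      then show "sign_avg n (\<lambda>\<sigma>. Max ((\<lambda>v. \<bar>\<Sum>i<n. \<sigma> i * masked_neuron d R \<alpha> v (s i)\<bar>) ` V)) \<le> 6 * L * sqrt (real n)"
        unfolding L_def using n by (intro rademacher_power_neurons[OF _ _ _ \<alpha> R]) auto
    qed (use n L0 in auto)
    moreover have "4 * G * \<delta> * (6 * L * sqrt (real n)) / real n = 24 * L * G * X * (1 / P)"
    proof -
      \<comment> \<open>The exponent identity behind the choice of \<delta>: \<delta> / sqrt n has
        the same order in \<open>n\<close> as the approximation error, namely 1 / P.\<close>
      have "real n powr (real \<alpha> / (2 * (real \<alpha> + 1))) * sqrt (real n) / real n =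
          real n powr (real \<alpha> / (2 * (real \<alpha> + 1))) * real n powr (1/2) / real n powr 1"
        using n by (simp add: powr_half_sqrt)
      also have "\<dots> = real n powr (real \<alpha> / (2 * (real \<alpha> + 1)) + 1/2 - 1)"
        by (simp only: powr_add powr_diff)
      also have "real \<alpha> / (2 * (real \<alpha> + 1)) + 1/2 - 1 = - 1 / (2 * real \<alpha> + 2)"
        by (simp add: field_simps)
      finally have e: "real n powr (real \<alpha> / (2 * (real \<alpha> + 1))) * sqrt (real n) / real n = 1 / P" unfolding Pinv .
      have "4 * G * \<delta> * (6 * L * sqrt (real n)) / real n =
          24 * L * G * X * (real n powr (real \<alpha> / (2 * (real \<alpha> + 1))) * sqrt (real n) / real n)"
        unfolding \<delta>_eq X_def by simp
      then show ?thesis unfolding e .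
    qed
    ultimately have "(\<integral>s. risk D loss (fhat s) \<partial>sample_law n D) - risk D loss (projection_pursuit d k w f)
        \<le> (Ca + 24 * L) * (G * X * (1 / P))"
      by (simp add: algebra_simps)
    also have "\<dots> \<le> (Ca + 24 * L) * (G * X * (2 * ln (real n) / P))"
    proof -
      have "ln 2 \<le> ln (real n)" using n by (intro ln_mono) auto
      \<comment> \<open>The logarithm enters here: n \<ge> 2 gives ln n \<ge> 2 / 3.\<close>
      then have "1 \<le> 2 * ln (real n)" using ln2_ge_two_thirds by simp
      then have "1 / P \<le> 2 * ln (real n) / P" using P by (intro divide_right_mono) auto
      then show ?thesis using Ca L0 G X by (intro mult_left_mono) auto
    qed
    also have "\<dots> = 2 * (Ca + 24 * L) * real k * G * R * \<eta> * (ln (real n) / P)"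
      by (simp add: X_def)
    finally show "(\<integral>s. risk D loss (fhat s) \<partial>sample_law n D) - risk D loss (projection_pursuit d k w f)
            \<le> 2 * (Ca + 24 * L) * real k * G * R * \<eta> * (ln (real n) / real n powr (1 / (2 * real \<alpha> + 2)))"
      unfolding P_def .
  qed
next
  show "\<exists>(c::real) (C::real). c > 0 \<and>
       (\<forall>(d::nat) (k::nat) (n::nat) (R::real) (\<eta>::real) (G::real) w f.
          d \<ge> 1 \<longrightarrow> k \<ge> 1 \<longrightarrow> n \<ge> 1 \<longrightarrow> R > 0 \<longrightarrow> \<eta> > 0 \<longrightarrow> G > 0 \<longrightarrow>
          projection_pursuit_params d k R \<eta> w f \<longrightarrow>
          (restrict (projection_pursuit d k w f) (input_ball d R) \<in> F1 d R 0 \<and>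
           gamma1 d R 0 (restrict (projection_pursuit d k w f) (input_ball d R))
             \<le> ennreal (c * real k * R * \<eta>)) \<and>
          (\<forall>(Y :: 'y measure) D loss fhat (\<delta>::real).
             data_law d R Y D \<longrightarrow>
             \<delta> = c * real k * R * \<eta> \<longrightarrow>
             assumption_L 0 Y D loss G \<delta> \<longrightarrow>
             empirical_minimizer d R 0 \<delta> n D loss fhat \<longrightarrow>
             (\<integral>s. risk D loss (fhat s) \<partial>sample_law n D) - risk D loss (projection_pursuit d k w f)
               \<le> C * (real k * G * R * \<eta> * sqrt (real d) / sqrt (real n))))"
  \<comment> \<open>3 is the variation bound of the representation, and 624 = 4 * 26 * 3 * 2, the
    last factor from sqrt (d + 1) \<le> 2 sqrt d.\<close>
  proof (rule exI[of _ 3], rule exI[of _ 624], intro conjI allI impI)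
    fix d k n :: nat and R \<eta> G :: real and w f
    assume d: "d \<ge> 1" and k: "k \<ge> 1" and n: "n \<ge> 1" and R: "R > 0" and \<eta>: "\<eta> > 0" and G: "G > 0"
      and params: "projection_pursuit_params d k R \<eta> w f"
    let ?f = "restrict (projection_pursuit d k w f) (input_ball d R)"
    have mem: "?f \<in> F1_ball d R 0 (3 * real k * R * \<eta>)" by (rule projection_pursuit_in_F1_ball[OF params R \<eta>])
    then show "?f \<in> F1 d R 0" "gamma1 d R 0 ?f \<le> ennreal (3 * real k * R * \<eta>)"
      by (auto simp: F1_ball_def)
    fix Y :: "'y measure" and D loss fhat and \<delta> :: real
    assume data: "data_law d R Y D" and \<delta>_eq: "\<delta> = 3 * real k * R * \<eta>"
      and assm_L: "assumption_L 0 Y D loss G \<delta>" and erm: "empirical_minimizer d R 0 \<delta> n D loss fhat"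
    have \<delta>: "0 < \<delta>" using k R \<eta> by (simp add: \<delta>_eq)
    interpret erm_problem d R 0 Y D loss G \<delta> by unfold_locales fact+
    have "real k * (\<eta> * R) \<le> \<delta>" using k R \<eta> by (simp add: \<delta>_eq)
    then have pp: "predictor (projection_pursuit d k w f)"
      using range_bound_ge by (intro projection_pursuit_predictor[OF params]) linarith
    have mem': "?f \<in> F1_ball d R 0 \<delta>" using mem by (simp add: \<delta>_eq)
    \<comment> \<open>The restriction agrees with the target on the ball, so there is no
      approximation error.\<close>
    have "risk D loss ?f \<le> risk D loss (projection_pursuit d k w f) + G * 0"
      by (intro risk_le_risk F1_ball_predictor pp mem') auto
    moreover have "(\<integral>s. risk D loss (fhat s) \<partial>sample_law n D) \<le> risk D loss ?f + 4 * G * \<delta> * (26 * sqrt (real n * real (Suc d))) / real n"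
    proof (rule generalization_bound[OF _ _ _ erm mem'])
      fix s and V :: "(nat \<Rightarrow> real) set" assume "finite V" "V \<noteq> {}"
      then show "sign_avg n (\<lambda>\<sigma>. Max ((\<lambda>v. \<bar>\<Sum>i<n. \<sigma> i * masked_neuron d R 0 v (s i)\<bar>) ` V))
          \<le> 26 * sqrt (real n * real (Suc d))"
        using n by (intro rademacher_threshold_neurons) auto
    qed (use n in auto)
    moreover have "4 * G * \<delta> * (26 * sqrt (real n * real (Suc d))) / real n \<le> 624 * (real k * G * R * \<eta> * sqrt (real d) / sqrt (real n))"
    proof -
      have "real n * real (Suc d) \<le> real n * (2\<^sup>2 * real d)" using d by (intro mult_left_mono) auto
      then have "sqrt (real n * real (Suc d)) \<le> sqrt (real n * (2\<^sup>2 * real d))" by (rule real_sqrt_le_mono)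
      also have "\<dots> = sqrt (real n) * (2 * sqrt (real d))" by (simp only: real_sqrt_mult real_sqrt_abs)
      finally have "sqrt (real n * real (Suc d)) / real n \<le> sqrt (real n) * (2 * sqrt (real d)) / real n"
        by (intro divide_right_mono) auto
      also have "\<dots> = 2 * sqrt (real d) * (sqrt (real n) / real n)" by simp
      also have "sqrt (real n) / real n = 1 / sqrt (real n)"
        by (simp add: sqrt_divide_self_eq inverse_eq_divide)
      finally have s: "sqrt (real n * real (Suc d)) / real n \<le> 2 * sqrt (real d) / sqrt (real n)" by simp
      have "4 * G * \<delta> * (26 * sqrt (real n * real (Suc d))) / real n = 104 * G * \<delta> * (sqrt (real n * real (Suc d)) / real n)"
        by simp
      also have "\<dots> \<le> 104 * G * \<delta> * (2 * sqrt (real d) / sqrt (real n))"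
        using G \<delta> by (intro mult_left_mono s) auto
      also have "\<dots> = 624 * (real k * G * R * \<eta> * sqrt (real d) / sqrt (real n))"
        by (simp add: \<delta>_eq)
      finally show ?thesis .
    qed
    ultimately show "(\<integral>s. risk D loss (fhat s) \<partial>sample_law n D) - risk D loss (projection_pursuit d k w f)
               \<le> 624 * (real k * G * R * \<eta> * sqrt (real d) / sqrt (real n))"
      by simp
  qed simp
qed

end
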